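(* Let $(\Sigma_1,g_1)$ and $(\Sigma_2,g_2)$ be Lorentzian surfaces with Gauss curvatures $\kappa_1,\kappa_2$, let $\epsilon\in\{-1,1\}$, and let $(G^{\epsilon},J,\Omega^{\epsilon})$ be the product para-Kähler structure on $\Sigma_1\times\Sigma_2$. Assume that one of the following holds: (i) the metrics $g_1$ and $g_2$ are both non-flat almost everywhere, and away from flat points $\epsilon\kappa_1\kappa_2<0$ (that is, $\epsilon\kappa_1(x)\kappa_2(y)<0$ for all $x\in\Sigma_1$, $y\in\Sigma_2$ with $\kappa_1(x)\neq0$ and $\kappa_2(y)\neq 0$); (ii) exactly one of the metrics $g_1,g_2$ is flat, while the other is non-flat almost everywhere. Then every $\Omega^{\epsilon}$-Lagrangian surface in $\Sigma_1\times\Sigma_2$ with parallel mean curvature vector (with respect to $G^\epsilon$) is locally a product $\gamma_1\times\gamma_2$, where each curve $\gamma_i\subset\Sigma_i$ has constant curvature.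
   Context: A Lorentzian surface $(\Sigma,g)$ is a connected, oriented smooth 2-manifold with a smooth metric $g$ of signature $(+,-)$. Near any point there are oriented isothermic coordinates $(s,t)$ with $g_{ss}=-g_{tt}>0$, $g_{st}=0$, and the endomorphism $j$ of $T\Sigma$ is given by $j(\partial_s)=\partial_t$, $j(\partial_t)=\partial_s$; it satisfies $j^2=\mathrm{Id}$ and $g(j\cdot,j\cdot)=-g(\cdot,\cdot)$. Put $\omega(\cdot,\cdot)=g(j\cdot,\cdot)$. For $k=1,2$ let $j_k,\omega_k$ be the objects so associated to $(\Sigma_k,g_k)$. Product structure: with $T(\Sigma_1\times\Sigma_2)=T\Sigma_1\oplus T\Sigma_2$, $X=(X_1,X_2)$, $Y=(Y_1,Y_2)$, and $\pi_i:\Sigma_1\times\Sigma_2\to\Sigma_i$ the projections, define $G^{\epsilon}(X,Y)=g_1(X_1,Y_1)+\epsilon\, g_2(X_2,Y_2)$, $J=j_1\oplus j_2$, $\Omega^{\epsilon}=\pi_1^*\omega_1+\epsilon\,\pi_2^*\omega_2$. "Non-flat almost everywhere" means that the set of flat points (points where the Gauss curvature vanishes) has measure zero. An immersion $\Phi:S\to\Sigma_1\times\Sigma_2$ of a surface $S$ is $\Omega^\epsilon$-Lagrangian if $\Phi^*\Omega^\epsilon=0$. Surfaces are assumed nondegenerate (i.e. $\Phi^*G^\epsilon$ is a nondegenerate metric, Riemannian or Lorentzian), so that the mean curvature vector $H$ (half the trace of the second fundamental form) is defined; it is parallel if $\nabla^\perp H=0$ for the normal connection. "Locally a product $\gamma_1\times\gamma_2$"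 means that near each point the immersion can be parametrised as $(s,t)\mapsto(\gamma_1(s),\gamma_2(t))$ with $\gamma_i$ a regular non-null curve in $\Sigma_i$. The curvature $k$ of a non-null curve $\gamma$ parametrised by arclength ($g(\gamma',\gamma')=\pm1$) is defined by $D_{\gamma'}\gamma'=k\,j\gamma'$, with $D$ the Levi-Civita connection of $g$. *)

theory Defs
  imports "HOL-Analysis.Analysis"
begin

subsection \<open>Smooth maps between open subsets of normed spaces\<close>

abbreviation dd :: "('a::real_normed_vector \<Rightarrow> 'b::real_normed_vector) \<Rightarrow> 'a \<Rightarrow> 'a \<Rightarrow> 'b"
  where "dd f x u \<equiv> frechet_derivative f (at x) u"

text \<open>Only meant for open sets \<open>S\<close>; on finite-dimensional spaces this is the usual class
  of k times continuously differentiable functions.\<close>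

primrec Ck_on ::
    "nat \<Rightarrow> 'a::real_normed_vector set \<Rightarrow> ('a \<Rightarrow> 'b::real_normed_vector) \<Rightarrow> bool" where
  "Ck_on 0 S f \<longleftrightarrow> continuous_on S f"
| "Ck_on (Suc k) S f \<longleftrightarrow>
     (\<forall>x\<in>S. f differentiable (at x)) \<and> (\<forall>v. Ck_on k S (\<lambda>x. dd f x v))"

definition smooth_on ::
    "'a::real_normed_vector set \<Rightarrow> ('a \<Rightarrow> 'b::real_normed_vector) \<Rightarrow> bool" where
  "smooth_on S f \<longleftrightarrow> (\<forall>k. Ck_on k S f)"


subsection \<open>Smooth surfaces\<close>

text \<open>A chart is a pair of an open set and a coordinate map on it; the values of the
  coordinate map off this set carry no information. The manifold is the union of the chart
  domains, an open subset of the type.\<close>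

type_synonym 'a chart = "'a set \<times> ('a \<Rightarrow> real^2)"

definition is_chart :: "'a::topological_space chart \<Rightarrow> bool" where
  "is_chart c \<longleftrightarrow> open (fst c) \<and> open (snd c ` fst c) \<and>
     homeomorphism (fst c) (snd c ` fst c) (snd c) (inv_into (fst c) (snd c))"

definition carrier_of :: "'a chart set \<Rightarrow> 'a set" where
  "carrier_of A = (\<Union>c\<in>A. fst c)"

definition transition :: "'a chart \<Rightarrow> 'a chart \<Rightarrow> real^2 \<Rightarrow> real^2" where
  "transition c d = snd d \<circ> inv_into (fst c) (snd c)"

definition smooth_surface ::
    "'a::{t2_space,second_countable_topology} chart set \<Rightarrow> bool" where
  "smooth_surface A \<longleftrightarrow> (\<forall>c\<in>A. is_chart c) \<and>
     (\<forall>c\<in>A. \<forall>d\<in>A. smooth_on (snd c ` (fst c \<inter> fst d)) (transition c d))"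

definition oriented_surface ::
    "'a::{t2_space,second_countable_topology} chart set \<Rightarrow> bool" where
  "oriented_surface A \<longleftrightarrow> smooth_surface A \<and>
     (\<forall>c\<in>A. \<forall>d\<in>A. \<forall>x \<in> snd c ` (fst c \<inter> fst d).
        0 < det (matrix (dd (transition c d) x)))"


subsection \<open>Lorentzian surfaces\<close>

text \<open>A symmetric 2-tensor field is given by its coordinate representation in each chart;
  \<open>g c x u v\<close> is the value on the coordinate vectors \<open>u\<close> and
  \<open>v\<close> at the point of the chart \<open>c\<close> with coordinates
  \<open>x\<close>.\<close>

type_synonym 'e tensor2 = "'e \<Rightarrow> 'e \<Rightarrow> 'e \<Rightarrow> real"

definition lorentzian_form :: "(real^2 \<Rightarrow> real^2 \<Rightarrow> real) \<Rightarrow> bool" where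
  "lorentzian_form b \<longleftrightarrow> bilinear b \<and> (\<forall>u v. b u v = b v u) \<and>
     (\<exists>e f. b e e > 0 \<and> b f f < 0 \<and> b e f = 0)"

definition lorentzian_surface ::
    "'a::{t2_space,second_countable_topology} chart set \<Rightarrow> ('a chart \<Rightarrow> (real^2) tensor2) \<Rightarrow> bool"
where
  "lorentzian_surface A g \<longleftrightarrow>
     oriented_surface A \<and> connected (carrier_of A) \<and>
     (\<forall>c\<in>A. \<forall>x \<in> snd c ` fst c. lorentzian_form (g c x)) \<and>
     (\<forall>c\<in>A. \<forall>u v. smooth_on (snd c ` fst c) (\<lambda>x. g c x u v)) \<and>
     (\<forall>c\<in>A. \<forall>d\<in>A. \<forall>x \<in> snd c ` (fst c \<inter> fst d). \<forall>u v.
        g c x u v =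
        g d (transition c d x) (dd (transition c d) x u) (dd (transition c d) x v))"

text \<open>The endomorphism j of a tangent plane. The bases \<open>(e, f)\<close> below are
  exactly the coordinate bases of oriented isothermic coordinates at the given point; j does
  not depend on the basis chosen (\<open>para_j_well_defined\<close>).\<close>

definition isothermic_basis ::
    "(real^2 \<Rightarrow> real^2 \<Rightarrow> real) \<Rightarrow> real^2 \<Rightarrow> real^2 \<Rightarrow> bool" where
  "isothermic_basis b e f \<longleftrightarrow>
     b e e = - b f f \<and> b e e > 0 \<and> b e f = 0 \<and> det (vector [e, f] :: real^2^2) > 0"

definition para_j :: "(real^2 \<Rightarrow> real^2 \<Rightarrow> real) \<Rightarrow> real^2 \<Rightarrow> real^2" where
  "para_j b = (THE L. linear L \<and> (\<forall>e f. isothermic_basis b e f \<longrightarrow> L e = f \<and> L f = e))"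

lemma isothermic_basis_exists:
  assumes "lorentzian_form b" shows "\<exists>e f. isothermic_basis b e f"
proof -
  from assms obtain e f where bil: "bilinear b" and sym: "\<And>u v. b u v = b v u"
    and ef: "b e e > 0" "b f f < 0" "b e f = 0" by (auto simp: lorentzian_form_def)
  define e' where "e' = (1 / sqrt (b e e)) *\<^sub>R e"
  define f' where "f' = (1 / sqrt (- b f f)) *\<^sub>R f"
  have 1: "b e' e' = 1" "b f' f' = -1" "b e' f' = 0"
    using ef by (auto simp: e'_def f'_def bilinear_lmul[OF bil] bilinear_rmul[OF bil] real_sqrt_mult_self)
  have d: "det (vector [e', f'] :: real^2^2) \<noteq> 0"
  proof
    assume "det (vector [e', f'] :: real^2^2) = 0"
    then have z: "e'$1 * f'$2 = e'$2 * f'$1" by (simp add: det_2)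
    have "(f'$1) *\<^sub>R e' = (e'$1) *\<^sub>R f'" "(f'$2) *\<^sub>R e' = (e'$2) *\<^sub>R f'"
      using z by (auto simp: vec_eq_iff forall_2 algebra_simps)
    then have "b e' ((f'$1) *\<^sub>R e') = b e' ((e'$1) *\<^sub>R f')" "b e' ((f'$2) *\<^sub>R e') = b e' ((e'$2) *\<^sub>R f')" by simp_all
    then have "f'$1 = 0" "f'$2 = 0" using 1 by (auto simp: bilinear_rmul[OF bil])
    then have "f' = 0" by (simp add: vec_eq_iff forall_2)
    then show False using 1 bilinear_lzero[OF bil] by simp
  qed
  show ?thesis
  proof (cases "det (vector [e', f'] :: real^2^2) > 0")
    case True
    then have "isothermic_basis b e' f'" using 1 by (simp add: isothermic_basis_def)
    then show ?thesis by blast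
  next
    case False
    then have "det (vector [e', -f'] :: real^2^2) > 0" using d by (simp add: det_2)
    then have "isothermic_basis b e' (-f')" using 1
      by (auto simp: isothermic_basis_def bilinear_lneg[OF bil] bilinear_rneg[OF bil])
    then show ?thesis by blast
  qed
qed

lemma para_j_well_defined:
  assumes "lorentzian_form b"
  shows "\<exists>!L. linear L \<and> (\<forall>e f. isothermic_basis b e f \<longrightarrow> L e = f \<and> L f = e)"
proof -
  from assms have bil: "bilinear b" and sym: "\<And>u v. b u v = b v u" by (auto simp: lorentzian_form_def)
  obtain e f where ib: "isothermic_basis b e f" using isothermic_basis_exists[OF assms] by blast
  define D where "D = e$1 * f$2 - e$2 * f$1"
  have D: "D > 0" using ib by (simp add: isothermic_basis_def D_def det_2 mult.commute)
  define \<alpha> where "\<alpha> v = (v$1 * f$2 - v$2 * f$1) / D" for v :: "real^2"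
  define \<beta> where "\<beta> v = (e$1 * v$2 - e$2 * v$1) / D" for v :: "real^2"
  have dec: "v = \<alpha> v *\<^sub>R e + \<beta> v *\<^sub>R f" for v
    using D by (auto simp: vec_eq_iff forall_2 \<alpha>_def \<beta>_def divide_simps) (auto simp: D_def algebra_simps)
  define L where "L v = \<alpha> v *\<^sub>R f + \<beta> v *\<^sub>R e" for v
  have lin: "linear L"
    by (rule linearI) (auto simp: L_def \<alpha>_def \<beta>_def vec_eq_iff forall_2 divide_simps algebra_simps)
  have Lp: "L e' = f' \<and> L f' = e'" if ib': "isothermic_basis b e' f'" for e' f'
  proof -
    define a c p q where "a = \<alpha> e'" "c = \<beta> e'" "p = \<alpha> f'" "q = \<beta> f'"
    have e': "e' = a *\<^sub>R e + c *\<^sub>R f" and f': "f' = p *\<^sub>R e + q *\<^sub>R f"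
      using dec a_c_p_q_def by metis+
    define m where "m = b e e"
    have m: "m > 0" "b f f = - m" "b e f = 0" "b f e = 0" using ib sym by (auto simp: isothermic_basis_def m_def)
    note bs = bilinear_ladd[OF bil] bilinear_radd[OF bil] bilinear_lmul[OF bil] bilinear_rmul[OF bil]
    have "b e' e' = m * (a^2 - c^2)" "b f' f' = m * (p^2-q^2)" "b e' f' = m * (a*p - c*q)"
      by (simp_all add: e' f' bs m m_def[symmetric] power2_eq_square algebra_simps)
    moreover have "b e' e' = - b f' f'" "b e' e' > 0" "b e' f' = 0" using ib' by (auto simp: isothermic_basis_def)
    ultimately have "m * (a^2 - c^2) = m * (q^2 - p^2)" "m * (a^2 - c^2) > 0" "m * (a*p - c*q) = 0"
      by (simp_all add: right_diff_distrib)
    then have r: "a^2 - c^2 = q^2 - p^2" "a^2 - c^2 > 0" "a*p = c*q"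
      using m(1) by (simp_all only: mult_cancel_left zero_less_mult_iff mult_eq_0_iff) auto
    have "det (vector [e', f'] :: real^2^2) = (a*q - c*p) * D"
      by (simp add: det_2 e' f' D_def algebra_simps)
    then have d: "a*q - c*p > 0" using ib' D by (auto simp: isothermic_basis_def zero_less_mult_iff)
    have "(a^2-c^2) * (q^2 - a^2) = 0" using r(1,3) by algebra
    then have "q^2 = a^2" using r by simp
    then have qa: "q = a \<or> q = -a" by (simp add: power2_eq_iff)
    have a0: "a \<noteq> 0" using r(2) by auto
    from qa have "q = a \<and> p = c"
    proof
      assume "q = a" then show ?thesis using r(3) a0 by (auto simp: algebra_simps)
    next
      assume q: "q = -a" then have "p = -c" using r(3) a0 by (metis mult.commute mult_cancel_left mult_minus_left mult_minus_right)
      then have "a*q - c*p = - (a^2-c^2)" using q by (simp add: power2_eq_square)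
      then show ?thesis using d r(2) by linarith
    qed
    then show ?thesis
      unfolding L_def a_c_p_q_def[symmetric] using e' f' by (simp add: add.commute)
  qed
  show ?thesis
  proof (rule ex1I[of _ L])
    show "linear L \<and> (\<forall>e f. isothermic_basis b e f \<longrightarrow> L e = f \<and> L f = e)" using lin Lp by blast
    fix L' assume L': "linear L' \<and> (\<forall>e f. isothermic_basis b e f \<longrightarrow> L' e = f \<and> L' f = e)"
    then have "L' v = L v" for v
      using ib by (subst dec) (simp add: linear_add linear_scale L_def)
    then show "L' = L" by auto
  qed
qed

definition para_omega :: "(real^2 \<Rightarrow> real^2 \<Rightarrow> real) \<Rightarrow> real^2 \<Rightarrow> real^2 \<Rightarrow> real" where
  "para_omega b u v = b (para_j b u) v"


subsection \<open>Levi-Civita connection and curvature in coordinates\<close>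

text \<open>The covariant derivative, with respect to the metric \<open>b\<close>, of the field with
  constant components \<open>v\<close> in the direction \<open>u\<close>, determined by the
  Koszul formula.\<close>

definition christoffel ::
    "'e::euclidean_space tensor2 \<Rightarrow> 'e \<Rightarrow> 'e \<Rightarrow> 'e \<Rightarrow> 'e" where
  "christoffel b x u v = (THE w. \<forall>z.
     2 * b x w z = dd (\<lambda>y. b y v z) x u + dd (\<lambda>y. b y u z) x v - dd (\<lambda>y. b y u v) x z)"

text \<open>Covariant derivative of a vector field \<open>W\<close> along a map
  \<open>F\<close> in the direction \<open>u\<close>.\<close>

definition cov_along ::
    "'e::euclidean_space tensor2 \<Rightarrow> ('m::real_normed_vector \<Rightarrow> 'e) \<Rightarrow> ('m \<Rightarrow> 'e) \<Rightarrow> 'm \<Rightarrow> 'm \<Rightarrow> 'e"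
where
  "cov_along b F W x u = dd W x u + christoffel b (F x) (dd F x u) (W x)"

definition riemann ::
    "'e::euclidean_space tensor2 \<Rightarrow> 'e \<Rightarrow> 'e \<Rightarrow> 'e \<Rightarrow> 'e \<Rightarrow> 'e" where
  "riemann b x u v w =
     dd (\<lambda>y. christoffel b y v w) x u - dd (\<lambda>y. christoffel b y u w) x v
     + christoffel b x u (christoffel b x v w) - christoffel b x v (christoffel b x u w)"

definition gauss_curvature :: "(real^2) tensor2 \<Rightarrow> real^2 \<Rightarrow> real" where
  "gauss_curvature b x =
     (let e = axis 1 1; f = axis 2 1 in
      b x (riemann b x e f f) e / (b x e e * b x f f - (b x e f)\<^sup>2))"

definition flat_metric :: "'a chart set \<Rightarrow> ('a chart \<Rightarrow> (real^2) tensor2) \<Rightarrow> bool" where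
  "flat_metric A g \<longleftrightarrow> (\<forall>c\<in>A. \<forall>x \<in> snd c ` fst c. gauss_curvature (g c) x = 0)"

text \<open>A subset of a manifold has measure zero if all its coordinate images do.\<close>

definition nonflat_ae :: "'a chart set \<Rightarrow> ('a chart \<Rightarrow> (real^2) tensor2) \<Rightarrow> bool" where
  "nonflat_ae A g \<longleftrightarrow>
     (\<forall>c\<in>A. negligible {x \<in> snd c ` fst c. gauss_curvature (g c) x = 0})"


subsection \<open>The product structure\<close>

definition prod_metric ::
    "real \<Rightarrow> (real^2) tensor2 \<Rightarrow> (real^2) tensor2 \<Rightarrow> ((real^2) \<times> (real^2)) tensor2" where
  "prod_metric \<epsilon> b1 b2 x u v =
     b1 (fst x) (fst u) (fst v) + \<epsilon> * b2 (snd x) (snd u) (snd v)"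

definition prod_omega ::
    "real \<Rightarrow> (real^2) tensor2 \<Rightarrow> (real^2) tensor2 \<Rightarrow> ((real^2) \<times> (real^2)) tensor2" where
  "prod_omega \<epsilon> b1 b2 x u v =
     para_omega (b1 (fst x)) (fst u) (fst v) + \<epsilon> * para_omega (b2 (snd x)) (snd u) (snd v)"


subsection \<open>Immersed surfaces in the product\<close>

definition pullback :: "('m::real_normed_vector \<Rightarrow> 'e::real_normed_vector) \<Rightarrow> 'e tensor2 \<Rightarrow> 'm tensor2" where
  "pullback F b x u v = b (F x) (dd F x u) (dd F x v)"

definition nondegenerate :: "('m::real_vector \<Rightarrow> 'm \<Rightarrow> real) \<Rightarrow> bool" where
  "nondegenerate h \<longleftrightarrow> (\<forall>u. (\<forall>v. h u v = 0) \<longrightarrow> u = 0)"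

text \<open>The component of \<open>w\<close> orthogonal to the range of \<open>L\<close>.\<close>

definition normal_part :: "('e::real_vector \<Rightarrow> 'e \<Rightarrow> real) \<Rightarrow> ('m \<Rightarrow> 'e) \<Rightarrow> 'e \<Rightarrow> 'e" where
  "normal_part b L w = (THE n. (\<forall>u. b n (L u) = 0) \<and> w - n \<in> range L)"

definition second_fundamental_form ::
    "'e::euclidean_space tensor2 \<Rightarrow> (real^2 \<Rightarrow> 'e) \<Rightarrow> real^2 \<Rightarrow> real^2 \<Rightarrow> real^2 \<Rightarrow> 'e" where
  "second_fundamental_form b F x u v =
     normal_part (b (F x)) (dd F x) (cov_along b F (\<lambda>y. dd F y v) x u)"

definition mean_curvature :: "'e::euclidean_space tensor2 \<Rightarrow> (real^2 \<Rightarrow> 'e) \<Rightarrow> real^2 \<Rightarrow> 'e" where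
  "mean_curvature b F x =
     (let h = matrix_inv (\<chi> i j. pullback F b x (axis i 1) (axis j 1)) in
      (1/2) *\<^sub>R (\<Sum>i\<in>UNIV. \<Sum>j\<in>UNIV.
        (h $ i $ j) *\<^sub>R second_fundamental_form b F x (axis i 1) (axis j 1)))"

definition normal_derivative ::
    "'e::euclidean_space tensor2 \<Rightarrow> (real^2 \<Rightarrow> 'e) \<Rightarrow> (real^2 \<Rightarrow> 'e) \<Rightarrow> real^2 \<Rightarrow> real^2 \<Rightarrow> 'e" where
  "normal_derivative b F N x u = normal_part (b (F x)) (dd F x) (cov_along b F N x u)"

text \<open>The coordinate representation of a map from a surface to a product of two surfaces, and
  the set on which it is meaningful.\<close>

definition local_rep ::
    "('c \<Rightarrow> 'a \<times> 'b) \<Rightarrow> 'c chart \<Rightarrow> 'a chart \<Rightarrow> 'b chart \<Rightarrow> real^2 \<Rightarrow> (real^2) \<times> (real^2)" where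
  "local_rep \<Phi> c c1 c2 x =
     (let q = \<Phi> (inv_into (fst c) (snd c) x) in (snd c1 (fst q), snd c2 (snd q)))"

definition local_dom ::
    "('c \<Rightarrow> 'a \<times> 'b) \<Rightarrow> 'c chart \<Rightarrow> 'a chart \<Rightarrow> 'b chart \<Rightarrow> (real^2) set" where
  "local_dom \<Phi> c c1 c2 = snd c ` {p \<in> fst c. \<Phi> p \<in> fst c1 \<times> fst c2}"

definition immersion ::
    "'c::topological_space chart set \<Rightarrow> 'a::topological_space chart set \<Rightarrow>
     'b::topological_space chart set \<Rightarrow> ('c \<Rightarrow> 'a \<times> 'b) \<Rightarrow> bool" where
  "immersion B A1 A2 \<Phi> \<longleftrightarrow>
     continuous_on (carrier_of B) \<Phi> \<and>
     \<Phi> ` carrier_of B \<subseteq> carrier_of A1 \<times> carrier_of A2 \<and>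
     (\<forall>c\<in>B. \<forall>c1\<in>A1. \<forall>c2\<in>A2.
        smooth_on (local_dom \<Phi> c c1 c2) (local_rep \<Phi> c c1 c2) \<and>
        (\<forall>x \<in> local_dom \<Phi> c c1 c2. inj (dd (local_rep \<Phi> c c1 c2) x)))"

definition nondegenerate_surface ::
    "real \<Rightarrow> 'c chart set \<Rightarrow> 'a chart set \<Rightarrow> ('a chart \<Rightarrow> (real^2) tensor2) \<Rightarrow>
     'b chart set \<Rightarrow> ('b chart \<Rightarrow> (real^2) tensor2) \<Rightarrow> ('c \<Rightarrow> 'a \<times> 'b) \<Rightarrow> bool" where
  "nondegenerate_surface \<epsilon> B A1 g1 A2 g2 \<Phi> \<longleftrightarrow>
     (\<forall>c\<in>B. \<forall>c1\<in>A1. \<forall>c2\<in>A2. \<forall>x \<in> local_dom \<Phi> c c1 c2.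
        nondegenerate (pullback (local_rep \<Phi> c c1 c2) (prod_metric \<epsilon> (g1 c1) (g2 c2)) x))"

definition lagrangian ::
    "real \<Rightarrow> 'c chart set \<Rightarrow> 'a chart set \<Rightarrow> ('a chart \<Rightarrow> (real^2) tensor2) \<Rightarrow>
     'b chart set \<Rightarrow> ('b chart \<Rightarrow> (real^2) tensor2) \<Rightarrow> ('c \<Rightarrow> 'a \<times> 'b) \<Rightarrow> bool" where
  "lagrangian \<epsilon> B A1 g1 A2 g2 \<Phi> \<longleftrightarrow>
     (\<forall>c\<in>B. \<forall>c1\<in>A1. \<forall>c2\<in>A2. \<forall>x \<in> local_dom \<Phi> c c1 c2. \<forall>u v.
        pullback (local_rep \<Phi> c c1 c2) (prod_omega \<epsilon> (g1 c1) (g2 c2)) x u v = 0)"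

definition parallel_mean_curvature ::
    "real \<Rightarrow> 'c chart set \<Rightarrow> 'a chart set \<Rightarrow> ('a chart \<Rightarrow> (real^2) tensor2) \<Rightarrow>
     'b chart set \<Rightarrow> ('b chart \<Rightarrow> (real^2) tensor2) \<Rightarrow> ('c \<Rightarrow> 'a \<times> 'b) \<Rightarrow> bool" where
  "parallel_mean_curvature \<epsilon> B A1 g1 A2 g2 \<Phi> \<longleftrightarrow>
     (\<forall>c\<in>B. \<forall>c1\<in>A1. \<forall>c2\<in>A2. \<forall>x \<in> local_dom \<Phi> c c1 c2. \<forall>u.
        let G = prod_metric \<epsilon> (g1 c1) (g2 c2); F = local_rep \<Phi> c c1 c2 in
        normal_derivative G F (mean_curvature G F) x u = 0)"


subsection \<open>Curves\<close>

definition open_interval :: "real set \<Rightarrow> bool" where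
  "open_interval I \<longleftrightarrow> open I \<and> is_interval I \<and> I \<noteq> {}"

definition velocity :: "'a chart \<Rightarrow> (real \<Rightarrow> 'a) \<Rightarrow> real \<Rightarrow> real^2" where
  "velocity c \<gamma> s = vector_derivative (snd c \<circ> \<gamma>) (at s)"

definition smooth_curve ::
    "'a::topological_space chart set \<Rightarrow> (real \<Rightarrow> 'a) \<Rightarrow> real set \<Rightarrow> bool" where
  "smooth_curve A \<gamma> I \<longleftrightarrow> continuous_on I \<gamma> \<and> \<gamma> ` I \<subseteq> carrier_of A \<and>
     (\<forall>c\<in>A. smooth_on {s\<in>I. \<gamma> s \<in> fst c} (snd c \<circ> \<gamma>))"

definition regular_nonnull_curve ::
    "'a::topological_space chart set \<Rightarrow> ('a chart \<Rightarrow> (real^2) tensor2) \<Rightarrow>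
     (real \<Rightarrow> 'a) \<Rightarrow> real set \<Rightarrow> bool" where
  "regular_nonnull_curve A g \<gamma> I \<longleftrightarrow> smooth_curve A \<gamma> I \<and>
     (\<forall>c\<in>A. \<forall>s\<in>I. \<gamma> s \<in> fst c \<longrightarrow>
        velocity c \<gamma> s \<noteq> 0 \<and>
        g c (snd c (\<gamma> s)) (velocity c \<gamma> s) (velocity c \<gamma> s) \<noteq> 0)"

definition arclength_curve ::
    "'a::topological_space chart set \<Rightarrow> ('a chart \<Rightarrow> (real^2) tensor2) \<Rightarrow>
     (real \<Rightarrow> 'a) \<Rightarrow> real set \<Rightarrow> bool" where
  "arclength_curve A g \<gamma> I \<longleftrightarrow> smooth_curve A \<gamma> I \<and>
     (\<exists>\<eta>\<in>{-1, 1}. \<forall>c\<in>A. \<forall>s\<in>I. \<gamma> s \<in> fst c \<longrightarrow>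
        g c (snd c (\<gamma> s)) (velocity c \<gamma> s) (velocity c \<gamma> s) = \<eta>)"

definition has_curvature ::
    "'a::topological_space chart set \<Rightarrow> ('a chart \<Rightarrow> (real^2) tensor2) \<Rightarrow>
     (real \<Rightarrow> 'a) \<Rightarrow> real set \<Rightarrow> (real \<Rightarrow> real) \<Rightarrow> bool" where
  "has_curvature A g \<gamma> I k \<longleftrightarrow> arclength_curve A g \<gamma> I \<and>
     (\<forall>c\<in>A. \<forall>s\<in>I. \<gamma> s \<in> fst c \<longrightarrow>
        cov_along (g c) (snd c \<circ> \<gamma>) (velocity c \<gamma>) s 1 =
        k s *\<^sub>R para_j (g c (snd c (\<gamma> s))) (velocity c \<gamma> s))"

text \<open>Constant curvature of a curve with arbitrary regular parameter, after
  reparametrisation by arclength.\<close>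

definition constant_curvature ::
    "'a::topological_space chart set \<Rightarrow> ('a chart \<Rightarrow> (real^2) tensor2) \<Rightarrow>
     (real \<Rightarrow> 'a) \<Rightarrow> real set \<Rightarrow> bool" where
  "constant_curvature A g \<gamma> I \<longleftrightarrow>
     (\<exists>J \<theta> k. open_interval J \<and> smooth_on J \<theta> \<and> bij_betw \<theta> J I \<and>
        (\<forall>r\<in>J. vector_derivative \<theta> (at r) \<noteq> 0) \<and>
        has_curvature A g (\<gamma> \<circ> \<theta>) J (\<lambda>_. k))"

text \<open>A diffeomorphism from an open subset of the plane onto an open subset of a surface.\<close>

definition local_parametrisation ::
    "'c::topological_space chart set \<Rightarrow> (real \<times> real) set \<Rightarrow> (real \<times> real \<Rightarrow> 'c) \<Rightarrow> bool" where
  "local_parametrisation B Q \<psi> \<longleftrightarrow>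
     open Q \<and> open (\<psi> ` Q) \<and> \<psi> ` Q \<subseteq> carrier_of B \<and>
     homeomorphism Q (\<psi> ` Q) \<psi> (inv_into Q \<psi>) \<and>
     (\<forall>c\<in>B. smooth_on {q\<in>Q. \<psi> q \<in> fst c} (snd c \<circ> \<psi>) \<and>
        smooth_on (snd c ` (fst c \<inter> \<psi> ` Q)) (inv_into Q \<psi> \<circ> inv_into (fst c) (snd c)))"

definition locally_product_of_constant_curvature_curves ::
    "'c::topological_space chart set \<Rightarrow>
     'a::topological_space chart set \<Rightarrow> ('a chart \<Rightarrow> (real^2) tensor2) \<Rightarrow>
     'b::topological_space chart set \<Rightarrow> ('b chart \<Rightarrow> (real^2) tensor2) \<Rightarrow>
     ('c \<Rightarrow> 'a \<times> 'b) \<Rightarrow> bool" where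
  "locally_product_of_constant_curvature_curves B A1 g1 A2 g2 \<Phi> \<longleftrightarrow>
     (\<forall>p \<in> carrier_of B. \<exists>I1 I2 \<psi> \<gamma>1 \<gamma>2.
        open_interval I1 \<and> open_interval I2 \<and>
        local_parametrisation B (I1 \<times> I2) \<psi> \<and> p \<in> \<psi> ` (I1 \<times> I2) \<and>
        (\<forall>s\<in>I1. \<forall>t\<in>I2. \<Phi> (\<psi> (s, t)) = (\<gamma>1 s, \<gamma>2 t)) \<and>
        regular_nonnull_curve A1 g1 \<gamma>1 I1 \<and> regular_nonnull_curve A2 g2 \<gamma>2 I2 \<and>
        constant_curvature A1 g1 \<gamma>1 I1 \<and> constant_curvature A2 g2 \<gamma>2 I2)"

end

theory Submission
  imports Defs
begin

text \<open>Write a Lorentzian metric locally as \<open>g = \<alpha> \<odot> \<beta>\<close> with null one-forms \<open>\<alpha>\<close>,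
  \<open>\<beta>\<close> satisfying \<open>\<alpha> \<circ> j = \<alpha>\<close>, \<open>\<beta> \<circ> j = - \<beta>\<close>; the Levi-Civita connection is then a single
  one-form \<open>\<theta>\<close> with \<open>d\<alpha> = - \<theta> \<and> \<alpha>\<close>, \<open>d\<beta> = \<theta> \<and> \<beta>\<close>, and \<open>d\<theta> = \<kappa> \<alpha> \<and> \<beta>\<close>.

  Pull the coframes of both factors back by the Lagrangian immersion, to \<open>P, R, \<theta>\<^sub>1\<close> and \<open>Q, S, \<theta>\<^sub>2\<close>.
  Because the tensor \<open>\<Omega>(\<nabla>\<^sub>u X\<^sub>v, X\<^sub>w)\<close> is totally symmetric, the form \<open>a = \<Omega>(H, \<cdot>)\<close> equals
  \<open>1/4 d log (P \<and> Q / R \<and> S) + 1/2 (\<theta>\<^sub>1 + \<theta>\<^sub>2)\<close>. If \<open>H\<close> is parallel, then \<open>a\<close> is closed, so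
  \<open>\<kappa>\<^sub>1 P \<and> R + \<kappa>\<^sub>2 Q \<and> S = 0\<close>; together with the Lagrangian condition \<open>P \<and> R + \<epsilon> Q \<and> S = 0\<close> this gives
  \<open>(\<kappa>\<^sub>1 - \<epsilon> \<kappa>\<^sub>2) P \<and> R = 0\<close>. Where \<open>P \<and> R \<noteq> 0\<close> both projections are local diffeomorphisms, and the
  curvature hypotheses would force both curvatures to vanish on open sets, which is excluded.
  Hence both projections have rank one and the surface is locally a product of curves. For unit speed
  curves with curvatures \<open>k\<^sub>1\<close>, \<open>k\<^sub>2\<close> and arclength parameters \<open>f\<close>, \<open>g\<close> the same formula reads
  \<open>a = 1/2 (k\<^sub>1 df + k\<^sub>2 dg)\<close>, and \<open>\<nabla>a = 0\<close> says that \<open>k\<^sub>1\<close>, \<open>k\<^sub>2\<close> are constant.\<close>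

subsection \<open>Smooth maps\<close>

text \<open>Null coframes take the place of isothermic coordinates because they cost one square root
  and no differential equation, and because they diagonalise j and the connection at once: each null
  direction is governed by a scalar connection form, and the curvature has no quadratic term. A
  nondegenerate Lagrangian tangent plane projects isomorphically onto both eigenbundles of J, so P
  \<and> Q and R \<and> S never vanish, and the trace that defines H turns into a difference of
  their logarithmic derivatives. The factor 1/4 is the 1/2 in the definition of H times the 1/2 left
  over from the determinant 4 \<epsilon> (P \<and> Q)(R \<and> S) of the induced metric. Parallel H
  makes a closed because the derivative of a(w) along u reduces to \<Omega>(H, \<nabla>_u X_w),
  which torsion-freeness makes symmetric in u and w. The relation \<kappa>1 = \<epsilon> \<kappa>2
  gives \<epsilon> \<kappa>1 \<kappa>2 = \<kappa>2^2, never negative: this is where the sign in case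
  (i) enters. Regularity is an issue of its own, since H is defined by a description and a matrix
  inverse; the formula for a is also what shows that H is smooth.\<close>

lemma dd_eqI: "(f has_derivative D) (at x) \<Longrightarrow> dd f x = D"
  by (metis frechet_derivative_at)

lemma dd_works: "f differentiable (at x) \<Longrightarrow> (f has_derivative dd f x) (at x)"
  by (simp add: frechet_derivative_works)

lemma dd_linear: "f differentiable (at x) \<Longrightarrow> linear (dd f x)"
  using dd_works has_derivative_linear by blast

lemma dd_cong_open:
  assumes "open S" "x \<in> S" "\<And>y. y \<in> S \<Longrightarrow> f y = g y"
  shows "dd f x = dd g x"
proof -
  have "(f has_derivative D) (at x) \<longleftrightarrow> (g has_derivative D) (at x)" for D
    using has_derivative_transform_within_open[OF _ assms(1,2)] assms(3) by metis
  then show ?thesis unfolding frechet_derivative_def by simp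
qed

lemma differentiable_cong_open:
  assumes "open S" "x \<in> S" "\<And>y. y \<in> S \<Longrightarrow> f y = g y" "f differentiable (at x)"
  shows "g differentiable (at x)"
  using assms(4) has_derivative_transform_within_open[OF _ assms(1,2)] assms(3) unfolding differentiable_def by blast

lemma Ck_on_cong:
  assumes "open S" "\<And>x. x \<in> S \<Longrightarrow> f x = g x" "Ck_on k S f"
  shows "Ck_on k S g"
  using assms(2,3)
proof (induction k arbitrary: f g)
  case 0
  then show ?case by (simp cong: continuous_on_cong)
next
  case (Suc k)
  have "g differentiable (at x)" if "x \<in> S" for x
    using differentiable_cong_open[OF assms(1) that Suc.prems(1)] Suc.prems(2) that by auto
  moreover have "Ck_on k S (\<lambda>x. dd g x v)" for v
  proof (rule Suc.IH[of "\<lambda>x. dd f x v"])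
    show "dd f x v = dd g x v" if "x \<in> S" for x
      using dd_cong_open[OF assms(1) that, of f g] Suc.prems(1) by metis
  qed (use Suc.prems in auto)
  ultimately show ?case by simp
qed

lemma Ck_on_subset: "Ck_on k S f \<Longrightarrow> T \<subseteq> S \<Longrightarrow> Ck_on k T f"
  by (induction k arbitrary: f) (auto intro: continuous_on_subset)

lemma Ck_on_Suc_imp: "Ck_on (Suc k) S f \<Longrightarrow> Ck_on k S f"
proof (induction k arbitrary: f)
  case 0
  then show ?case
    by (simp add: continuous_at_imp_continuous_on differentiable_imp_continuous_within)
qed auto

lemma Ck_on_SucI:
  assumes "\<And>x. x \<in> S \<Longrightarrow> (f has_derivative f' x) (at x)" "open S" "\<And>v. Ck_on k S (\<lambda>x. f' x v)"
  shows "Ck_on (Suc k) S f"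
proof -
  have "f differentiable (at x)" if "x \<in> S" for x
    using assms(1) that differentiable_def by blast
  moreover have "Ck_on k S (\<lambda>x. dd f x v)" for v
    by (rule Ck_on_cong[OF assms(2) _ assms(3)[of v]]) (simp add: assms(1)[THEN dd_eqI])
  ultimately show ?thesis by simp
qed

lemma Ck_on_SucD:
  assumes "Ck_on (Suc k) S f" "x \<in> S"
  shows "(f has_derivative dd f x) (at x)"
  using assms dd_works by auto

lemma Ck_on_const: "open S \<Longrightarrow> Ck_on k S (\<lambda>x. c)"
  by (induction k arbitrary: c) (auto intro: Ck_on_SucI[OF has_derivative_const])

lemma Ck_on_bounded_linear:
  assumes "bounded_linear L" "open S"
  shows "Ck_on k S L"
proof (cases k)
  case 0
  then show ?thesis using assms linear_continuous_on by auto
next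
  case (Suc m)
  show ?thesis unfolding Suc
    by (rule Ck_on_SucI[OF bounded_linear_imp_has_derivative[OF assms(1)] assms(2)])
      (simp add: Ck_on_const assms(2))
qed


lemma Ck_on_add:
  assumes "open S" "Ck_on k S f" "Ck_on k S g"
  shows "Ck_on k S (\<lambda>x. f x + g x)"
  using assms(2,3)
proof (induction k arbitrary: f g)
  case 0
  then show ?case by (auto intro: continuous_on_add)
next
  case (Suc k)
  show ?case
    by (rule Ck_on_SucI[OF has_derivative_add[OF Ck_on_SucD Ck_on_SucD] assms(1)])
      (use Suc in auto)
qed

lemma Ck_on_bilinear:
  assumes "bounded_bilinear pr" "open S" "Ck_on k S f" "Ck_on k S g"
  shows "Ck_on k S (\<lambda>x. pr (f x) (g x))"
  using assms(3,4)
proof (induction k arbitrary: f g)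
  case 0
  then show ?case by (auto intro: bounded_bilinear.continuous_on[OF assms(1)])
next
  case (Suc k)
  have "Ck_on k S f" "Ck_on k S g"
    using Suc.prems Ck_on_Suc_imp by blast+
  then show ?case
    by (intro Ck_on_SucI[OF bounded_bilinear.FDERIV[OF assms(1) Ck_on_SucD Ck_on_SucD] assms(2)]
        Ck_on_add assms Suc.IH) (use Suc.prems in auto)
qed

lemma Ck_on_sum:
  assumes "open S" "\<And>i. i \<in> I \<Longrightarrow> Ck_on k S (f i)"
  shows "Ck_on k S (\<lambda>x. \<Sum>i\<in>I. f i x)"
  using assms(2)
  by (induction I rule: infinite_finite_induct) (simp_all add: Ck_on_const Ck_on_add assms(1))

lemma linear_basis_expansion:
  fixes L :: "'a::euclidean_space \<Rightarrow> 'b::real_vector"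
  assumes "linear L"
  shows "L v = (\<Sum>b\<in>Basis. (v \<bullet> b) *\<^sub>R L b)"
proof -
  have "L v = L (\<Sum>b\<in>Basis. (v \<bullet> b) *\<^sub>R b)" by (simp add: euclidean_representation)
  then show ?thesis by (simp add: linear_sum[OF assms] linear_scale[OF assms])
qed

text \<open>\<open>Ck_on\<close> only sees derivatives in a fixed direction, while the chain rule
  produces \<open>dd f (g x)\<close> in the moving direction \<open>dd g x v\<close>. Expanding that
  direction in \<open>Basis\<close> returns to fixed directions; hence the Euclidean type in the
  middle.\<close>

lemma Ck_on_compose:
  fixes g :: "'a::real_normed_vector \<Rightarrow> 'b::euclidean_space"
    and f :: "'b \<Rightarrow> 'c::real_normed_vector"
  assumes "open S" "open T" "g ` S \<subseteq> T" "Ck_on k T f" "Ck_on k S g"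
  shows "Ck_on k S (\<lambda>x. f (g x))"
  using assms(4,5)
proof (induction k arbitrary: f)
  case 0
  then show ?case using assms(3) continuous_on_compose2 by auto
next
  case (Suc k)
  have gk: "Ck_on k S g" using Suc.prems Ck_on_Suc_imp by blast
  have der: "((\<lambda>x. f (g x)) has_derivative
      (\<lambda>v. \<Sum>b\<in>Basis. (dd g x v \<bullet> b) *\<^sub>R dd f (g x) b)) (at x)" if x: "x \<in> S" for x
  proof -
    have gx: "(g has_derivative dd g x) (at x)" and fx: "(f has_derivative dd f (g x)) (at (g x))"
      using Ck_on_SucD Suc.prems x assms(3) by blast+
    have "dd f (g x) (dd g x v) = (\<Sum>b\<in>Basis. (dd g x v \<bullet> b) *\<^sub>R dd f (g x) b)" for v
      by (rule linear_basis_expansion[OF has_derivative_linear[OF fx]])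
    then show ?thesis using has_derivative_compose[OF gx fx] by simp
  qed
  have "Ck_on k S (\<lambda>x. dd g x v \<bullet> b)" for v b
    by (rule Ck_on_bilinear[OF bounded_bilinear_inner assms(1)]) (use Suc.prems assms(1) Ck_on_const in auto)
  then show ?case
    by (intro Ck_on_SucI[OF der assms(1)] Ck_on_sum Ck_on_bilinear[OF bounded_bilinear_scaleR]
         Suc.IH assms(1)) (use Suc.prems gk in auto)
qed

lemma Ck_on_inverse:
  fixes f :: "'a::real_normed_vector \<Rightarrow> real"
  assumes "open S" "\<And>x. x \<in> S \<Longrightarrow> f x \<noteq> 0" "Ck_on k S f"
  shows "Ck_on k S (\<lambda>x. inverse (f x))"
  using assms(3)
proof (induction k)
  case 0
  then show ?case using assms(2) by (auto intro: continuous_on_inverse)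
next
  case (Suc k)
  have fk: "Ck_on k S (\<lambda>x. inverse (f x))" using Suc Ck_on_Suc_imp by blast
  have "((\<lambda>x. inverse (f x)) has_derivative
      (\<lambda>v. - 1 *\<^sub>R (inverse (f x) * dd f x v * inverse (f x)))) (at x)" if "x \<in> S" for x
    using Deriv.has_derivative_inverse[OF assms(2) Ck_on_SucD[OF Suc.prems]] that by simp
  then show ?case
  proof (rule Ck_on_SucI[OF _ assms(1)])
    show "Ck_on k S (\<lambda>x. - 1 *\<^sub>R (inverse (f x) * dd f x v * inverse (f x)))" for v
      using Suc.prems
      by (intro Ck_on_bilinear[OF bounded_bilinear_mult assms(1)] fk
        Ck_on_bilinear[OF bounded_bilinear_scaleR assms(1)] Ck_on_const[OF assms(1)]) auto
  qed
qed

lemma Ck_on_sqrt: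
  fixes f :: "'a::real_normed_vector \<Rightarrow> real"
  assumes "open S" "\<And>x. x \<in> S \<Longrightarrow> 0 < f x" "Ck_on k S f"
  shows "Ck_on k S (\<lambda>x. sqrt (f x))"
  using assms(3)
proof (induction k)
  case 0
  then show ?case by (auto intro: continuous_on_real_sqrt)
next
  case (Suc k)
  have fk: "Ck_on k S (\<lambda>x. sqrt (f x))" using Suc Ck_on_Suc_imp by blast
  have der: "((\<lambda>x. sqrt (f x)) has_derivative (\<lambda>v. dd f x v * (inverse (sqrt (f x)) / 2))) (at x)" if "x \<in> S" for x
    using has_derivative_real_sqrt[OF assms(2)[OF that] Ck_on_SucD[OF Suc.prems that]] .
  have "Ck_on k S (\<lambda>x. inverse (sqrt (f x)))"
    using assms(2) by (intro Ck_on_inverse[OF assms(1) _ fk]) fastforce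
  then have "Ck_on k S (\<lambda>x. dd f x v * (inverse (sqrt (f x)) / 2))" for v
    using Suc.prems unfolding divide_inverse
    by (intro Ck_on_bilinear[OF bounded_bilinear_mult assms(1)] Ck_on_const[OF assms(1)]) auto
  then show ?case by (intro Ck_on_SucI[OF der assms(1)])
qed

lemma smooth_onD:
  assumes "smooth_on S f"
  shows "x \<in> S \<Longrightarrow> f differentiable (at x)" "smooth_on S (\<lambda>x. dd f x v)" "continuous_on S f"
  using assms unfolding smooth_on_def by (metis Ck_on.simps)+

lemma smooth_onI:
  assumes "\<And>x. x \<in> S \<Longrightarrow> (f has_derivative f' x) (at x)" "open S" "\<And>v. smooth_on S (\<lambda>x. f' x v)"
  shows "smooth_on S f"
  using Ck_on_SucI[OF assms(1,2)] assms(3) Ck_on_Suc_imp unfolding smooth_on_def by blast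

lemma smooth_on_has_derivative: "smooth_on S f \<Longrightarrow> x \<in> S \<Longrightarrow> (f has_derivative dd f x) (at x)"
  using smooth_onD(1) dd_works by blast

lemma smooth_on_cong: "open S \<Longrightarrow> smooth_on S f \<Longrightarrow> (\<And>x. x \<in> S \<Longrightarrow> f x = g x) \<Longrightarrow> smooth_on S g"
  unfolding smooth_on_def using Ck_on_cong by blast

lemma smooth_on_subset: "smooth_on S f \<Longrightarrow> T \<subseteq> S \<Longrightarrow> smooth_on T f"
  unfolding smooth_on_def using Ck_on_subset by blast

lemma smooth_on_const: "open S \<Longrightarrow> smooth_on S (\<lambda>x. c)"
  unfolding smooth_on_def using Ck_on_const by blast

lemma smooth_on_bounded_linear: "bounded_linear L \<Longrightarrow> open S \<Longrightarrow> smooth_on S L"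
  unfolding smooth_on_def using Ck_on_bounded_linear by blast

lemma smooth_on_id: "open S \<Longrightarrow> smooth_on S (\<lambda>x. x)"
  using smooth_on_bounded_linear bounded_linear_ident by blast

lemma smooth_on_add:
  "open S \<Longrightarrow> smooth_on S f \<Longrightarrow> smooth_on S g \<Longrightarrow> smooth_on S (\<lambda>x. f x + g x)"
  unfolding smooth_on_def using Ck_on_add by blast

lemma smooth_on_bilinear:
  "bounded_bilinear pr \<Longrightarrow> open S \<Longrightarrow> smooth_on S f \<Longrightarrow> smooth_on S g \<Longrightarrow> smooth_on S (\<lambda>x. pr (f x) (g x))"
  unfolding smooth_on_def using Ck_on_bilinear by blast

lemmas smooth_on_scaleR = smooth_on_bilinear[OF bounded_bilinear_scaleR]

lemma smooth_on_mult:
  fixes f g :: "'a::real_normed_vector \<Rightarrow> real"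
  shows "open S \<Longrightarrow> smooth_on S f \<Longrightarrow> smooth_on S g \<Longrightarrow> smooth_on S (\<lambda>x. f x * g x)"
  by (rule smooth_on_bilinear[OF bounded_bilinear_mult])

lemma smooth_on_compose:
  fixes g :: "'a::real_normed_vector \<Rightarrow> 'b::euclidean_space"
  assumes "open S" "open T" "g ` S \<subseteq> T" "smooth_on T f" "smooth_on S g"
  shows "smooth_on S (\<lambda>x. f (g x))"
  using assms Ck_on_compose unfolding smooth_on_def by blast

lemma smooth_on_linear_comp:
  fixes g :: "'a::real_normed_vector \<Rightarrow> 'b::euclidean_space"
  assumes "bounded_linear L" "open S" "smooth_on S g"
  shows "smooth_on S (\<lambda>x. L (g x))"
  using smooth_on_compose[OF assms(2) open_UNIV _ smooth_on_bounded_linear[OF assms(1) open_UNIV] assms(3)]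
  by simp

lemma smooth_on_minus:
  fixes f :: "'a::real_normed_vector \<Rightarrow> 'b::euclidean_space"
  shows "open S \<Longrightarrow> smooth_on S f \<Longrightarrow> smooth_on S (\<lambda>x. - f x)"
  using smooth_on_linear_comp[of uminus] bounded_linear_minus[OF bounded_linear_ident] by blast

lemma smooth_on_diff:
  fixes f g :: "'a::real_normed_vector \<Rightarrow> 'b::euclidean_space"
  shows "open S \<Longrightarrow> smooth_on S f \<Longrightarrow> smooth_on S g \<Longrightarrow> smooth_on S (\<lambda>x. f x - g x)"
  using smooth_on_add[OF _ _ smooth_on_minus, of S f g] by simp

lemma smooth_on_inverse:
  fixes f :: "'a::real_normed_vector \<Rightarrow> real"
  shows "open S \<Longrightarrow> smooth_on S f \<Longrightarrow> (\<And>x. x \<in> S \<Longrightarrow> f x \<noteq> 0) \<Longrightarrow> smooth_on S (\<lambda>x. inverse (f x))"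
  unfolding smooth_on_def using Ck_on_inverse by blast

lemma smooth_on_divide:
  fixes f g :: "'a::real_normed_vector \<Rightarrow> real"
  shows "open S \<Longrightarrow> smooth_on S f \<Longrightarrow> smooth_on S g \<Longrightarrow> (\<And>x. x \<in> S \<Longrightarrow> g x \<noteq> 0) \<Longrightarrow> smooth_on S (\<lambda>x. f x / g x)"
  unfolding divide_inverse by (intro smooth_on_mult smooth_on_inverse)

lemma smooth_on_sqrt:
  fixes f :: "'a::real_normed_vector \<Rightarrow> real"
  shows "open S \<Longrightarrow> smooth_on S f \<Longrightarrow> (\<And>x. x \<in> S \<Longrightarrow> 0 < f x) \<Longrightarrow> smooth_on S (\<lambda>x. sqrt (f x))"
  unfolding smooth_on_def using Ck_on_sqrt by blast

lemma smooth_on_vec_nth: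
  fixes f :: "'a::real_normed_vector \<Rightarrow> real^'n"
  shows "open S \<Longrightarrow> smooth_on S f \<Longrightarrow> smooth_on S (\<lambda>x. f x $ i)"
  by (rule smooth_on_linear_comp[OF bounded_linear_vec_nth])

lemma smooth_on_fst:
  fixes f :: "'a::real_normed_vector \<Rightarrow> 'b::euclidean_space \<times> 'c::euclidean_space"
  shows "open S \<Longrightarrow> smooth_on S f \<Longrightarrow> smooth_on S (\<lambda>x. fst (f x))"
  by (rule smooth_on_linear_comp[OF bounded_linear_fst])

lemma smooth_on_snd:
  fixes f :: "'a::real_normed_vector \<Rightarrow> 'b::euclidean_space \<times> 'c::euclidean_space"
  shows "open S \<Longrightarrow> smooth_on S f \<Longrightarrow> smooth_on S (\<lambda>x. snd (f x))"
  by (rule smooth_on_linear_comp[OF bounded_linear_snd])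

lemma smooth_on_Pair:
  fixes f :: "'a::real_normed_vector \<Rightarrow> 'b::euclidean_space" and g :: "'a \<Rightarrow> 'c::euclidean_space"
  assumes "open S" "smooth_on S f" "smooth_on S g"
  shows "smooth_on S (\<lambda>x. (f x, g x))"
proof -
  have "smooth_on S (\<lambda>x. (f x, 0) + (0, g x))"
    by (intro smooth_on_add smooth_on_linear_comp[of "\<lambda>x. (x, 0)"] smooth_on_linear_comp[of "\<lambda>x. (0, x)"] assms
        bounded_linear_Pair bounded_linear_ident bounded_linear_zero)
  then show ?thesis by simp
qed

lemmas smooth_intros = smooth_on_const smooth_on_id smooth_on_add smooth_on_minus smooth_on_diff
  smooth_on_mult smooth_on_scaleR smooth_on_vec_nth smooth_on_fst smooth_on_snd smooth_on_Pair
  smooth_onD(2)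


subsection \<open>Second derivatives and derivatives of families of forms\<close>

text \<open>The mean value theorem is used once along u and once along v. The second difference does
  not change when u and v are exchanged, which is what makes the second derivative
  symmetric.\<close>

lemma second_difference_mean_value:
  fixes f :: "'a::real_normed_vector \<Rightarrow> real"
  assumes f: "smooth_on S f" and "h > 0"
    and S: "\<And>s t. 0 \<le> s \<Longrightarrow> s \<le> h \<Longrightarrow> 0 \<le> t \<Longrightarrow> t \<le> h \<Longrightarrow> x + s *\<^sub>R u + t *\<^sub>R v \<in> S"
  shows "\<exists>s t. 0 < s \<and> s < h \<and> 0 < t \<and> t < h \<and>
    f (x + h *\<^sub>R u + h *\<^sub>R v) - f (x + h *\<^sub>R u) - f (x + h *\<^sub>R v) + f x =
    h * (h * dd (\<lambda>y. dd f y u) (x + s *\<^sub>R u + t *\<^sub>R v) v)"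
proof -
  have der: "((\<lambda>s. F (y + s *\<^sub>R w)) has_real_derivative dd F (y + s *\<^sub>R w) w) (at s)"
    if F: "smooth_on S F" and y: "y + s *\<^sub>R w \<in> S" for F :: "'a \<Rightarrow> real" and y w s
  proof -
    have "((\<lambda>s. y + s *\<^sub>R w) has_derivative (\<lambda>r. r *\<^sub>R w)) (at s)"
      by (auto intro!: derivative_eq_intros)
    from has_derivative_compose[OF this smooth_on_has_derivative[OF F y]]
    have "((\<lambda>s. F (y + s *\<^sub>R w)) has_derivative (\<lambda>r. dd F (y + s *\<^sub>R w) (r *\<^sub>R w))) (at s)" .
    moreover have "dd F (y + s *\<^sub>R w) (r *\<^sub>R w) = dd F (y + s *\<^sub>R w) w * r" for r
      using linear_scale[OF dd_linear[OF smooth_onD(1)[OF F y]]] by simp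
    ultimately show ?thesis unfolding has_field_derivative_def by simp
  qed
  define g where "g s = f (x + h *\<^sub>R v + s *\<^sub>R u) - f (x + s *\<^sub>R u)" for s
  have "\<exists>s>0. s < h \<and> g h - g 0 = (h - 0) * (dd f (x + h *\<^sub>R v + s *\<^sub>R u) u - dd f (x + s *\<^sub>R u) u)"
  proof (rule MVT2[OF \<open>h > 0\<close>])
    fix s assume "0 \<le> s" "s \<le> h"
    then have "x + h *\<^sub>R v + s *\<^sub>R u \<in> S" "x + s *\<^sub>R u \<in> S"
      using S[of s h] S[of s 0] \<open>h > 0\<close> by (simp_all add: algebra_simps)
    then show "(g has_real_derivative dd f (x + h *\<^sub>R v + s *\<^sub>R u) u - dd f (x + s *\<^sub>R u) u) (at s)"
      unfolding g_def by (intro DERIV_diff der f)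
  qed
  then obtain s where s: "0 < s" "s < h"
    "g h - g 0 = h * (dd f (x + h *\<^sub>R v + s *\<^sub>R u) u - dd f (x + s *\<^sub>R u) u)" by auto
  have "\<exists>t>0. t < h \<and> dd f ((x + s *\<^sub>R u) + h *\<^sub>R v) u - dd f ((x + s *\<^sub>R u) + 0 *\<^sub>R v) u =
      (h - 0) * dd (\<lambda>y. dd f y u) ((x + s *\<^sub>R u) + t *\<^sub>R v) v"
    by (rule MVT2[OF \<open>h > 0\<close> der[OF smooth_onD(2)[OF f]]]) (use s S in auto)
  then obtain t where "0 < t" "t < h" "dd f ((x + s *\<^sub>R u) + h *\<^sub>R v) u - dd f (x + s *\<^sub>R u) u =
      h * dd (\<lambda>y. dd f y u) ((x + s *\<^sub>R u) + t *\<^sub>R v) v" by auto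
  moreover have "f (x + h *\<^sub>R u + h *\<^sub>R v) - f (x + h *\<^sub>R u) - f (x + h *\<^sub>R v) + f x = g h - g 0"
    by (simp add: g_def add.assoc add.commute[of "h *\<^sub>R u"])
  ultimately show ?thesis
    using s by (intro exI[of _ s] exI[of _ t]) (simp add: add.assoc add.commute[of "s *\<^sub>R u"])
qed

lemma dd_commute_real:
  fixes f :: "'a::real_normed_vector \<Rightarrow> real"
  assumes "open S" "x \<in> S" "smooth_on S f"
  shows "dd (\<lambda>y. dd f y u) x v = dd (\<lambda>y. dd f y v) x u"
proof (rule ccontr)
  let ?p = "\<lambda>y. dd (\<lambda>y. dd f y u) y v" and ?q = "\<lambda>y. dd (\<lambda>y. dd f y v) y u"
  assume ne: "?p x \<noteq> ?q x"
  define e where "e = \<bar>?p x - ?q x\<bar> / 2"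
  have e: "e > 0" using ne by (simp add: e_def)
  have "isCont ?p x" "isCont ?q x"
    using smooth_onD(3)[OF smooth_onD(2)[OF smooth_onD(2)[OF assms(3)]]] assms(1,2)
    by (simp_all add: continuous_on_eq_continuous_at)
  then obtain d1 d2 where d: "d1 > 0" "\<And>y. dist y x < d1 \<Longrightarrow> dist (?p y) (?p x) < e"
      "d2 > 0" "\<And>y. dist y x < d2 \<Longrightarrow> dist (?q y) (?q x) < e"
    using e unfolding continuous_at_eps_delta by metis
  obtain r where r: "r > 0" "ball x r \<subseteq> S" using assms(1,2) openE by blast
  define m where "m = min r (min d1 d2)"
  \<comment> \<open>The parallelogram with sides h u and h v has to stay within distance m of x; the
    1 in the denominator keeps it positive when u = v = 0.\<close>
  define h where "h = m / (2 * (norm u + norm v + 1))"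
  have m: "m > 0" using r d by (simp add: m_def)
  have n: "norm u + norm v + 1 > 0" by (smt (verit) norm_ge_zero)
  have h: "h > 0" using m n by (simp add: h_def)
  have near: "dist (x + s *\<^sub>R u' + t *\<^sub>R v') x < m"
    if "0 \<le> s" "s \<le> h" "0 \<le> t" "t \<le> h" "{u',v'} = {u,v}" for s t u' v'
  proof -
    have "norm (s *\<^sub>R u' + t *\<^sub>R v') \<le> s * norm u' + t * norm v'"
      using that by (intro norm_triangle_le) simp
    also have "\<dots> \<le> h * norm u' + h * norm v'"
      using that by (intro add_mono mult_right_mono) auto
    also have "\<dots> = h * (norm u + norm v)" using that(5) by (auto simp: doubleton_eq_iff algebra_simps)
    also have "\<dots> < h * (2 * (norm u + norm v + 1))"
      using h n by (intro mult_strict_left_mono) auto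
    also have "\<dots> = m" using n by (simp add: h_def)
    finally show ?thesis by (simp add: dist_norm add.assoc)
  qed
  have inS: "y \<in> S" if "dist y x < m" for y
    using that r by (auto simp: m_def dist_commute)
  obtain s t where 1: "0 < s" "s < h" "0 < t" "t < h"
    "f (x + h *\<^sub>R u + h *\<^sub>R v) - f (x + h *\<^sub>R u) - f (x + h *\<^sub>R v) + f x = h * (h * ?p (x + s *\<^sub>R u + t *\<^sub>R v))"
    using second_difference_mean_value[OF assms(3) h, of x u v] near[of _ _ u v] inS by auto
  obtain s' t' where 2: "0 < s'" "s' < h" "0 < t'" "t' < h"
    "f (x + h *\<^sub>R v + h *\<^sub>R u) - f (x + h *\<^sub>R v) - f (x + h *\<^sub>R u) + f x = h * (h * ?q (x + s' *\<^sub>R v + t' *\<^sub>R u))"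
    using second_difference_mean_value[OF assms(3) h, of x v u] near[of _ _ v u, OF _ _ _ _ insert_commute] inS by auto
  have "h * (h * ?p (x + s *\<^sub>R u + t *\<^sub>R v)) = h * (h * ?q (x + s' *\<^sub>R v + t' *\<^sub>R u))"
    using 1(5) 2(5) by (simp add: algebra_simps)
  then have "?p (x + s *\<^sub>R u + t *\<^sub>R v) = ?q (x + s' *\<^sub>R v + t' *\<^sub>R u)" using h by simp
  moreover have "dist (?p (x + s *\<^sub>R u + t *\<^sub>R v)) (?p x) < e"
    using near[of s t u v] 1 by (intro d) (simp add: m_def)
  moreover have "dist (?q (x + s' *\<^sub>R v + t' *\<^sub>R u)) (?q x) < e"
    using near[of s' t' v u, OF _ _ _ _ insert_commute] 2 by (intro d) (simp add: m_def)
  ultimately have "\<bar>?p x - ?q x\<bar> < e + e" unfolding dist_real_def by linarith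
  then show False by (simp add: e_def)
qed

lemma dd_bounded_linear:
  assumes "bounded_linear L" "f differentiable (at x)"
  shows "dd (\<lambda>y. L (f y)) x v = L (dd f x v)"
  using dd_eqI[OF bounded_linear.has_derivative[OF assms(1) dd_works[OF assms(2)]]] by simp

lemma dd_commute:
  fixes f :: "'a::real_normed_vector \<Rightarrow> 'b::euclidean_space"
  assumes "open S" "x \<in> S" "smooth_on S f"
  shows "dd (\<lambda>y. dd f y u) x v = dd (\<lambda>y. dd f y v) x u"
proof (rule euclidean_eqI)
  fix b :: 'b assume "b \<in> Basis"
  have bl: "bounded_linear (\<lambda>y. y \<bullet> b)" by (rule bounded_linear_inner_left)
  have "dd (\<lambda>y. dd f y u) x v \<bullet> b = dd (\<lambda>y. dd (\<lambda>z. f z \<bullet> b) y u) x v" for u v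
  proof -
    have "dd (\<lambda>y. dd (\<lambda>z. f z \<bullet> b) y u) x = dd (\<lambda>y. dd f y u \<bullet> b) x"
      by (rule dd_cong_open[OF assms(1,2)])
        (use dd_bounded_linear[OF bl smooth_onD(1)[OF assms(3)]] in simp)
    then show ?thesis
      using dd_bounded_linear[OF bl smooth_onD(1)[OF smooth_onD(2)[OF assms(3)] assms(2)]] by simp
  qed
  moreover have "smooth_on S (\<lambda>z. f z \<bullet> b)"
    by (rule smooth_on_linear_comp[OF bl assms(1,3)])
  ultimately show "dd (\<lambda>y. dd f y u) x v \<bullet> b = dd (\<lambda>y. dd f y v) x u \<bullet> b"
    using dd_commute_real[OF assms(1,2)] by metis
qed

text \<open>Product rule for a point-dependent linear map evaluated on a moving vector. Only the
  derivatives of \<alpha> on fixed vectors are given, so both terms come from expanding the argument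
  in \<open>Basis\<close>.\<close>

lemma linear_family_has_derivative:
  fixes \<alpha> :: "'e::real_normed_vector \<Rightarrow> 'a::euclidean_space \<Rightarrow> 'b::real_normed_vector"
  assumes lin: "eventually (\<lambda>y. linear (\<alpha> y)) (nhds (F x))"
    and dif: "\<And>v. (\<lambda>y. \<alpha> y v) differentiable (at (F x))"
    and F: "F differentiable (at x)" and A: "A differentiable (at x)"
  shows "((\<lambda>y. \<alpha> (F y) (A y)) has_derivative
    (\<lambda>u. dd (\<lambda>y. \<alpha> y (A x)) (F x) (dd F x u) + \<alpha> (F x) (dd A x u))) (at x)"
proof -
  have expand: "\<alpha> y w = (\<Sum>b\<in>Basis. (w \<bullet> b) *\<^sub>R \<alpha> y b)" if "linear (\<alpha> y)" for y w
    using linear_basis_expansion[OF that, of w] .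
  have linx: "linear (\<alpha> (F x))" using lin eventually_nhds_x_imp_x by blast
  have ev: "eventually (\<lambda>y. linear (\<alpha> (F y))) (nhds x)"
  proof -
    have "(F \<longlongrightarrow> F x) (nhds x)"
      using differentiable_imp_continuous_within[OF F] by (simp add: tendsto_at_iff_tendsto_nhds continuous_within)
    then show ?thesis using lin unfolding filterlim_iff by blast
  qed
  have "((\<lambda>y. \<alpha> y (A x)) has_derivative (\<lambda>w. \<Sum>b\<in>Basis. (A x \<bullet> b) *\<^sub>R dd (\<lambda>y. \<alpha> y b) (F x) w)) (at (F x))"
  proof (rule has_derivative_transform_eventually)
    show "((\<lambda>y. \<Sum>b\<in>Basis. (A x \<bullet> b) *\<^sub>R \<alpha> y b) has_derivative (\<lambda>w. \<Sum>b\<in>Basis. (A x \<bullet> b) *\<^sub>R dd (\<lambda>y. \<alpha> y b) (F x) w)) (at (F x))"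
      by (intro has_derivative_sum has_derivative_scaleR_right dd_works dif)
    show "\<forall>\<^sub>F y in at (F x). (\<Sum>b\<in>Basis. (A x \<bullet> b) *\<^sub>R \<alpha> y b) = \<alpha> y (A x)"
      by (rule eventually_mono[OF lin[unfolded eventually_nhds_conv_at, THEN conjunct1]]) (simp only: expand[symmetric])
  qed (simp_all add: expand[OF linx, symmetric])
  then have 1: "dd (\<lambda>y. \<alpha> y (A x)) (F x) w = (\<Sum>b\<in>Basis. (A x \<bullet> b) *\<^sub>R dd (\<lambda>y. \<alpha> y b) (F x) w)" for w
    by (simp add: dd_eqI)
  have "((\<lambda>y. \<Sum>b\<in>Basis. (A y \<bullet> b) *\<^sub>R \<alpha> (F y) b) has_derivative
      (\<lambda>u. \<Sum>b\<in>Basis. (A x \<bullet> b) *\<^sub>R dd (\<lambda>y. \<alpha> y b) (F x) (dd F x u) + (dd A x u \<bullet> b) *\<^sub>R \<alpha> (F x) b)) (at x)"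
    by (intro has_derivative_sum has_derivative_scaleR has_derivative_inner_left dd_works A
        has_derivative_compose[OF dd_works[OF F] dd_works[OF dif]])
  then have "((\<lambda>y. \<Sum>b\<in>Basis. (A y \<bullet> b) *\<^sub>R \<alpha> (F y) b) has_derivative
    (\<lambda>u. dd (\<lambda>y. \<alpha> y (A x)) (F x) (dd F x u) + \<alpha> (F x) (dd A x u))) (at x)"
    unfolding 1 sum.distrib by (subst expand[OF linx, of "dd A x _"])
  then show ?thesis
  proof (rule has_derivative_transform_eventually)
    show "\<forall>\<^sub>F y in at x. (\<Sum>b\<in>Basis. (A y \<bullet> b) *\<^sub>R \<alpha> (F y) b) = \<alpha> (F y) (A y)"
      by (rule eventually_mono[OF ev[unfolded eventually_nhds_conv_at, THEN conjunct1]]) (simp only: expand[symmetric])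
  qed (simp_all add: expand[OF linx, symmetric])
qed

lemma bilinear_family_has_derivative:
  fixes \<beta> :: "'e::real_normed_vector \<Rightarrow> 'a::euclidean_space \<Rightarrow> 'c::euclidean_space \<Rightarrow> real"
  assumes lin: "eventually (\<lambda>y. bilinear (\<beta> y)) (nhds (F x))"
    and dif: "\<And>v w. (\<lambda>y. \<beta> y v w) differentiable (at (F x))"
    and F: "F differentiable (at x)" and A: "A differentiable (at x)" and B: "B differentiable (at x)"
  shows "((\<lambda>y. \<beta> (F y) (A y) (B y)) has_derivative
    (\<lambda>u. dd (\<lambda>y. \<beta> y (A x) (B x)) (F x) (dd F x u) + \<beta> (F x) (A x) (dd B x u) + \<beta> (F x) (dd A x u) (B x))) (at x)"
proof -
  have ev: "eventually (\<lambda>y. bilinear (\<beta> (F y))) (nhds x)"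
  proof -
    have "(F \<longlongrightarrow> F x) (nhds x)"
      using differentiable_imp_continuous_within[OF F] by (simp add: tendsto_at_iff_tendsto_nhds continuous_within)
    then show ?thesis using lin unfolding filterlim_iff by blast
  qed
  have 1: "((\<lambda>y. \<beta> (F y) w (B y)) has_derivative
    (\<lambda>u. dd (\<lambda>y. \<beta> y w (B x)) (F x) (dd F x u) + \<beta> (F x) w (dd B x u))) (at x)" for w
    using lin by (intro linear_family_has_derivative[of "\<lambda>y. \<beta> y w"] dif F B) (auto elim: eventually_mono simp: bilinear_def)
  \<comment> \<open>The rule for linear families is applied a second time, with the identity as base
    map: the family is now z \<mapsto> \<beta> (F z) w (B z), linear in w, and its derivative for
    fixed w is \<open>1\<close>.\<close>
  have "((\<lambda>y. (\<lambda>z w. \<beta> (F z) w (B z)) y (A y)) has_derivative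
    (\<lambda>u. dd (\<lambda>y. \<beta> (F y) (A x) (B y)) x (dd (\<lambda>x. x) x u) + \<beta> (F x) (dd A x u) (B x))) (at x)"
    by (rule linear_family_has_derivative[of "\<lambda>z w. \<beta> (F z) w (B z)" "\<lambda>x. x"])
      (use ev 1 A in \<open>auto elim: eventually_mono simp: bilinear_def differentiable_def\<close>)
  moreover have "dd (\<lambda>x. x) x u = u" for u
    using dd_eqI[OF has_derivative_ident[of "at x"]] by simp
  ultimately show ?thesis using dd_eqI[OF 1] by simp
qed

lemma smooth_on_linear_family:
  fixes \<alpha> :: "'e::euclidean_space \<Rightarrow> 'a::euclidean_space \<Rightarrow> real"
    and F :: "'m::real_normed_vector \<Rightarrow> 'e"
  assumes "open S" "open V" "F ` S \<subseteq> V" "\<And>y. y \<in> V \<Longrightarrow> linear (\<alpha> y)" "\<And>v. smooth_on V (\<lambda>y. \<alpha> y v)"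
    "smooth_on S F" "smooth_on S A"
  shows "smooth_on S (\<lambda>x. \<alpha> (F x) (A x))"
proof (rule smooth_on_cong[OF assms(1)])
  have "smooth_on S (\<lambda>x. A x \<bullet> b)" for b
    by (rule smooth_on_linear_comp[OF bounded_linear_inner_left assms(1,7)])
  moreover have "smooth_on S (\<lambda>x. \<alpha> (F x) b)" for b
    by (rule smooth_on_compose[OF assms(1,2,3) assms(5,6)])
  ultimately show "smooth_on S (\<lambda>x. \<Sum>b\<in>Basis. (A x \<bullet> b) * \<alpha> (F x) b)"
    unfolding smooth_on_def by (intro allI Ck_on_sum[OF assms(1)] Ck_on_bilinear[OF bounded_bilinear_mult assms(1)]) blast+
  show "(\<Sum>b\<in>Basis. (A x \<bullet> b) * \<alpha> (F x) b) = \<alpha> (F x) (A x)" if "x \<in> S" for x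
    using linear_basis_expansion[OF assms(4), of "F x" "A x"] assms(3) that
    unfolding real_scaleR_def by (metis image_subset_iff)
qed


subsection \<open>Product coordinates from the inverse function theorem\<close>

abbreviation ex :: "real^2" where "ex \<equiv> axis 1 1"
abbreviation ey :: "real^2" where "ey \<equiv> axis 2 1"

lemma vec2_expand: "v = v $ 1 *\<^sub>R ex + v $ 2 *\<^sub>R ey"
  by (simp add: vec_eq_iff forall_2 axis_def)

lemma ex_ey_nth [simp]: "ex $ 1 = 1" "ex $ 2 = 0" "ey $ 1 = 0" "ey $ 2 = 1"
  by (simp_all add: axis_def)

lemma linear_expand2:
  fixes L :: "real^2 \<Rightarrow> 'b::real_vector"
  assumes "linear L"
  shows "L v = v $ 1 *\<^sub>R L ex + v $ 2 *\<^sub>R L ey"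
  by (subst vec2_expand[of v]) (simp only: linear_add[OF assms] linear_scale[OF assms])

definition wedge :: "(real^2 \<Rightarrow> real) \<Rightarrow> (real^2 \<Rightarrow> real) \<Rightarrow> real" where
  "wedge p q = p ex * q ey - p ey * q ex"

lemma open_prod_interval:
  fixes q :: "real \<times> real"
  assumes "open W" "q \<in> W"
  obtains a b c d where "a < fst q" "fst q < b" "c < snd q" "snd q < d" "{a<..<b} \<times> {c<..<d} \<subseteq> W"
proof -
  obtain A B where AB: "open A" "open B" "q \<in> A \<times> B" "A \<times> B \<subseteq> W"
    using open_prod_elim[OF assms] by metis
  have "fst q \<in> A" "snd q \<in> B" using AB(3) by auto
  then obtain r t where r: "r > 0" "ball (fst q) r \<subseteq> A" and t: "t > 0" "ball (snd q) t \<subseteq> B"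
    using openE[OF AB(1)] openE[OF AB(2)] by metis
  show thesis
    by (rule that[of "fst q - r" "fst q + r" "snd q - t" "snd q + t"])
      (use r t AB(4) in \<open>auto simp: ball_eq_greaterThanLessThan\<close>)
qed

text \<open>The inverse function theorem gives a differentiable inverse. Its derivative is, by
  Cramer's rule, a smooth function evaluated at \<open>\<zeta>\<close> itself, so each order of
  differentiability yields the next. The target is cut down to an open rectangle so that f and g
  vary independently on U0.\<close>

lemma smooth_local_inverse:
  fixes f g :: "real^2 \<Rightarrow> real"
  assumes U: "open U" "x0 \<in> U" and f: "smooth_on U f" and g: "smooth_on U g"
    and J0: "wedge (dd f x0) (dd g x0) \<noteq> 0"
  obtains U0 a b c d \<zeta> where "open U0" "U0 \<subseteq> U" "x0 \<in> U0"
    "\<And>x. x \<in> U0 \<Longrightarrow> f x \<in> {a<..<b} \<and> g x \<in> {c<..<d} \<and> \<zeta> (f x, g x) = x"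
    "\<And>s t. s \<in> {a<..<b} \<Longrightarrow> t \<in> {c<..<d} \<Longrightarrow> \<zeta> (s, t) \<in> U0 \<and> f (\<zeta> (s, t)) = s \<and> g (\<zeta> (s, t)) = t"
    "smooth_on ({a<..<b} \<times> {c<..<d}) \<zeta>"
    "\<And>x. x \<in> U0 \<Longrightarrow> wedge (dd f x) (dd g x) \<noteq> 0"
proof -
  define J where "J x = wedge (dd f x) (dd g x)" for x
  have Js: "smooth_on U J"
    unfolding J_def wedge_def by (intro smooth_on_diff smooth_on_mult smooth_onD(2) f g U(1))
  define U1 where "U1 = {x \<in> U. J x \<noteq> 0}"
  have U1: "open U1" "x0 \<in> U1" "U1 \<subseteq> U"
    using continuous_open_preimage[OF smooth_onD(3)[OF Js] U(1), of "- {0}"] U(2) J0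
    by (auto simp: U1_def J_def vimage_def Int_def)
  note fd = smooth_on_has_derivative[OF smooth_on_subset[OF f U1(3)]]
  note gd = smooth_on_has_derivative[OF smooth_on_subset[OF g U1(3)]]
  define h where "h x = f x *\<^sub>R ex + g x *\<^sub>R ey" for x
  define h' where "h' x = Blinfun (\<lambda>v. dd f x v *\<^sub>R ex + dd g x v *\<^sub>R ey)" for x
  have hd: "(h has_derivative (\<lambda>v. dd f x v *\<^sub>R ex + dd g x v *\<^sub>R ey)) (at x)" if "x \<in> U1" for x
    unfolding h_def by (intro has_derivative_add has_derivative_scaleR_left fd gd that)
  have h'a: "blinfun_apply (h' x) = (\<lambda>v. dd f x v *\<^sub>R ex + dd g x v *\<^sub>R ey)" if "x \<in> U1" for x
    unfolding h'_def by (rule bounded_linear_Blinfun_apply[OF has_derivative_bounded_linear[OF hd[OF that]]])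
  have 1: "(h has_derivative blinfun_apply (h' x)) (at x)" if "x \<in> U1" for x
    using hd[OF that] h'a[OF that] by simp
  have 2: "continuous_on U1 h'"
  proof (rule continuous_on_blinfun_componentwise)
    fix v :: "real^2"
    have "continuous_on U1 (\<lambda>x. dd f x v *\<^sub>R ex + dd g x v *\<^sub>R ey)"
      by (intro continuous_intros smooth_onD(3) smooth_onD(2) smooth_on_subset[OF f U1(3)] smooth_on_subset[OF g U1(3)])
    then show "continuous_on U1 (\<lambda>x. blinfun_apply (h' x) v)"
      by (rule continuous_on_eq) (simp add: h'a)
  qed
  \<comment> \<open>Cramer's rule for the inverse of the Jacobian matrix of (f, g) at x0.\<close>
  define k where "k w = ((w$1 * dd g x0 ey - w$2 * dd f x0 ey) / J x0) *\<^sub>R ex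
     + ((w$2 * dd f x0 ex - w$1 * dd g x0 ex) / J x0) *\<^sub>R ey" for w :: "real^2"
  have "linear k"
    by (rule linearI) (simp_all add: k_def vec_eq_iff forall_2 add_divide_distrib diff_divide_distrib algebra_simps)
  then have kB: "blinfun_apply (Blinfun k) = k"
    by (intro bounded_linear_Blinfun_apply) (simp add: linear_conv_bounded_linear)
  have 3: "Blinfun k o\<^sub>L h' x0 = id_blinfun"
  proof (rule blinfun_eqI)
    fix v :: "real^2"
    have "dd f x0 v = v$1 * dd f x0 ex + v$2 * dd f x0 ey" "dd g x0 v = v$1 * dd g x0 ex + v$2 * dd g x0 ey"
      using linear_expand2[OF has_derivative_linear[OF fd[OF U1(2)]], of v]
        linear_expand2[OF has_derivative_linear[OF gd[OF U1(2)]], of v] by simp_all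
    then have "k (dd f x0 v *\<^sub>R ex + dd g x0 v *\<^sub>R ey) = v"
      using J0 unfolding k_def
      by (simp add: vec_eq_iff forall_2 J_def divide_simps) (simp add: wedge_def algebra_simps)
    then show "blinfun_apply (Blinfun k o\<^sub>L h' x0) v = blinfun_apply id_blinfun v"
      by (simp add: kB h'a[OF U1(2)])
  qed
  obtain U' V k0 k0' where iv: "open U'" "U' \<subseteq> U1" "x0 \<in> U'" "open V" "h x0 \<in> V" "homeomorphism U' V h k0"
    "\<And>y. y \<in> V \<Longrightarrow> (k0 has_derivative k0' y) (at y)"
    using inverse_function_theorem[OF U1(1) 1 2 U1(2) 3] by metis
  define \<iota> where "\<iota> q = fst q *\<^sub>R ex + snd q *\<^sub>R ey" for q :: "real \<times> real"
  have \<iota>d: "(\<iota> has_derivative \<iota>) (at q)" for q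
    unfolding \<iota>_def by (auto intro!: derivative_eq_intros)
  have "open {q. \<iota> q \<in> V}"
    using continuous_open_vimage[OF iv(4), of \<iota>] has_derivative_continuous[OF \<iota>d] by (simp add: vimage_def)
  moreover have "(f x0, g x0) \<in> {q. \<iota> q \<in> V}" using iv(5) by (simp add: \<iota>_def h_def)
  ultimately obtain a b c d where ab: "a < f x0" "f x0 < b" "c < g x0" "g x0 < d"
    "{a<..<b} \<times> {c<..<d} \<subseteq> {q. \<iota> q \<in> V}"
    by (rule open_prod_interval) simp
  define Q where "Q = {a<..<b} \<times> {c<..<d}"
  define \<zeta> where "\<zeta> q = k0 (\<iota> q)" for q
  define U0 where "U0 = {x \<in> U'. f x \<in> {a<..<b} \<and> g x \<in> {c<..<d}}"
  have oQ: "open Q" by (simp add: Q_def open_Times)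
  have U'U: "U' \<subseteq> U" using iv(2) U1(3) by blast
  have "U0 = (U' \<inter> f -` {a<..<b}) \<inter> (U' \<inter> g -` {c<..<d})" by (auto simp: U0_def)
  then have oU0: "open U0"
    using continuous_open_preimage[OF smooth_onD(3)[OF smooth_on_subset[OF f U'U]] iv(1)]
      continuous_open_preimage[OF smooth_onD(3)[OF smooth_on_subset[OF g U'U]] iv(1)]
    by (metis open_Int open_greaterThanLessThan)
  have left: "\<zeta> (f x, g x) = x" if "x \<in> U'" for x
    using homeomorphism_apply1[OF iv(6) that] by (simp add: \<zeta>_def \<iota>_def h_def)
  have right: "\<zeta> q \<in> U' \<and> f (\<zeta> q) = fst q \<and> g (\<zeta> q) = snd q" if "q \<in> Q" for q
  proof -
    have "\<iota> q \<in> V" using that ab(5) by (auto simp: Q_def)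
    then have "k0 (\<iota> q) \<in> U'" "h (k0 (\<iota> q)) = \<iota> q"
      using iv(6) by (auto simp: homeomorphism_def)
    then show ?thesis by (simp add: \<zeta>_def h_def \<iota>_def vec_eq_iff forall_2)
  qed
  have rU0: "\<zeta> q \<in> U0" if "q \<in> Q" for q
    using right[OF that] that by (auto simp: U0_def Q_def)
  have zd: "(\<zeta> has_derivative (\<lambda>w. ((fst w * dd g (\<zeta> q) ey - snd w * dd f (\<zeta> q) ey) * inverse (J (\<zeta> q))) *\<^sub>R ex
     + ((snd w * dd f (\<zeta> q) ex - fst w * dd g (\<zeta> q) ex) * inverse (J (\<zeta> q))) *\<^sub>R ey)) (at q)"
    if q: "q \<in> Q" for q
  proof -
    have "\<iota> q \<in> V" using that ab(5) by (auto simp: Q_def)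
    then have "(\<zeta> has_derivative (\<lambda>w. k0' (\<iota> q) (\<iota> w))) (at q)"
      unfolding \<zeta>_def using has_derivative_compose[OF \<iota>d iv(7)] by blast
    then have D: "(\<zeta> has_derivative dd \<zeta> q) (at q)" using dd_works differentiable_def by blast
    have x1: "\<zeta> q \<in> U1" using right[OF q] iv(2) by blast
    have "dd f (\<zeta> q) (dd \<zeta> q w) = fst w" "dd g (\<zeta> q) (dd \<zeta> q w) = snd w" for w
    proof -
      have "(\<lambda>w. dd f (\<zeta> q) (dd \<zeta> q w)) = dd (\<lambda>q. f (\<zeta> q)) q"
        using dd_eqI[OF has_derivative_compose[OF D fd[OF x1]]] by simp
      also have "\<dots> = dd fst q"
        by (rule dd_cong_open[OF oQ q]) (simp add: right)
      also have "\<dots> = fst" by (intro dd_eqI bounded_linear_imp_has_derivative bounded_linear_fst)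
      finally show "dd f (\<zeta> q) (dd \<zeta> q w) = fst w" by (rule fun_cong)
      have "(\<lambda>w. dd g (\<zeta> q) (dd \<zeta> q w)) = dd (\<lambda>q. g (\<zeta> q)) q"
        using dd_eqI[OF has_derivative_compose[OF D gd[OF x1]]] by simp
      also have "\<dots> = dd snd q"
        by (rule dd_cong_open[OF oQ q]) (simp add: right)
      also have "\<dots> = snd" by (intro dd_eqI bounded_linear_imp_has_derivative bounded_linear_snd)
      finally show "dd g (\<zeta> q) (dd \<zeta> q w) = snd w" by (rule fun_cong)
    qed
    then have eq: "dd \<zeta> q w $ 1 * dd f (\<zeta> q) ex + dd \<zeta> q w $ 2 * dd f (\<zeta> q) ey = fst w"
      "dd \<zeta> q w $ 1 * dd g (\<zeta> q) ex + dd \<zeta> q w $ 2 * dd g (\<zeta> q) ey = snd w" for w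
      using linear_expand2[OF has_derivative_linear[OF fd[OF x1]], of "dd \<zeta> q w"]
        linear_expand2[OF has_derivative_linear[OF gd[OF x1]], of "dd \<zeta> q w"] by simp_all
    have "J (\<zeta> q) \<noteq> 0" using x1 by (simp add: U1_def)
    moreover have "dd \<zeta> q w $ 1 * J (\<zeta> q) = fst w * dd g (\<zeta> q) ey - snd w * dd f (\<zeta> q) ey"
      "dd \<zeta> q w $ 2 * J (\<zeta> q) = snd w * dd f (\<zeta> q) ex - fst w * dd g (\<zeta> q) ex" for w
      unfolding eq[of w, symmetric] J_def wedge_def by (simp_all add: algebra_simps)
    ultimately have "dd \<zeta> q w $ 1 = (fst w * dd g (\<zeta> q) ey - snd w * dd f (\<zeta> q) ey) * inverse (J (\<zeta> q))"
      "dd \<zeta> q w $ 2 = (snd w * dd f (\<zeta> q) ex - fst w * dd g (\<zeta> q) ex) * inverse (J (\<zeta> q))" for w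
      by (metis mult.assoc mult.right_neutral right_inverse)+
    then have "dd \<zeta> q w = ((fst w * dd g (\<zeta> q) ey - snd w * dd f (\<zeta> q) ey) * inverse (J (\<zeta> q))) *\<^sub>R ex
     + ((snd w * dd f (\<zeta> q) ex - fst w * dd g (\<zeta> q) ex) * inverse (J (\<zeta> q))) *\<^sub>R ey" for w
      by (simp add: vec_eq_iff forall_2)
    then have "dd \<zeta> q = (\<lambda>w. ((fst w * dd g (\<zeta> q) ey - snd w * dd f (\<zeta> q) ey) * inverse (J (\<zeta> q))) *\<^sub>R ex
     + ((snd w * dd f (\<zeta> q) ex - fst w * dd g (\<zeta> q) ex) * inverse (J (\<zeta> q))) *\<^sub>R ey)" by blast
    then show ?thesis using D by simp
  qed
  have sm: "smooth_on U1 (\<lambda>x. ((s * dd g x ey - t * dd f x ey) * inverse (J x)) *\<^sub>R ex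
     + ((t * dd f x ex - s * dd g x ex) * inverse (J x)) *\<^sub>R ey)" for s t
    by (intro smooth_on_add smooth_on_scaleR smooth_on_mult smooth_on_diff smooth_on_const smooth_onD(2)
        smooth_on_inverse U1(1) smooth_on_subset[OF f U1(3)] smooth_on_subset[OF g U1(3)]
        smooth_on_subset[OF Js U1(3)]) (simp_all add: U1_def)
  have "Ck_on k Q \<zeta>" for k
  proof (induction k)
    case 0
    show ?case by (auto intro!: continuous_at_imp_continuous_on has_derivative_continuous[OF zd])
  next
    case (Suc k)
    have "\<zeta> ` Q \<subseteq> U1" using right iv(2) by blast
    then show ?case
      using sm unfolding smooth_on_def
      by (intro Ck_on_SucI[OF zd oQ] Ck_on_compose[OF oQ U1(1) _ _ Suc, where f = "\<lambda>x. ((fst v * dd g x ey - snd v * dd f x ey) * inverse (J x)) *\<^sub>R ex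
         + ((snd v * dd f x ex - fst v * dd g x ex) * inverse (J x)) *\<^sub>R ey" for v]) auto
  qed
  then have "smooth_on Q \<zeta>" by (simp add: smooth_on_def)
  moreover have "x0 \<in> U0" using iv(3) ab by (simp add: U0_def)
  moreover have "wedge (dd f x) (dd g x) \<noteq> 0" if "x \<in> U0" for x
    using that iv(2) by (auto simp: U0_def U1_def J_def)
  moreover have "U0 \<subseteq> U" using U'U by (auto simp: U0_def)
  moreover have "f x \<in> {a<..<b} \<and> g x \<in> {c<..<d} \<and> \<zeta> (f x, g x) = x" if "x \<in> U0" for x
    using that left by (simp add: U0_def)
  moreover have "\<zeta> (s, t) \<in> U0 \<and> f (\<zeta> (s, t)) = s \<and> g (\<zeta> (s, t)) = t"
    if "s \<in> {a<..<b}" "t \<in> {c<..<d}" for s t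
    using right[of "(s, t)"] rU0[of "(s, t)"] that by (simp add: Q_def)
  ultimately show thesis
    using that[of U0 a b c d \<zeta>] oU0 by (simp add: Q_def)
qed

text \<open>The path w stays on one level set of f, so its velocity lies in the kernel of df and
  hence in that of d\<phi>.\<close>

lemma constant_on_fibre:
  fixes \<phi> :: "real^2 \<Rightarrow> 'n::euclidean_space" and f :: "real^2 \<Rightarrow> real" and w :: "real \<Rightarrow> real^2"
  assumes f: "smooth_on U f" and \<phi>: "smooth_on U \<phi>"
    and ker: "\<And>x v. x \<in> U \<Longrightarrow> dd f x v = 0 \<Longrightarrow> dd \<phi> x v = 0"
    and w: "\<And>t. t \<in> {p<..<q} \<Longrightarrow> w differentiable (at t) \<and> w t \<in> U \<and> f (w t) = k"
    and t: "t \<in> {p<..<q}" "t' \<in> {p<..<q}"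
  shows "\<phi> (w t) = \<phi> (w t')"
proof (rule has_derivative_zero_unique[of "{p<..<q}" "\<lambda>t. \<phi> (w t)"])
  fix r assume r: "r \<in> {p<..<q}"
  then have wr: "(w has_derivative dd w r) (at r)" "w r \<in> U" using w dd_works by blast+
  have "(\<lambda>v. dd f (w r) (dd w r v)) = dd (\<lambda>t. f (w t)) r"
    using dd_eqI[OF has_derivative_compose[OF wr(1) smooth_on_has_derivative[OF f wr(2)]]] by simp
  also have "\<dots> = dd (\<lambda>t. k) r" by (rule dd_cong_open[OF _ r]) (use w in auto)
  also have "\<dots> = (\<lambda>v. 0)" by (intro dd_eqI has_derivative_const)
  finally have "dd f (w r) (dd w r v) = 0" for v by meson
  then have "dd \<phi> (w r) (dd w r v) = 0" for v using ker wr(2) by blast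
  then have "((\<lambda>t. \<phi> (w t)) has_derivative (\<lambda>v. 0)) (at r)"
    using has_derivative_compose[OF wr(1) smooth_on_has_derivative[OF \<phi> wr(2)]] by simp
  then show "((\<lambda>t. \<phi> (w t)) has_derivative (\<lambda>v. 0)) (at r within {p<..<q})"
    by (rule has_derivative_at_withinI)
qed (use t in auto)

text \<open>If ker df lies in ker d\<phi>, then \<phi> is constant along connected pieces of the
  fibres of f. In the rectangle a whole fibre is one segment s = const, so \<phi> is a function of f
  on all of U0; \<open>\<gamma>1\<close> reads it off on the slice g = g x0, and
  \<open>\<gamma>2\<close> reads \<psi> off on f = f x0.\<close>

lemma product_coordinates:
  fixes f g :: "real^2 \<Rightarrow> real" and \<phi> \<psi> :: "real^2 \<Rightarrow> 'n::euclidean_space"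
  assumes U: "open U" "x0 \<in> U" and f: "smooth_on U f" and g: "smooth_on U g"
    and J0: "wedge (dd f x0) (dd g x0) \<noteq> 0"
    and \<phi>: "smooth_on U \<phi>" and \<psi>: "smooth_on U \<psi>"
    and ker\<phi>: "\<And>x v. x \<in> U \<Longrightarrow> dd f x v = 0 \<Longrightarrow> dd \<phi> x v = 0"
    and ker\<psi>: "\<And>x v. x \<in> U \<Longrightarrow> dd g x v = 0 \<Longrightarrow> dd \<psi> x v = 0"
  obtains U0 a b c d \<zeta> \<gamma>1 \<gamma>2 where "open U0" "U0 \<subseteq> U" "x0 \<in> U0"
    "\<And>x. x \<in> U0 \<Longrightarrow> f x \<in> {a<..<b} \<and> g x \<in> {c<..<d} \<and> \<zeta> (f x, g x) = x"
    "\<And>s t. s \<in> {a<..<b} \<Longrightarrow> t \<in> {c<..<d} \<Longrightarrow> \<zeta> (s, t) \<in> U0 \<and> f (\<zeta> (s, t)) = s \<and> g (\<zeta> (s, t)) = t"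
    "smooth_on ({a<..<b} \<times> {c<..<d}) \<zeta>"
    "\<And>x. x \<in> U0 \<Longrightarrow> wedge (dd f x) (dd g x) \<noteq> 0"
    "smooth_on {a<..<b} \<gamma>1" "smooth_on {c<..<d} \<gamma>2"
    "\<And>x. x \<in> U0 \<Longrightarrow> \<phi> x = \<gamma>1 (f x) \<and> \<psi> x = \<gamma>2 (g x)"
proof -
  obtain U0 a b c d \<zeta> where U0: "open U0" "U0 \<subseteq> U" "x0 \<in> U0"
    "\<And>x. x \<in> U0 \<Longrightarrow> f x \<in> {a<..<b} \<and> g x \<in> {c<..<d} \<and> \<zeta> (f x, g x) = x"
    "\<And>s t. s \<in> {a<..<b} \<Longrightarrow> t \<in> {c<..<d} \<Longrightarrow> \<zeta> (s, t) \<in> U0 \<and> f (\<zeta> (s, t)) = s \<and> g (\<zeta> (s, t)) = t"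
    and z: "smooth_on ({a<..<b} \<times> {c<..<d}) \<zeta>"
    and J: "\<And>x. x \<in> U0 \<Longrightarrow> wedge (dd f x) (dd g x) \<noteq> 0"
    by (rule smooth_local_inverse[OF U f g J0]) (rule that, assumption+)
  have x0: "f x0 \<in> {a<..<b}" "g x0 \<in> {c<..<d}" using U0(3,4) by blast+
  have s1: "smooth_on {a<..<b} (\<lambda>s. \<zeta> (s, t))" if "t \<in> {c<..<d}" for t
    by (rule smooth_on_compose[OF _ _ _ z]) (use that in \<open>auto intro!: smooth_intros simp: open_Times\<close>)
  have s2: "smooth_on {c<..<d} (\<lambda>t. \<zeta> (s, t))" if "s \<in> {a<..<b}" for s
    by (rule smooth_on_compose[OF _ _ _ z]) (use that in \<open>auto intro!: smooth_intros simp: open_Times\<close>)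
  define \<gamma>1 where "\<gamma>1 s = \<phi> (\<zeta> (s, g x0))" for s
  define \<gamma>2 where "\<gamma>2 t = \<psi> (\<zeta> (f x0, t))" for t
  have "smooth_on {a<..<b} \<gamma>1"
    unfolding \<gamma>1_def by (rule smooth_on_compose[OF _ U(1) _ \<phi> s1]) (use x0 U0 in auto)
  moreover have "smooth_on {c<..<d} \<gamma>2"
    unfolding \<gamma>2_def by (rule smooth_on_compose[OF _ U(1) _ \<psi> s2]) (use x0 U0 in auto)
  moreover have "\<phi> x = \<gamma>1 (f x) \<and> \<psi> x = \<gamma>2 (g x)" if x: "x \<in> U0" for x
  proof -
    have fx: "f x \<in> {a<..<b}" "g x \<in> {c<..<d}" "\<zeta> (f x, g x) = x" using U0(4)[OF x] by auto
    have "\<phi> (\<zeta> (f x, g x)) = \<phi> (\<zeta> (f x, g x0))"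
    proof (rule constant_on_fibre[OF f \<phi> ker\<phi>, of c d "\<lambda>t. \<zeta> (f x, t)" "f x"])
      show "(\<lambda>t. \<zeta> (f x, t)) differentiable at t \<and> \<zeta> (f x, t) \<in> U \<and> f (\<zeta> (f x, t)) = f x"
        if "t \<in> {c<..<d}" for t
        using smooth_onD(1)[OF s2[OF fx(1)] that] U0(2) U0(5)[OF fx(1) that] by auto
    qed (use fx x0 in auto)
    moreover have "\<psi> (\<zeta> (f x, g x)) = \<psi> (\<zeta> (f x0, g x))"
    proof (rule constant_on_fibre[OF g \<psi> ker\<psi>, of a b "\<lambda>s. \<zeta> (s, g x)" "g x"])
      show "(\<lambda>s. \<zeta> (s, g x)) differentiable at s \<and> \<zeta> (s, g x) \<in> U \<and> g (\<zeta> (s, g x)) = g x"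
        if "s \<in> {a<..<b}" for s
        using smooth_onD(1)[OF s1[OF fx(2)] that] U0(2) U0(5)[OF that fx(2)] by auto
    qed (use fx x0 in auto)
    ultimately show ?thesis using fx(3) by (simp add: \<gamma>1_def \<gamma>2_def)
  qed
  ultimately show thesis
    using that[of U0 a b c d \<zeta> \<gamma>1 \<gamma>2, OF U0 z J] by simp
qed

section \<open>Smooth antiderivatives on an interval\<close>

lemma smooth_on_real_derivative:
  fixes \<sigma> \<rho> :: "real \<Rightarrow> real"
  assumes "open S" "\<And>s. s \<in> S \<Longrightarrow> (\<sigma> has_real_derivative \<rho> s) (at s)" "smooth_on S \<rho>"
  shows "smooth_on S \<sigma>"
  by (rule smooth_onI[OF assms(2)[unfolded has_field_derivative_def] assms(1)])
    (auto intro!: smooth_intros assms(1,3))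

lemma smooth_antiderivative:
  fixes \<rho> :: "real \<Rightarrow> real"
  assumes "smooth_on {a<..<b} \<rho>"
  obtains \<sigma> where "smooth_on {a<..<b} \<sigma>" "\<And>s. s \<in> {a<..<b} \<Longrightarrow> (\<sigma> has_real_derivative \<rho> s) (at s)"
proof (cases "a < b")
  case True
  have "isCont \<rho> s" if "a < s" "s < b" for s
    using smooth_onD(3)[OF assms] that by (simp add: continuous_on_eq_continuous_at)
  then obtain \<sigma> where "\<And>s. a < s \<Longrightarrow> s < b \<Longrightarrow> (\<sigma> has_vector_derivative \<rho> s) (at s)"
    using einterval_antiderivative[of "ereal a" "ereal b" \<rho>] True by (auto simp: less_ereal.simps)
  then have "\<And>s. s \<in> {a<..<b} \<Longrightarrow> (\<sigma> has_real_derivative \<rho> s) (at s)"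
    by (simp add: has_real_derivative_iff_has_vector_derivative)
  then show thesis
    by (intro that[of \<sigma>] smooth_on_real_derivative[OF open_greaterThanLessThan _ assms])
next
  case False
  then show thesis using that[of "\<lambda>_. 0"] smooth_on_const by auto
qed


subsection \<open>Null coframes of a Lorentzian metric\<close>

definition koszul :: "'e::euclidean_space tensor2 \<Rightarrow> 'e \<Rightarrow> 'e \<Rightarrow> 'e \<Rightarrow> 'e \<Rightarrow> real" where
  "koszul b x u v z = dd (\<lambda>y. b y v z) x u + dd (\<lambda>y. b y u z) x v - dd (\<lambda>y. b y u v) x z"

lemma christoffel_eqI:
  assumes "bilinear (b x)" "nondegenerate (b x)" "\<And>z. 2 * b x w z = koszul b x u v z"
  shows "christoffel b x u v = w"
  unfolding christoffel_def
proof (rule the_equality)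
  show "\<forall>z. 2 * b x w z = dd (\<lambda>y. b y v z) x u + dd (\<lambda>y. b y u z) x v - dd (\<lambda>y. b y u v) x z"
    using assms(3) by (simp add: koszul_def)
  fix w' assume w': "\<forall>z. 2 * b x w' z = dd (\<lambda>y. b y v z) x u + dd (\<lambda>y. b y u z) x v - dd (\<lambda>y. b y u v) x z"
  have "b x w' z = b x w z" for z
    using w'[rule_format, of z] assms(3)[of z] unfolding koszul_def by linarith
  then have "b x (w' - w) z = 0" for z by (simp add: bilinear_lsub[OF assms(1)])
  then have "w' - w = 0" using assms(2) unfolding nondegenerate_def by blast
  then show "w' = w" by simp
qed

definition vol2 :: "real^2 \<Rightarrow> real^2 \<Rightarrow> real" where
  "vol2 u v = u $ 1 * v $ 2 - u $ 2 * v $ 1"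

text \<open>Alternating forms on the plane are multiples of the area form. This reduces the
  structure equations, and the exterior derivative of the connection form, to their values on the
  coordinate basis.\<close>

lemma bilinear_skew:
  assumes l: "\<And>v. linear (\<lambda>u. D u v)" and r: "\<And>u. linear (D u)"
  shows "D u v - D v u = vol2 u v * (D ex ey - D ey ex)"
proof -
  have D: "D u v = u$1 * (v$1 * D ex ex + v$2 * D ex ey) + u$2 * (v$1 * D ey ex + v$2 * D ey ey)" for u v :: "real^2"
    using linear_expand2[OF l[of v], of u] linear_expand2[OF r[of ex], of v] linear_expand2[OF r[of ey], of v]
    by simp
  show ?thesis unfolding D[of u v] D[of v u] vol2_def by (simp add: algebra_simps)
qed

text \<open>The sign in \<open>wedge_neg\<close> records the orientation: for ds^2 - dt^2 one has
  \<alpha> = ds + dt and \<beta> = (ds - dt)/2. It decides which null form is fixed by j and which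
  one changes sign.\<close>

locale null_coframe =
  fixes V :: "(real^2) set" and b :: "(real^2) tensor2" and \<alpha> \<beta> :: "real^2 \<Rightarrow> real^2 \<Rightarrow> real"
  assumes openV: "open V"
    and lin\<alpha>: "y \<in> V \<Longrightarrow> linear (\<alpha> y)" and lin\<beta>: "y \<in> V \<Longrightarrow> linear (\<beta> y)"
    and smooth\<alpha>: "smooth_on V (\<lambda>y. \<alpha> y v)" and smooth\<beta>: "smooth_on V (\<lambda>y. \<beta> y v)"
    and metric: "y \<in> V \<Longrightarrow> b y u v = \<alpha> y u * \<beta> y v + \<beta> y u * \<alpha> y v"
    and wedge_neg: "y \<in> V \<Longrightarrow> wedge (\<alpha> y) (\<beta> y) < 0"
begin

lemma expand\<alpha>: "y \<in> V \<Longrightarrow> \<alpha> y u = u$1 * \<alpha> y ex + u$2 * \<alpha> y ey"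
  using linear_expand2[OF lin\<alpha>, of y u] by simp

lemma expand\<beta>: "y \<in> V \<Longrightarrow> \<beta> y u = u$1 * \<beta> y ex + u$2 * \<beta> y ey"
  using linear_expand2[OF lin\<beta>, of y u] by simp

lemma wedge_vol:
  assumes "y \<in> V"
  shows "\<alpha> y u * \<beta> y v - \<beta> y u * \<alpha> y v = vol2 u v * wedge (\<alpha> y) (\<beta> y)"
  using expand\<alpha>[OF assms, of u] expand\<alpha>[OF assms, of v] expand\<beta>[OF assms, of u] expand\<beta>[OF assms, of v]
  unfolding vol2_def wedge_def by algebra

lemma eq_zeroI:
  assumes "y \<in> V" "\<alpha> y u = 0" "\<beta> y u = 0"
  shows "u = 0"
proof -
  have "vol2 u v = 0" for v using wedge_vol[OF assms(1), of u v] wedge_neg[OF assms(1)] assms(2,3) by auto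
  from this[of ex] this[of ey] show ?thesis by (simp add: vol2_def vec_eq_iff forall_2)
qed

lemma bilinear_metric: "y \<in> V \<Longrightarrow> bilinear (b y)"
  unfolding bilinear_def using lin\<alpha>[of y] lin\<beta>[of y]
  by (auto intro!: linearI simp: metric linear_add linear_scale algebra_simps)

text \<open>The vector with coframe components A and B, by Cramer's rule.\<close>

definition of_coframe :: "real^2 \<Rightarrow> real \<Rightarrow> real \<Rightarrow> real^2" where
  "of_coframe y A B = ((A * \<beta> y ey - B * \<alpha> y ey) * inverse (wedge (\<alpha> y) (\<beta> y))) *\<^sub>R ex
     + ((B * \<alpha> y ex - A * \<beta> y ex) * inverse (wedge (\<alpha> y) (\<beta> y))) *\<^sub>R ey"

lemma of_coframe [simp]:
  assumes "y \<in> V"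
  shows "\<alpha> y (of_coframe y A B) = A" "\<beta> y (of_coframe y A B) = B"
proof -
  have d: "wedge (\<alpha> y) (\<beta> y) \<noteq> 0" using wedge_neg[OF assms] by simp
  have "of_coframe y A B $ 1 * wedge (\<alpha> y) (\<beta> y) = A * \<beta> y ey - B * \<alpha> y ey"
    "of_coframe y A B $ 2 * wedge (\<alpha> y) (\<beta> y) = B * \<alpha> y ex - A * \<beta> y ex"
    using d by (simp_all add: of_coframe_def)
  then have "\<alpha> y (of_coframe y A B) * wedge (\<alpha> y) (\<beta> y) = A * wedge (\<alpha> y) (\<beta> y)"
    "\<beta> y (of_coframe y A B) * wedge (\<alpha> y) (\<beta> y) = B * wedge (\<alpha> y) (\<beta> y)"
    using expand\<alpha>[OF assms, of "of_coframe y A B"] expand\<beta>[OF assms, of "of_coframe y A B"]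
    unfolding wedge_def by algebra+
  then show "\<alpha> y (of_coframe y A B) = A" "\<beta> y (of_coframe y A B) = B" using d by simp_all
qed

lemma eqI:
  assumes "y \<in> V" "\<alpha> y u = \<alpha> y v" "\<beta> y u = \<beta> y v"
  shows "u = v"
  using eq_zeroI[OF assms(1), of "u - v"] assms linear_diff[OF lin\<alpha>[OF assms(1)]] linear_diff[OF lin\<beta>[OF assms(1)]]
  by simp

lemma nondegenerate_metric:
  assumes "y \<in> V"
  shows "nondegenerate (b y)"
  unfolding nondegenerate_def
proof (intro allI impI)
  fix u assume "\<forall>v. b y u v = 0"
  from this[rule_format, of "of_coframe y 1 0"] this[rule_format, of "of_coframe y 0 1"]
  show "u = 0" using assms by (intro eq_zeroI[of y]) (simp_all add: metric)
qed

lemma smooth_wedge: "smooth_on V (\<lambda>y. wedge (\<alpha> y) (\<beta> y))"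
  unfolding wedge_def by (intro smooth_on_diff smooth_on_mult smooth\<alpha> smooth\<beta> openV)

lemma smooth_of_coframe:
  assumes "smooth_on V A" "smooth_on V B"
  shows "smooth_on V (\<lambda>y. of_coframe y (A y) (B y))"
  unfolding of_coframe_def using wedge_neg
  by (intro smooth_on_add smooth_on_scaleR smooth_on_mult smooth_on_diff smooth_on_inverse smooth_on_const
      smooth\<alpha> smooth\<beta> openV assms smooth_wedge) fastforce+

text \<open>Write \<theta> = p \<alpha> + q \<beta>. Then d\<beta> = \<theta> \<and> \<beta> = p
  \<alpha> \<and> \<beta> and d\<alpha> = - \<theta> \<and> \<alpha> = q \<alpha> \<and> \<beta>,
  which determines p and q.\<close>

definition \<theta> :: "real^2 \<Rightarrow> real^2 \<Rightarrow> real" where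
  "\<theta> y u =
    (dd (\<lambda>z. \<beta> z ey) y ex - dd (\<lambda>z. \<beta> z ex) y ey) * inverse (wedge (\<alpha> y) (\<beta> y)) * \<alpha> y u
    + (dd (\<lambda>z. \<alpha> z ey) y ex - dd (\<lambda>z. \<alpha> z ex) y ey) * inverse (wedge (\<alpha> y) (\<beta> y)) * \<beta> y u"

lemma smooth\<theta>: "smooth_on V (\<lambda>y. \<theta> y u)"
  unfolding \<theta>_def using wedge_neg
  by (intro smooth_on_add smooth_on_mult smooth_on_diff smooth_on_inverse smooth_onD(2)
      smooth\<alpha> smooth\<beta> openV smooth_wedge) fastforce+

lemma linear\<theta>: "y \<in> V \<Longrightarrow> linear (\<theta> y)"
  unfolding \<theta>_def using lin\<alpha>[of y] lin\<beta>[of y]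
  by (auto intro!: linearI simp: linear_add linear_scale algebra_simps)

lemma dd_linear_arg:
  fixes \<eta> :: "real^2 \<Rightarrow> real^2 \<Rightarrow> real"
  assumes "\<And>y. y \<in> V \<Longrightarrow> linear (\<eta> y)" "\<And>v. smooth_on V (\<lambda>y. \<eta> y v)" "y \<in> V"
  shows "linear (\<lambda>v. dd (\<lambda>z. \<eta> z v) y u)" "linear (\<lambda>u. dd (\<lambda>z. \<eta> z v) y u)"
proof -
  have d: "((\<lambda>z. \<eta> z v) has_derivative dd (\<lambda>z. \<eta> z v) y) (at y)" for v
    using smooth_on_has_derivative[OF assms(2,3)] .
  show "linear (\<lambda>u. dd (\<lambda>z. \<eta> z v) y u)" using has_derivative_linear[OF d] .
  show "linear (\<lambda>v. dd (\<lambda>z. \<eta> z v) y u)"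
  proof (rule linearI)
    fix v w :: "real^2" and r :: real
    have "dd (\<lambda>z. \<eta> z (v + w)) y = dd (\<lambda>z. \<eta> z v + \<eta> z w) y"
      by (rule dd_cong_open[OF openV assms(3)]) (simp add: linear_add[OF assms(1)])
    then show "dd (\<lambda>z. \<eta> z (v + w)) y u = dd (\<lambda>z. \<eta> z v) y u + dd (\<lambda>z. \<eta> z w) y u"
      using dd_eqI[OF has_derivative_add[OF d[of v] d[of w]]] by simp
    have "dd (\<lambda>z. \<eta> z (r *\<^sub>R v)) y = dd (\<lambda>z. r * \<eta> z v) y"
      by (rule dd_cong_open[OF openV assms(3)]) (simp add: linear_scale[OF assms(1)])
    then show "dd (\<lambda>z. \<eta> z (r *\<^sub>R v)) y u = r *\<^sub>R dd (\<lambda>z. \<eta> z v) y u"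
      using dd_eqI[OF has_derivative_mult_right[OF d[of v], of r]] by simp
  qed
qed

text \<open>The equation d\<alpha> = - \<theta> \<and> \<alpha> on (u, v), arranged so that each
  side becomes the other when u and v are exchanged: this is the symmetry of the \<alpha>-component
  of \<open>\<Gamma>\<close>.\<close>

lemma torsion\<alpha>:
  assumes "y \<in> V"
  shows "dd (\<lambda>z. \<alpha> z v) y u + \<theta> y u * \<alpha> y v = dd (\<lambda>z. \<alpha> z u) y v + \<theta> y v * \<alpha> y u"
proof -
  note w = wedge_vol[OF assms, of u v]
  have "dd (\<lambda>z. \<alpha> z v) y u - dd (\<lambda>z. \<alpha> z u) y v
      = vol2 u v * (dd (\<lambda>z. \<alpha> z ey) y ex - dd (\<lambda>z. \<alpha> z ex) y ey)"
    by (rule bilinear_skew[where D = "\<lambda>u v. dd (\<lambda>z. \<alpha> z v) y u"]) (use dd_linear_arg[where \<eta> = \<alpha>] lin\<alpha> smooth\<alpha> assms in blast)+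
  also have "\<dots> = (vol2 u v * wedge (\<alpha> y) (\<beta> y)) *
      ((dd (\<lambda>z. \<alpha> z ey) y ex - dd (\<lambda>z. \<alpha> z ex) y ey) * inverse (wedge (\<alpha> y) (\<beta> y)))"
    using wedge_neg[OF assms] by simp
  finally show ?thesis unfolding w[symmetric] \<theta>_def by (simp add: algebra_simps)
qed

lemma torsion\<beta>:
  assumes "y \<in> V"
  shows "dd (\<lambda>z. \<beta> z v) y u - \<theta> y u * \<beta> y v = dd (\<lambda>z. \<beta> z u) y v - \<theta> y v * \<beta> y u"
proof -
  note w = wedge_vol[OF assms, of u v]
  have "dd (\<lambda>z. \<beta> z v) y u - dd (\<lambda>z. \<beta> z u) y v
      = vol2 u v * (dd (\<lambda>z. \<beta> z ey) y ex - dd (\<lambda>z. \<beta> z ex) y ey)"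
    by (rule bilinear_skew[where D = "\<lambda>u v. dd (\<lambda>z. \<beta> z v) y u"]) (use dd_linear_arg[where \<eta> = \<beta>] lin\<beta> smooth\<beta> assms in blast)+
  also have "\<dots> = (vol2 u v * wedge (\<alpha> y) (\<beta> y)) *
      ((dd (\<lambda>z. \<beta> z ey) y ex - dd (\<lambda>z. \<beta> z ex) y ey) * inverse (wedge (\<alpha> y) (\<beta> y)))"
    using wedge_neg[OF assms] by simp
  finally show ?thesis unfolding w[symmetric] \<theta>_def by (simp add: algebra_simps)
qed

lemma smooth_metric: "smooth_on V (\<lambda>y. b y u v)"
proof (rule smooth_on_cong[OF openV])
  show "smooth_on V (\<lambda>y. \<alpha> y u * \<beta> y v + \<beta> y u * \<alpha> y v)"
    by (intro smooth_on_add smooth_on_mult smooth\<alpha> smooth\<beta> openV)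
qed (simp add: metric)

lemma dd_metric:
  assumes "y \<in> V"
  shows "dd (\<lambda>z. b z u v) y w = dd (\<lambda>z. \<alpha> z u) y w * \<beta> y v + \<alpha> y u * dd (\<lambda>z. \<beta> z v) y w
    + dd (\<lambda>z. \<beta> z u) y w * \<alpha> y v + \<beta> y u * dd (\<lambda>z. \<alpha> z v) y w"
proof -
  note da = smooth_on_has_derivative[OF smooth\<alpha> assms] and db = smooth_on_has_derivative[OF smooth\<beta> assms]
  have "dd (\<lambda>z. b z u v) y = dd (\<lambda>z. \<alpha> z u * \<beta> z v + \<beta> z u * \<alpha> z v) y"
    by (rule dd_cong_open[OF openV assms]) (simp add: metric)
  also have "\<dots> = (\<lambda>w. (\<alpha> y u * dd (\<lambda>z. \<beta> z v) y w + dd (\<lambda>z. \<alpha> z u) y w * \<beta> y v)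
      + (\<beta> y u * dd (\<lambda>z. \<alpha> z v) y w + dd (\<lambda>z. \<beta> z u) y w * \<alpha> y v))"
    by (intro dd_eqI has_derivative_add has_derivative_mult da db)
  finally show ?thesis by simp
qed

definition \<Gamma> :: "real^2 \<Rightarrow> real^2 \<Rightarrow> real^2 \<Rightarrow> real^2" where
  "\<Gamma> y u v = of_coframe y (dd (\<lambda>z. \<alpha> z v) y u + \<theta> y u * \<alpha> y v) (dd (\<lambda>z. \<beta> z v) y u - \<theta> y u * \<beta> y v)"

text \<open>Two facts characterise the Levi-Civita connection: \<open>\<Gamma>\<close> is symmetric
  by the structure equations, and it is metric because \<theta> enters with opposite signs in the
  two factors of b. The polynomial check uses the structure equations for all pairs from u, v,
  z.\<close>

lemma koszul_\<Gamma>: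
  assumes "y \<in> V"
  shows "2 * b y (\<Gamma> y u v) z = koszul b y u v z"
  using torsion\<alpha>[OF assms, of v u] torsion\<alpha>[OF assms, of z u] torsion\<alpha>[OF assms, of z v]
    torsion\<beta>[OF assms, of v u] torsion\<beta>[OF assms, of z u] torsion\<beta>[OF assms, of z v]
  unfolding koszul_def dd_metric[OF assms] metric[OF assms] \<Gamma>_def of_coframe[OF assms]
  by algebra

lemma christoffel: "y \<in> V \<Longrightarrow> christoffel b y u v = \<Gamma> y u v"
  by (intro christoffel_eqI bilinear_metric nondegenerate_metric koszul_\<Gamma>)

lemma smooth_\<Gamma>: "smooth_on V (\<lambda>y. \<Gamma> y u v)"
  unfolding \<Gamma>_def
  by (intro smooth_of_coframe smooth_on_add smooth_on_diff smooth_on_mult smooth_onD(2) smooth\<alpha> smooth\<beta> smooth\<theta> openV)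

lemma \<Gamma>_coframe:
  assumes "y \<in> V"
  shows "\<alpha> y (\<Gamma> y u v) = dd (\<lambda>z. \<alpha> z v) y u + \<theta> y u * \<alpha> y v"
    "\<beta> y (\<Gamma> y u v) = dd (\<lambda>z. \<beta> z v) y u - \<theta> y u * \<beta> y v"
  using assms by (simp_all add: \<Gamma>_def)

lemma eventually_V: "y \<in> V \<Longrightarrow> eventually (\<lambda>z. z \<in> V) (nhds y)"
  using openV eventually_nhds_in_open by blast

lemma dd_coframe_along:
  fixes F :: "'m::real_normed_vector \<Rightarrow> real^2"
  assumes "F x \<in> V" "F differentiable (at x)" "W differentiable (at x)"
  shows "((\<lambda>y. \<alpha> (F y) (W y)) has_derivative
      (\<lambda>u. dd (\<lambda>y. \<alpha> y (W x)) (F x) (dd F x u) + \<alpha> (F x) (dd W x u))) (at x)"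
    "((\<lambda>y. \<beta> (F y) (W y)) has_derivative
      (\<lambda>u. dd (\<lambda>y. \<beta> y (W x)) (F x) (dd F x u) + \<beta> (F x) (dd W x u))) (at x)"
    "((\<lambda>y. \<theta> (F y) (W y)) has_derivative
      (\<lambda>u. dd (\<lambda>y. \<theta> y (W x)) (F x) (dd F x u) + \<theta> (F x) (dd W x u))) (at x)"
  by (intro linear_family_has_derivative assms smooth_onD(1)[OF smooth\<alpha>] smooth_onD(1)[OF smooth\<beta>]
      smooth_onD(1)[OF smooth\<theta>] eventually_mono[OF eventually_V[OF assms(1)]] lin\<alpha> lin\<beta> linear\<theta>; assumption)+

text \<open>The connection is diagonal in the coframe: an infinitesimal isometry of a Lorentzian
  plane scales its two null directions at opposite rates.\<close>

lemma cov_along_coframe: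
  fixes F :: "'m::real_normed_vector \<Rightarrow> real^2"
  assumes "F x \<in> V" "F differentiable (at x)" "W differentiable (at x)"
  shows "\<alpha> (F x) (cov_along b F W x u) =
      dd (\<lambda>y. \<alpha> (F y) (W y)) x u + \<theta> (F x) (dd F x u) * \<alpha> (F x) (W x)"
    "\<beta> (F x) (cov_along b F W x u) =
      dd (\<lambda>y. \<beta> (F y) (W y)) x u - \<theta> (F x) (dd F x u) * \<beta> (F x) (W x)"
  unfolding cov_along_def christoffel[OF assms(1)]
    dd_eqI[OF dd_coframe_along(1)[OF assms]] dd_eqI[OF dd_coframe_along(2)[OF assms]]
  by (simp_all add: linear_add[OF lin\<alpha>[OF assms(1)]] linear_add[OF lin\<beta>[OF assms(1)]] \<Gamma>_coframe[OF assms(1)])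

definition curvature_form :: "real^2 \<Rightarrow> real" where
  "curvature_form y = dd (\<lambda>z. \<theta> z ey) y ex - dd (\<lambda>z. \<theta> z ex) y ey"

text \<open>Each coframe component carries a one-dimensional, hence abelian, connection. In the
  commutator the second derivatives cancel by symmetry and the products of two values of \<theta>
  cancel as well, leaving d\<theta> with sign + on \<alpha> and - on \<beta>.\<close>

lemma riemann_coframe:
  assumes y: "y \<in> V"
  shows "\<alpha> y (riemann b y ex ey w) = curvature_form y * \<alpha> y w"
    "\<beta> y (riemann b y ex ey w) = - curvature_form y * \<beta> y w"
proof -
  have chr: "dd (\<lambda>z. christoffel b z v w) y = dd (\<lambda>z. \<Gamma> z v w) y" for v
    by (rule dd_cong_open[OF openV y]) (rule christoffel)
  note id = differentiable_ident[of "at y"]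
  have ddid: "dd (\<lambda>x. x) y u = u" for u :: "real^2" using dd_eqI[OF has_derivative_ident[of "at y"]] by simp
  note \<Gamma>d = smooth_onD(1)[OF smooth_\<Gamma> y]
  \<comment> \<open>The function z \<mapsto> \<alpha> z (\<Gamma> z v w) is differentiated in two
    ways: by the product rule for a moving form on a moving vector, and from its closed expression
    \<open>\<Gamma>_coframe\<close>.\<close>
  have a: "\<alpha> y (dd (\<lambda>z. \<Gamma> z v w) y u + \<Gamma> y u (\<Gamma> y v w)) =
      dd (\<lambda>z. dd (\<lambda>t. \<alpha> t w) z v) y u + dd (\<lambda>z. \<theta> z v) y u * \<alpha> y w + \<theta> y v * dd (\<lambda>t. \<alpha> t w) y u
      + \<theta> y u * (dd (\<lambda>t. \<alpha> t w) y v + \<theta> y v * \<alpha> y w)" for u v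
  proof -
    have "dd (\<lambda>z. \<alpha> z (\<Gamma> z v w)) y u = dd (\<lambda>z. \<alpha> z (\<Gamma> y v w)) y u + \<alpha> y (dd (\<lambda>z. \<Gamma> z v w) y u)"
      using dd_eqI[OF dd_coframe_along(1)[of "\<lambda>x. x" y "\<lambda>z. \<Gamma> z v w", OF y id \<Gamma>d]] ddid by simp
    moreover have "dd (\<lambda>z. \<alpha> z (\<Gamma> z v w)) y = dd (\<lambda>z. dd (\<lambda>t. \<alpha> t w) z v + \<theta> z v * \<alpha> z w) y"
      by (rule dd_cong_open[OF openV y]) (rule \<Gamma>_coframe)
    moreover have "dd (\<lambda>z. dd (\<lambda>t. \<alpha> t w) z v + \<theta> z v * \<alpha> z w) y =
        (\<lambda>u. dd (\<lambda>z. dd (\<lambda>t. \<alpha> t w) z v) y u + (\<theta> y v * dd (\<lambda>t. \<alpha> t w) y u + dd (\<lambda>z. \<theta> z v) y u * \<alpha> y w))"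
      by (intro dd_eqI has_derivative_add has_derivative_mult smooth_on_has_derivative[OF _ y] smooth_onD(2) smooth\<alpha> smooth\<theta>)
    ultimately show ?thesis
      by (simp add: linear_add[OF lin\<alpha>[OF y]] \<Gamma>_coframe[OF y])
  qed
  have bb: "\<beta> y (dd (\<lambda>z. \<Gamma> z v w) y u + \<Gamma> y u (\<Gamma> y v w)) =
      dd (\<lambda>z. dd (\<lambda>t. \<beta> t w) z v) y u - dd (\<lambda>z. \<theta> z v) y u * \<beta> y w - \<theta> y v * dd (\<lambda>t. \<beta> t w) y u
      - \<theta> y u * (dd (\<lambda>t. \<beta> t w) y v - \<theta> y v * \<beta> y w)" for u v
  proof -
    have "dd (\<lambda>z. \<beta> z (\<Gamma> z v w)) y u = dd (\<lambda>z. \<beta> z (\<Gamma> y v w)) y u + \<beta> y (dd (\<lambda>z. \<Gamma> z v w) y u)"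
      using dd_eqI[OF dd_coframe_along(2)[of "\<lambda>x. x" y "\<lambda>z. \<Gamma> z v w", OF y id \<Gamma>d]] ddid by simp
    moreover have "dd (\<lambda>z. \<beta> z (\<Gamma> z v w)) y = dd (\<lambda>z. dd (\<lambda>t. \<beta> t w) z v - \<theta> z v * \<beta> z w) y"
      by (rule dd_cong_open[OF openV y]) (rule \<Gamma>_coframe)
    moreover have "dd (\<lambda>z. dd (\<lambda>t. \<beta> t w) z v - \<theta> z v * \<beta> z w) y =
        (\<lambda>u. dd (\<lambda>z. dd (\<lambda>t. \<beta> t w) z v) y u - (\<theta> y v * dd (\<lambda>t. \<beta> t w) y u + dd (\<lambda>z. \<theta> z v) y u * \<beta> y w))"
      by (intro dd_eqI has_derivative_diff has_derivative_mult smooth_on_has_derivative[OF _ y] smooth_onD(2) smooth\<beta> smooth\<theta>)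
    ultimately show ?thesis
      by (simp add: linear_add[OF lin\<beta>[OF y]] \<Gamma>_coframe[OF y])
  qed
  have r: "riemann b y ex ey w = (dd (\<lambda>z. \<Gamma> z ey w) y ex + \<Gamma> y ex (\<Gamma> y ey w))
      - (dd (\<lambda>z. \<Gamma> z ex w) y ey + \<Gamma> y ey (\<Gamma> y ex w))"
    by (simp add: riemann_def chr christoffel[OF y])
  show "\<alpha> y (riemann b y ex ey w) = curvature_form y * \<alpha> y w"
    unfolding r linear_diff[OF lin\<alpha>[OF y]] a dd_commute[OF openV y smooth\<alpha>, of w ey ex] curvature_form_def
    by (simp add: algebra_simps)
  show "\<beta> y (riemann b y ex ey w) = - curvature_form y * \<beta> y w"
    unfolding r linear_diff[OF lin\<beta>[OF y]] bb dd_commute[OF openV y smooth\<beta>, of w ey ex] curvature_form_def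
    by (simp add: algebra_simps)
qed

lemma gauss_curvature:
  assumes "y \<in> V"
  shows "gauss_curvature b y * wedge (\<alpha> y) (\<beta> y) = curvature_form y"
proof -
  let ?d = "wedge (\<alpha> y) (\<beta> y)"
  have "b y (riemann b y ex ey ey) ex = - curvature_form y * ?d"
    unfolding metric[OF assms] riemann_coframe[OF assms] wedge_def by (simp add: algebra_simps)
  moreover have "b y ex ex * b y ey ey - (b y ex ey)\<^sup>2 = - ?d * ?d"
    unfolding metric[OF assms] wedge_def by (simp add: algebra_simps power2_eq_square)
  ultimately show ?thesis
    using wedge_neg[OF assms] by (simp add: gauss_curvature_def Let_def)
qed

text \<open>The candidate L keeps the \<alpha>-component and negates the \<beta>-component. As j is
  unique, it remains to see that L swaps the two vectors of every isothermic basis.\<close>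

lemma para_j:
  assumes "lorentzian_form (b y)" "y \<in> V"
  shows "\<alpha> y (para_j (b y) u) = \<alpha> y u" "\<beta> y (para_j (b y) u) = - \<beta> y u"
proof -
  define L where "L u = of_coframe y (\<alpha> y u) (- \<beta> y u)" for u
  have La: "\<alpha> y (L u) = \<alpha> y u" "\<beta> y (L u) = - \<beta> y u" for u
    using assms(2) by (simp_all add: L_def)
  have "linear L"
    by (rule linearI; rule eqI[OF assms(2)])
      (simp_all add: La linear_add[OF lin\<alpha>[OF assms(2)]] linear_add[OF lin\<beta>[OF assms(2)]]
        linear_scale[OF lin\<alpha>[OF assms(2)]] linear_scale[OF lin\<beta>[OF assms(2)]])
  moreover have "L e = f \<and> L f = e" if "isothermic_basis (b y) e f" for e f
  proof -
    have i: "\<alpha> y e * \<beta> y e = - (\<alpha> y f * \<beta> y f)" "0 < \<alpha> y e * \<beta> y e"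
      "\<alpha> y e * \<beta> y f + \<beta> y e * \<alpha> y f = 0" "vol2 e f > 0"
      using that by (simp_all add: isothermic_basis_def metric[OF assms(2)] det_2 vol2_def algebra_simps)
    have "\<alpha> y e * \<beta> y f - \<beta> y e * \<alpha> y f < 0"
      unfolding wedge_vol[OF assms(2)] using i(4) wedge_neg[OF assms(2)] by (simp add: mult_pos_neg)
    then have "0 < \<beta> y e * \<alpha> y f" using i(3) by linarith
    then have pos: "0 < (\<alpha> y e * \<beta> y e) * (\<beta> y e * \<alpha> y f)" using i(2) by simp
    have nz: "\<beta> y e \<noteq> 0" "\<alpha> y e \<noteq> 0" using i(2) by auto
    \<comment> \<open>The two isothermic conditions leave \<alpha> f = \<alpha> e or \<alpha> f = -
      \<alpha> e; positive orientation, through \<open>pos\<close>, rules out the second.\<close>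
    have "\<beta> y e * ((\<alpha> y f - \<alpha> y e) * (\<alpha> y f + \<alpha> y e)) = 0"
      using i(1,3) by algebra
    then have "(\<alpha> y f - \<alpha> y e) = 0 \<or> (\<alpha> y f + \<alpha> y e) = 0" using nz by simp
    moreover have "\<alpha> y f + \<alpha> y e \<noteq> 0"
    proof
      assume "\<alpha> y f + \<alpha> y e = 0"
      then have "\<alpha> y f = - \<alpha> y e" by simp
      with pos have "0 < - ((\<alpha> y e * \<beta> y e) * (\<alpha> y e * \<beta> y e))" by (simp add: algebra_simps)
      then show False by (smt (verit) zero_le_square)
    qed
    ultimately have f: "\<alpha> y f = \<alpha> y e" by simp
    with i(1) nz have g: "\<beta> y f = - \<beta> y e"
      by (metis minus_minus mult_left_cancel mult_minus_right)
    show ?thesis using f g by (auto intro!: eqI[OF assms(2)] simp: La)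
  qed
  ultimately have "para_j (b y) = L"
    unfolding para_j_def using para_j_well_defined[OF assms(1)] by (intro the1_equality) auto
  then show "\<alpha> y (para_j (b y) u) = \<alpha> y u" "\<beta> y (para_j (b y) u) = - \<beta> y u"
    using La by auto
qed

end

text \<open>A change of basis multiplies the Gram determinant by the square of
  \<open>vol2 e f\<close>, so its sign in the orthogonal basis (e, f) is also its sign in the
  coordinate basis.\<close>

lemma lorentzian_form_det:
  assumes "lorentzian_form b"
  shows "b ex ex * b ey ey - (b ex ey)\<^sup>2 < 0"
proof -
  obtain e f where bil: "bilinear b" and sym: "b ey ex = b ex ey" and ef: "b e e > 0" "b f f < 0" "b e f = 0"
    using assms by (auto simp: lorentzian_form_def)
  have ex: "b u v = u$1 * (v$1 * b ex ex + v$2 * b ex ey) + u$2 * (v$1 * b ex ey + v$2 * b ey ey)" for u v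
    using linear_expand2[of "\<lambda>u. b u v" u] linear_expand2[of "b ex" v] linear_expand2[of "b ey" v] bil sym
    by (simp add: bilinear_def)
  have "b e e * b f f - (b e f)\<^sup>2 = (vol2 e f)\<^sup>2 * (b ex ex * b ey ey - (b ex ey)\<^sup>2)"
    unfolding ex[of e e] ex[of f f] ex[of e f] vol2_def by algebra
  moreover have "b e e * b f f - (b e f)\<^sup>2 < 0" using ef by (simp add: mult_pos_neg)
  ultimately show ?thesis by (smt (verit) zero_le_power2 mult_nonneg_nonneg)
qed

text \<open>With \<open>D = - det b\<close> one has \<open>b(e, u) b(e, v) - b(e, e) b(u, v) = D vol(e, u) vol(e, v)\<close>; if
  \<open>b(e, e) > 0\<close>, this identity splits \<open>b\<close> into two null factors.\<close>

lemma null_coframe_exists: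
  assumes W: "open W" "x \<in> W" and lor: "\<And>y. y \<in> W \<Longrightarrow> lorentzian_form (b y)"
    and sm: "\<And>u v. smooth_on W (\<lambda>y. b y u v)"
  obtains V \<alpha> \<beta> where "null_coframe V b \<alpha> \<beta>" "x \<in> V" "V \<subseteq> W"
proof -
  obtain e where e: "b x e e > 0" using lor[OF W(2)] by (auto simp: lorentzian_form_def)
  \<comment> \<open>The positive vector chosen at x is kept constant, so that one algebraic formula
    serves all of V.\<close>
  define V where "V = {y \<in> W. b y e e > 0}"
  have V: "open V" "x \<in> V" "V \<subseteq> W"
    using continuous_open_preimage[OF smooth_onD(3)[OF sm] W(1), of "{0<..}" e e] e W(2)
    by (auto simp: V_def vimage_def Int_def)
  have lv: "lorentzian_form (b y)" if "y \<in> V" for y using lor V(3) that by blast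
  define \<Delta> where "\<Delta> y = sqrt ((b y ex ey)\<^sup>2 - b y ex ex * b y ey ey)" for y
  have pos: "(b y ex ey)\<^sup>2 - b y ex ex * b y ey ey > 0" if "y \<in> V" for y
    using lorentzian_form_det[OF lv[OF that]] by simp
  have \<Delta>: "\<Delta> y > 0" "\<Delta> y * \<Delta> y = (b y ex ey)\<^sup>2 - b y ex ex * b y ey ey" if "y \<in> V" for y
    using pos[OF that] by (simp_all add: \<Delta>_def)
  note smV = smooth_on_subset[OF sm V(3)]
  have sm\<Delta>: "smooth_on V \<Delta>"
    unfolding \<Delta>_def power2_eq_square
    by (intro smooth_on_sqrt smooth_on_diff smooth_on_mult smV V(1)) (use pos in \<open>simp add: power2_eq_square\<close>)
  \<comment> \<open>The sign of \<open>\<Delta>\<close> in \<alpha> is the one that makes the wedge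
    of \<alpha> and \<beta> negative; with the other sign the two forms would trade their roles
    under j.\<close>
  define \<alpha> where "\<alpha> y u = b y e u + \<Delta> y * vol2 e u" for y u
  define \<beta> where "\<beta> y u = (b y e u - \<Delta> y * vol2 e u) * inverse (2 * b y e e)" for y u
  have exp: "b y u v = u$1 * (v$1 * b y ex ex + v$2 * b y ex ey) + u$2 * (v$1 * b y ex ey + v$2 * b y ey ey)"
    if "y \<in> V" for y u v
    using linear_expand2[of "\<lambda>u. b y u v" u] linear_expand2[of "b y ex" v] linear_expand2[of "b y ey" v] lv[OF that]
    by (simp add: bilinear_def lorentzian_form_def)
  have key: "b y e u * b y e v - b y e e * b y u v = \<Delta> y * \<Delta> y * (vol2 e u * vol2 e v)" if y: "y \<in> V" for y u v
    unfolding exp[OF y, of e u] exp[OF y, of e v] exp[OF y, of e e] exp[OF y, of u v] \<Delta>(2)[OF y] vol2_def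
    by algebra
  have "null_coframe V b \<alpha> \<beta>"
  proof (rule null_coframe.intro)
    fix y assume y: "y \<in> V"
    have lb: "linear (b y e)" and lb': "linear (vol2 e)" using lv[OF y]
      by (auto simp: lorentzian_form_def bilinear_def vol2_def algebra_simps intro!: linearI)
    note ls = linear_add[OF lb] linear_add[OF lb'] linear_scale[OF lb] linear_scale[OF lb']
    show "linear (\<alpha> y)" unfolding \<alpha>_def by (auto intro!: linearI simp: ls algebra_simps)
    have "linear (\<lambda>u. (b y e u - \<Delta> y * vol2 e u) * k)" for k
      by (auto intro!: linearI simp: ls algebra_simps)
    then show "linear (\<beta> y)" unfolding \<beta>_def .
    have ne: "b y e e > 0" using y by (simp add: V_def)
    show "b y u v = \<alpha> y u * \<beta> y v + \<beta> y u * \<alpha> y v" for u v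
    proof -
      have "(\<alpha> y u * \<beta> y v + \<beta> y u * \<alpha> y v) = 2 * (b y e u * b y e v - \<Delta> y * \<Delta> y * (vol2 e u * vol2 e v)) * inverse (2 * b y e e)"
        unfolding \<alpha>_def \<beta>_def by algebra
      then show ?thesis unfolding key[OF y, symmetric] using ne by (simp add: field_simps)
    qed
    have v: "vol2 e ex = - (e$2)" "vol2 e ey = e$1" by (simp_all add: vol2_def)
    have "wedge (\<alpha> y) (\<beta> y) = - 2 * \<Delta> y * (e$1 * b y e ex + e$2 * b y e ey) * inverse (2 * b y e e)"
      unfolding wedge_def \<alpha>_def \<beta>_def v by algebra
    also have "e$1 * b y e ex + e$2 * b y e ey = b y e e"
      using linear_expand2[OF lb, of e] by simp
    finally show "wedge (\<alpha> y) (\<beta> y) < 0" using ne \<Delta>(1)[OF y] by (simp add: field_simps)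
  next
    show "smooth_on V (\<lambda>y. \<alpha> y v)" for v
      unfolding \<alpha>_def by (intro smooth_on_add smooth_on_mult smooth_on_const smV sm\<Delta> V(1))
    show "smooth_on V (\<lambda>y. \<beta> y v)" for v
      unfolding \<beta>_def by (intro smooth_on_diff smooth_on_mult smooth_on_const smV sm\<Delta> V(1) smooth_on_inverse)
        (simp add: V_def)
  qed (rule V(1))
  then show thesis using that V by blast
qed

section \<open>Naturality of the connection and of j under isometries\<close>

lemma christoffel_koszul:
  assumes W: "open W" "x \<in> W" and lor: "\<And>y. y \<in> W \<Longrightarrow> lorentzian_form (b y)"
    and sm: "\<And>u v. smooth_on W (\<lambda>y. b y u v)"
  shows "2 * b x (christoffel b x u v) z = koszul b x u v z" "nondegenerate (b x)"
proof -
  obtain V \<alpha> \<beta> where "null_coframe V b \<alpha> \<beta>" and x: "x \<in> V" using null_coframe_exists[OF assms] by metis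
  then interpret null_coframe V b \<alpha> \<beta> by simp
  show "2 * b x (christoffel b x u v) z = koszul b x u v z" "nondegenerate (b x)"
    using christoffel[OF x] koszul_\<Gamma>[OF x] nondegenerate_metric[OF x] by simp_all
qed

text \<open>Models a transition map between two charts of one Lorentzian surface. Orientation is
  kept out of it and enters in \<open>para_j_transform\<close>.\<close>

locale isometry =
  fixes W W' :: "(real^2) set" and b b' :: "(real^2) tensor2" and \<tau> :: "real^2 \<Rightarrow> real^2"
  assumes W: "open W" "open W'" "\<tau> ` W \<subseteq> W'"
    and lor: "\<And>y. y \<in> W \<Longrightarrow> lorentzian_form (b y)" "\<And>y. y \<in> W' \<Longrightarrow> lorentzian_form (b' y)"
    and smb: "\<And>u v. smooth_on W (\<lambda>y. b y u v)" "\<And>u v. smooth_on W' (\<lambda>y. b' y u v)"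
    and sm\<tau>: "smooth_on W \<tau>"
    and iso: "\<And>y u v. y \<in> W \<Longrightarrow> b y u v = b' (\<tau> y) (dd \<tau> y u) (dd \<tau> y v)"
begin

lemma dd_surj: "x \<in> W \<Longrightarrow> surj (dd \<tau> x)"
proof -
  assume x: "x \<in> W"
  have lin: "linear (dd \<tau> x)" by (rule dd_linear[OF smooth_onD(1)[OF sm\<tau> x]])
  have bil': "bilinear (b' (\<tau> x))" using lor(2) W(3) x by (auto simp: lorentzian_form_def)
  have "u = 0" if "dd \<tau> x u = 0" for u
    using christoffel_koszul(2)[OF W(1) x lor(1) smb(1)] iso[OF x, of u] bilinear_lzero[OF bil'] that
    unfolding nondegenerate_def by simp
  then have "inj (dd \<tau> x)" using lin by (simp add: linear_injective_0)
  then show ?thesis using lin linear_injective_imp_surjective by blast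
qed

text \<open>Christoffel symbols are not tensorial; the Hessian of \<tau> is the correction that lets
  \<open>cov_along\<close> transform like a vector. The law is checked through the Koszul formula,
  where it suffices to test against images under d\<tau>, since d\<tau> is onto.\<close>

lemma christoffel_transform:
  assumes x: "x \<in> W"
  shows "christoffel b' (\<tau> x) (dd \<tau> x u) (dd \<tau> x v) =
    dd \<tau> x (christoffel b x u v) - dd (\<lambda>y. dd \<tau> y v) x u"
proof (rule christoffel_eqI)
  let ?T = "dd \<tau> x" and ?H = "\<lambda>u v. dd (\<lambda>y. dd \<tau> y v) x u"
  have \<tau>x: "\<tau> x \<in> W'" using W(3) x by blast
  show bil': "bilinear (b' (\<tau> x))" using lor(2)[OF \<tau>x] by (simp add: lorentzian_form_def)
  have sym': "b' (\<tau> x) u v = b' (\<tau> x) v u" for u v using lor(2)[OF \<tau>x] unfolding lorentzian_form_def by blast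
  show "nondegenerate (b' (\<tau> x))" by (rule christoffel_koszul(2)[OF W(2) \<tau>x lor(2) smb(2)])
  have D: "dd (\<lambda>y. b y v z) x u = dd (\<lambda>y. b' y (?T v) (?T z)) (\<tau> x) (?T u)
      + b' (\<tau> x) (?T v) (?H u z) + b' (\<tau> x) (?H u v) (?T z)" for u v z
  proof -
    have "dd (\<lambda>y. b y v z) x = dd (\<lambda>y. b' (\<tau> y) (dd \<tau> y v) (dd \<tau> y z)) x"
      by (rule dd_cong_open[OF W(1) x]) (rule iso)
    moreover have "((\<lambda>y. b' (\<tau> y) (dd \<tau> y v) (dd \<tau> y z)) has_derivative
        (\<lambda>u. dd (\<lambda>y. b' y (?T v) (?T z)) (\<tau> x) (?T u) + b' (\<tau> x) (?T v) (?H u z) + b' (\<tau> x) (?H u v) (?T z))) (at x)"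
    proof (rule bilinear_family_has_derivative)
      show "\<forall>\<^sub>F y in nhds (\<tau> x). bilinear (b' y)"
        using eventually_nhds_in_open[OF W(2) \<tau>x] by (rule eventually_mono) (use lor(2) in \<open>simp add: lorentzian_form_def\<close>)
    qed (rule smooth_onD(1)[OF smb(2) \<tau>x] smooth_onD(1)[OF sm\<tau> x] smooth_onD(1)[OF smooth_onD(2)[OF sm\<tau>] x])+
    ultimately show ?thesis by (simp add: dd_eqI)
  qed
  have Hs: "?H u v = ?H v u" for u v by (rule dd_commute[OF W(1) x sm\<tau>])
  fix z'
  obtain z where z: "z' = ?T z" using dd_surj[OF x] by (metis surjD)
  have "2 * b' (\<tau> x) (?T (christoffel b x u v)) (?T z) = koszul b x u v z"
    using christoffel_koszul(1)[OF W(1) x lor(1) smb(1)] iso[OF x] by simp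
  \<comment> \<open>Of the six Hessian terms those that involve z cancel in pairs by symmetry of
    second derivatives; the two copies of the Hessian on (u, v) survive.\<close>
  also have "\<dots> = koszul b' (\<tau> x) (?T u) (?T v) (?T z) + 2 * b' (\<tau> x) (?H u v) (?T z)"
    unfolding koszul_def D Hs[of v u] Hs[of z u] Hs[of z v]
      by (simp add: sym')
  finally show "2 * b' (\<tau> x) (?T (christoffel b x u v) - ?H u v) z' = koszul b' (\<tau> x) (?T u) (?T v) z'"
    unfolding z bilinear_lsub[OF bil'] by simp
qed

lemma cov_along_transform:
  fixes F :: "'m::real_normed_vector \<Rightarrow> real^2"
  assumes Fx: "F x \<in> W" and F: "F differentiable (at x)" and X: "X differentiable (at x)"
  shows "cov_along b' (\<lambda>s. \<tau> (F s)) (\<lambda>s. dd \<tau> (F s) (X s)) x u = dd \<tau> (F x) (cov_along b F X x u)"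
proof -
  have lin: "linear (dd \<tau> y)" if "y \<in> W" for y by (rule dd_linear[OF smooth_onD(1)[OF sm\<tau> that]])
  have "((\<lambda>s. dd \<tau> (F s) (X s)) has_derivative
      (\<lambda>u. dd (\<lambda>y. dd \<tau> y (X x)) (F x) (dd F x u) + dd \<tau> (F x) (dd X x u))) (at x)"
  proof (rule linear_family_has_derivative[where \<alpha> = "dd \<tau>", OF _ _ F X])
    show "\<forall>\<^sub>F y in nhds (F x). linear (dd \<tau> y)"
      using eventually_nhds_in_open[OF W(1) Fx] by (rule eventually_mono) (rule lin)
  qed (rule smooth_onD(1)[OF smooth_onD(2)[OF sm\<tau>] Fx])
  moreover have "((\<lambda>s. \<tau> (F s)) has_derivative (\<lambda>u. dd \<tau> (F x) (dd F x u))) (at x)"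
    by (rule has_derivative_compose[OF dd_works[OF F] smooth_on_has_derivative[OF sm\<tau> Fx]])
  ultimately show ?thesis
    unfolding cov_along_def by (simp add: dd_eqI christoffel_transform[OF Fx] linear_add[OF lin[OF Fx]])
qed

text \<open>An orientation-preserving isometry carries an isothermic basis to an isothermic basis.
  Both sides are linear in u and agree on such a basis, because each j swaps its own.\<close>

lemma para_j_transform:
  assumes x: "x \<in> W" and d: "0 < det (matrix (dd \<tau> x))"
  shows "para_j (b' (\<tau> x)) (dd \<tau> x u) = dd \<tau> x (para_j (b x) u)"
proof -
  let ?T = "dd \<tau> x"
  have \<tau>x: "\<tau> x \<in> W'" using W(3) x by blast
  have lin: "linear ?T" by (rule dd_linear[OF smooth_onD(1)[OF sm\<tau> x]])
  have j: "linear (para_j b) \<and> (\<forall>e f. isothermic_basis b e f \<longrightarrow> para_j b e = f \<and> para_j b f = e)"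
    if "lorentzian_form b" for b
    unfolding para_j_def by (rule theI'[OF para_j_well_defined[OF that]])
  note jb = j[OF lor(1)[OF x]] and jb' = j[OF lor(2)[OF \<tau>x]]
  obtain e f where ef: "isothermic_basis (b x) e f" using isothermic_basis_exists[OF lor(1)[OF x]] by blast
  define M where "M = matrix ?T"
  have Tm: "?T u = M *v u" for u
    unfolding M_def by (rule matrix_vector_mul(2)[OF lin, THEN fun_cong, symmetric])
  have "vol2 (?T e) (?T f) = det M * vol2 e f"
    unfolding Tm by (simp add: vol2_def det_2 matrix_vector_mult_def sum_2 algebra_simps)
  then have ef': "isothermic_basis (b' (\<tau> x)) (?T e) (?T f)"
    using ef d[folded M_def] iso[OF x] by (simp add: isothermic_basis_def det_2 vol2_def mult.commute)
  have D: "vol2 e f > 0" using ef by (simp add: isothermic_basis_def det_2 vol2_def mult.commute)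
  have "vol2 e f *\<^sub>R u = vol2 u f *\<^sub>R e + vol2 e u *\<^sub>R f" for u
    by (simp add: vec_eq_iff forall_2 vol2_def algebra_simps)
  then have "u = inverse (vol2 e f) *\<^sub>R (vol2 u f *\<^sub>R e + vol2 e u *\<^sub>R f)"
    using D by (metis less_irrefl scaleR_one scaleR_scaleR left_inverse)
  then obtain p q where u: "u = p *\<^sub>R e + q *\<^sub>R f" by (metis scaleR_add_right scaleR_scaleR)
  show ?thesis
    unfolding u using jb jb' ef ef'
    by (simp add: linear_add linear_scale lin linear_add[OF conjunct1[OF jb]] linear_scale[OF conjunct1[OF jb]]
       linear_add[OF conjunct1[OF jb']] linear_scale[OF conjunct1[OF jb']] linear_add[OF lin] linear_scale[OF lin])
qed

end


subsection \<open>Pulling back a null coframe\<close>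

locale coframe_map = null_coframe V b \<alpha> \<beta> for V b \<alpha> \<beta> +
  fixes U :: "(real^2) set" and \<phi> :: "real^2 \<Rightarrow> real^2"
  assumes openU: "open U" and smooth\<phi>: "smooth_on U \<phi>" and \<phi>V: "x \<in> U \<Longrightarrow> \<phi> x \<in> V"
begin

definition pa :: "real^2 \<Rightarrow> real^2 \<Rightarrow> real" where "pa x u = \<alpha> (\<phi> x) (dd \<phi> x u)"
definition pb :: "real^2 \<Rightarrow> real^2 \<Rightarrow> real" where "pb x u = \<beta> (\<phi> x) (dd \<phi> x u)"
definition pt :: "real^2 \<Rightarrow> real^2 \<Rightarrow> real" where "pt x u = \<theta> (\<phi> x) (dd \<phi> x u)"
text \<open>\<open>paa\<close> and \<open>pbb\<close> are the \<alpha>- and \<beta>-components of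
  the second derivative \<nabla>_u (d\<phi> v) of \<phi>; see \<open>cov_along_dd\<close>.\<close>

definition paa :: "real^2 \<Rightarrow> real^2 \<Rightarrow> real^2 \<Rightarrow> real" where
  "paa x u v = dd (\<lambda>y. pa y v) x u + pt x u * pa x v"
definition pbb :: "real^2 \<Rightarrow> real^2 \<Rightarrow> real^2 \<Rightarrow> real" where
  "pbb x u v = dd (\<lambda>y. pb y v) x u - pt x u * pb x v"

lemma linear_dd\<phi>: "x \<in> U \<Longrightarrow> linear (dd \<phi> x)"
  by (rule dd_linear[OF smooth_onD(1)[OF smooth\<phi>]])

lemma smooth_pullback:
  "smooth_on U (\<lambda>x. pa x v)" "smooth_on U (\<lambda>x. pb x v)" "smooth_on U (\<lambda>x. pt x v)"
  unfolding pa_def pb_def pt_def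
  by (rule smooth_on_linear_family[OF openU openV image_subsetI lin\<alpha> smooth\<alpha> smooth\<phi> smooth_onD(2)[OF smooth\<phi>]]
      smooth_on_linear_family[OF openU openV image_subsetI lin\<beta> smooth\<beta> smooth\<phi> smooth_onD(2)[OF smooth\<phi>]]
      smooth_on_linear_family[OF openU openV image_subsetI linear\<theta> smooth\<theta> smooth\<phi> smooth_onD(2)[OF smooth\<phi>]];
    simp add: \<phi>V)+

lemma linear_pullback:
  assumes x: "x \<in> U"
  shows "linear (pa x)" "linear (pb x)" "linear (pt x)"
proof -
  have "pa x = \<alpha> (\<phi> x) \<circ> dd \<phi> x" "pb x = \<beta> (\<phi> x) \<circ> dd \<phi> x" "pt x = \<theta> (\<phi> x) \<circ> dd \<phi> x"
    by (simp_all add: pa_def pb_def pt_def fun_eq_iff)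
  then show "linear (pa x)" "linear (pb x)" "linear (pt x)"
    using linear_compose[OF linear_dd\<phi>[OF x] lin\<alpha>[OF \<phi>V[OF x]]]
      linear_compose[OF linear_dd\<phi>[OF x] lin\<beta>[OF \<phi>V[OF x]]]
      linear_compose[OF linear_dd\<phi>[OF x] linear\<theta>[OF \<phi>V[OF x]]] by metis+
qed

lemma cov_along_map:
  assumes x: "x \<in> U" and W: "W differentiable (at x)"
  shows "\<alpha> (\<phi> x) (cov_along b \<phi> W x u) = dd (\<lambda>y. \<alpha> (\<phi> y) (W y)) x u + pt x u * \<alpha> (\<phi> x) (W x)"
    "\<beta> (\<phi> x) (cov_along b \<phi> W x u) = dd (\<lambda>y. \<beta> (\<phi> y) (W y)) x u - pt x u * \<beta> (\<phi> x) (W x)"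
  using cov_along_coframe[OF \<phi>V[OF x] smooth_onD(1)[OF smooth\<phi> x] W] by (simp_all add: pt_def)

lemma cov_along_dd:
  assumes x: "x \<in> U"
  shows "\<alpha> (\<phi> x) (cov_along b \<phi> (\<lambda>y. dd \<phi> y v) x u) = paa x u v"
    "\<beta> (\<phi> x) (cov_along b \<phi> (\<lambda>y. dd \<phi> y v) x u) = pbb x u v"
  using cov_along_map[OF x smooth_onD(1)[OF smooth_onD(2)[OF smooth\<phi>] x]]
  by (simp_all add: paa_def pbb_def pa_def pb_def)

lemma cov_along_dd_sym:
  assumes x: "x \<in> U"
  shows "cov_along b \<phi> (\<lambda>y. dd \<phi> y v) x u = cov_along b \<phi> (\<lambda>y. dd \<phi> y u) x v"
proof -
  have "\<Gamma> (\<phi> x) u v = \<Gamma> (\<phi> x) v u" for u v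
    unfolding \<Gamma>_def torsion\<alpha>[OF \<phi>V[OF x], of v u] torsion\<beta>[OF \<phi>V[OF x], of v u] ..
  then show ?thesis
    unfolding cov_along_def dd_commute[OF openU x smooth\<phi>, of v u] christoffel[OF \<phi>V[OF x]] by metis
qed

lemma second_sym:
  assumes x: "x \<in> U"
  shows "paa x u v = paa x v u" "pbb x u v = pbb x v u"
  unfolding cov_along_dd[OF x, symmetric] cov_along_dd_sym[OF x, of v u] by (rule refl)+

lemma smooth_coframe_map:
  "smooth_on U (\<lambda>x. \<alpha> (\<phi> x) v)" "smooth_on U (\<lambda>x. \<beta> (\<phi> x) v)"
  by (rule smooth_on_compose[OF openU openV _ smooth\<alpha> smooth\<phi>] smooth_on_compose[OF openU openV _ smooth\<beta> smooth\<phi>];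
    use \<phi>V in blast)+

lemma smooth_of_coframe_map:
  assumes "smooth_on U A" "smooth_on U B"
  shows "smooth_on U (\<lambda>x. of_coframe (\<phi> x) (A x) (B x))"
proof -
  have "smooth_on U (\<lambda>x. inverse (wedge (\<alpha> (\<phi> x)) (\<beta> (\<phi> x))))"
    using wedge_neg[OF \<phi>V] unfolding wedge_def
    by (intro smooth_on_inverse smooth_on_diff smooth_on_mult smooth_coframe_map openU) fastforce
  then show ?thesis
    unfolding of_coframe_def
    by (intro smooth_on_add smooth_on_scaleR smooth_on_mult smooth_on_diff smooth_on_const
      smooth_coframe_map openU assms)
qed

text \<open>Exterior differentiation commutes with pullback: the second derivatives of \<phi> cancel
  by symmetry, and d\<theta> = \<kappa> \<alpha> \<and> \<beta> is evaluated on the images of the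
  coordinate vectors.\<close>

lemma pullback_curvature:
  assumes x: "x \<in> U"
  shows "dd (\<lambda>y. pt y ey) x ex - dd (\<lambda>y. pt y ex) x ey =
    gauss_curvature b (\<phi> x) * (pa x ex * pb x ey - pb x ex * pa x ey)"
proof -
  have d: "dd (\<lambda>y. pt y v) x u = dd (\<lambda>y. \<theta> y (dd \<phi> x v)) (\<phi> x) (dd \<phi> x u)
      + \<theta> (\<phi> x) (dd (\<lambda>y. dd \<phi> y v) x u)" for u v
    unfolding pt_def
    using dd_eqI[OF dd_coframe_along(3)[OF \<phi>V[OF x] smooth_onD(1)[OF smooth\<phi> x]
      smooth_onD(1)[OF smooth_onD(2)[OF smooth\<phi>] x]]] by simp
  have "dd (\<lambda>y. pt y ey) x ex - dd (\<lambda>y. pt y ex) x ey =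
      dd (\<lambda>y. \<theta> y (dd \<phi> x ey)) (\<phi> x) (dd \<phi> x ex) - dd (\<lambda>y. \<theta> y (dd \<phi> x ex)) (\<phi> x) (dd \<phi> x ey)"
    unfolding d dd_commute[OF openU x smooth\<phi>, of ey ex] by simp
  also have "\<dots> = vol2 (dd \<phi> x ex) (dd \<phi> x ey) * curvature_form (\<phi> x)"
    unfolding curvature_form_def
    by (rule bilinear_skew[where D = "\<lambda>u v. dd (\<lambda>y. \<theta> y v) (\<phi> x) u"])
      (use dd_linear_arg[where \<eta> = \<theta>] linear\<theta> smooth\<theta> \<phi>V[OF x] in blast)+
  also have "\<dots> = gauss_curvature b (\<phi> x) * (vol2 (dd \<phi> x ex) (dd \<phi> x ey) * wedge (\<alpha> (\<phi> x)) (\<beta> (\<phi> x)))"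
    unfolding gauss_curvature[OF \<phi>V[OF x], symmetric] by simp
  finally show ?thesis unfolding wedge_vol[OF \<phi>V[OF x], symmetric] pa_def pb_def .
qed

end

section \<open>Orthogonal projection, and the algebra of the trace\<close>

lemma normal_part_exists:
  fixes L :: "real^2 \<Rightarrow> 'e::euclidean_space"
  assumes bil: "bilinear B" and lin: "linear L" and nd: "nondegenerate (\<lambda>u v. B (L u) (L v))"
  shows "\<exists>u. \<forall>v. B (L u) (L v) = B w (L v)"
proof -
  define h where "h z = B z (L ex) *\<^sub>R ex + B z (L ey) *\<^sub>R ey" for z
  have hv: "B z (L v) = v$1 * h z $ 1 + v$2 * h z $ 2" for z v
    using linear_expand2[OF lin, of v] by (simp add: h_def bilinear_radd[OF bil] bilinear_rmul[OF bil])
  have lh: "linear (\<lambda>u. h (L u))"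
    by (rule linearI) (simp_all add: h_def linear_add[OF lin] linear_scale[OF lin] bilinear_ladd[OF bil]
        bilinear_lmul[OF bil] algebra_simps)
  have "inj (\<lambda>u. h (L u))"
    unfolding linear_injective_0[OF lh] using nd hv unfolding nondegenerate_def by auto
  then obtain u where "h (L u) = h w"
    using linear_injective_imp_surjective[OF lh] by (metis surjD)
  then show ?thesis using hv by metis
qed

text \<open>Nondegeneracy of the form on the range of L makes the whole space the direct sum of that
  range and its orthogonal complement, so the description in \<open>normal_part\<close> singles out
  one vector.\<close>

lemma normal_part:
  fixes L :: "real^2 \<Rightarrow> 'e::euclidean_space"
  assumes bil: "bilinear B" and lin: "linear L" and nd: "nondegenerate (\<lambda>u v. B (L u) (L v))"
  shows "B (normal_part B L w) (L v) = 0" "\<exists>u. w = normal_part B L w + L u"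
proof -
  let ?P = "\<lambda>n. (\<forall>u. B n (L u) = 0) \<and> w - n \<in> range L"
  obtain u where u: "\<And>v. B (L u) (L v) = B w (L v)" using normal_part_exists[OF assms] by metis
  have "\<exists>!n. ?P n"
  proof
    show "?P (w - L u)" using u by (simp add: bilinear_lsub[OF bil])
    fix n assume n: "?P n"
    then obtain t where t: "w - n = L t" by auto
    have "B (L (t - u)) (L v) = 0" for v
    proof -
      have "L (t - u) = w - n - L u" using t by (simp add: linear_diff[OF lin])
      then show ?thesis using n u[of v] by (simp add: bilinear_lsub[OF bil])
    qed
    then have "t - u = 0" using nd unfolding nondegenerate_def by blast
    then show "n = w - L u" using t by (simp add: algebra_simps)
  qed
  from theI'[OF this] have "?P (normal_part B L w)" unfolding normal_part_def .
  then show "B (normal_part B L w) (L v) = 0" "\<exists>u. w = normal_part B L w + L u"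
    by (auto simp: image_iff algebra_simps)
qed

lemma matrix_inv_2:
  fixes M :: "real^2^2"
  assumes d: "M$1$1 * M$2$2 - M$1$2 * M$2$1 \<noteq> 0"
  defines "d \<equiv> M$1$1 * M$2$2 - M$1$2 * M$2$1"
  shows "matrix_inv M $ 1 $ 1 = M$2$2 / d" "matrix_inv M $ 1 $ 2 = - M$1$2 / d"
    "matrix_inv M $ 2 $ 1 = - M$2$1 / d" "matrix_inv M $ 2 $ 2 = M$1$1 / d"
proof -
  define N :: "real^2^2" where "N = vector [vector [M$2$2 / d, - M$1$2 / d], vector [- M$2$1 / d, M$1$1 / d]]"
  have d0: "d \<noteq> 0" using d by (simp add: d_def)
  have N: "M ** N = mat 1 \<and> N ** M = mat 1"
    using d0 by (simp add: N_def matrix_matrix_mult_def mat_def vec_eq_iff forall_2 sum_2 field_simps)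
      (simp add: d_def algebra_simps)
  then have "M ** matrix_inv M = mat 1 \<and> matrix_inv M ** M = mat 1"
    unfolding matrix_inv_def by (rule someI)
  then have "matrix_inv M = N" using N by (metis matrix_mul_assoc matrix_mul_lid matrix_mul_rid)
  then show "matrix_inv M $ 1 $ 1 = M$2$2 / d" "matrix_inv M $ 1 $ 2 = - M$1$2 / d"
    "matrix_inv M $ 2 $ 1 = - M$2$1 / d" "matrix_inv M $ 2 $ 2 = M$1$1 / d"
    by (simp_all add: N_def)
qed

text \<open>The suffixes x and y mark coordinate directions; \<open>pwx\<close>, \<open>rwx\<close>,
  \<open>qwx\<close>, \<open>swx\<close> stand for the values of \<open>m1.paa\<close>,
  \<open>m1.pbb\<close>, \<open>m2.paa\<close>, \<open>m2.pbb\<close> on (w, ex), and the h's for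
  the induced metric. Contracting h with one of the forms P, Q, R, S collapses to a multiple of one
  of the two determinants P \<and> Q, R \<and> S. The trace of the cubic form thus becomes a
  difference of derivatives of these determinants.\<close>

lemma trace_identity:
  fixes e :: real
  assumes lag: "Px * Ry - Rx * Py + e * (Qx * Sy - Sx * Qy) = 0"
    and hxx: "hxx = 2 * (Px * Rx + e * (Qx * Sx))" and hxy: "hxy = 2 * (Px * Ry + e * (Qx * Sy))"
    and hyy: "hyy = 2 * (Py * Ry + e * (Qy * Sy))"
  shows "hyy * (pwx * Rx - rwx * Px + e * (qwx * Sx - swx * Qx))
      - hxy * ((pwx * Ry - rwx * Py + e * (qwx * Sy - swx * Qy)) + (pwy * Rx - rwy * Px + e * (qwy * Sx - swy * Qx)))
      + hxx * (pwy * Ry - rwy * Py + e * (qwy * Sy - swy * Qy))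
    = 2 * e * ((pwx * Qy - pwy * Qx + Px * qwy - Py * qwx) * (Rx * Sy - Ry * Sx)
       - (rwx * Sy - rwy * Sx + Rx * swy - Ry * swx) * (Px * Qy - Py * Qx))"
    "hxx * hyy - hxy * hxy = 4 * e * ((Px * Qy - Py * Qx) * (Rx * Sy - Ry * Sx))"
proof -
  \<comment> \<open>The Lagrangian condition supplies a second expression for \<open>hxy\<close>;
    the contractions \<open>r\<close> use this one, \<open>r'\<close> the original one.\<close>
  have hyx: "hxy = 2 * (Py * Rx + e * (Qy * Sx))" using lag hxy by (simp add: algebra_simps)
  have r: "hyy * Rx - hxy * Ry = 2 * e * Qy * (Rx * Sy - Ry * Sx)"
    "hxx * Qy - hxy * Qx = 2 * Rx * (Px * Qy - Py * Qx)"
    "hyy * Sx - hxy * Sy = - 2 * Py * (Rx * Sy - Ry * Sx)"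
    "hxx * Py - hxy * Px = - 2 * e * Sx * (Px * Qy - Py * Qx)"
    unfolding hxx hyy hyx by (simp_all add: algebra_simps)
  have r': "hxx * Sy - hxy * Sx = 2 * Px * (Rx * Sy - Ry * Sx)"
    "hyy * Px - hxy * Py = 2 * e * Sy * (Px * Qy - Py * Qx)"
    "hxx * Ry - hxy * Rx = - 2 * e * Qx * (Rx * Sy - Ry * Sx)"
    "hyy * Qx - hxy * Qy = - 2 * Ry * (Px * Qy - Py * Qx)"
    unfolding hxx hyy hxy by (simp_all add: algebra_simps)
  have "hyy * (pwx * Rx - rwx * Px + e * (qwx * Sx - swx * Qx))
      - hxy * ((pwx * Ry - rwx * Py + e * (qwx * Sy - swx * Qy)) + (pwy * Rx - rwy * Px + e * (qwy * Sx - swy * Qx)))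
      + hxx * (pwy * Ry - rwy * Py + e * (qwy * Sy - swy * Qy))
    = pwx * (hyy * Rx - hxy * Ry) + pwy * (hxx * Ry - hxy * Rx)
      - rwx * (hyy * Px - hxy * Py) - rwy * (hxx * Py - hxy * Px)
      + e * (qwx * (hyy * Sx - hxy * Sy) + qwy * (hxx * Sy - hxy * Sx)
      - swx * (hyy * Qx - hxy * Qy) - swy * (hxx * Qy - hxy * Qx))"
    by algebra
  also have "\<dots> = 2 * e * ((pwx * Qy - pwy * Qx + Px * qwy - Py * qwx) * (Rx * Sy - Ry * Sx)
       - (rwx * Sy - rwy * Sx + Rx * swy - Ry * swx) * (Px * Qy - Py * Qx))"
    unfolding r r' by algebra
  finally show "hyy * (pwx * Rx - rwx * Px + e * (qwx * Sx - swx * Qx))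
      - hxy * ((pwx * Ry - rwx * Py + e * (qwx * Sy - swx * Qy)) + (pwy * Rx - rwy * Px + e * (qwy * Sx - swy * Qx)))
      + hxx * (pwy * Ry - rwy * Py + e * (qwy * Sy - swy * Qy))
    = 2 * e * ((pwx * Qy - pwy * Qx + Px * qwy - Py * qwx) * (Rx * Sy - Ry * Sx)
       - (rwx * Sy - rwy * Sx + Rx * swy - Ry * swx) * (Px * Qy - Py * Qx))" .
  have "hxx * hyy - hxy * hxy = 2 * (Px * Rx + e * (Qx * Sx)) * (2 * (Py * Ry + e * (Qy * Sy)))
     - 2 * (Px * Ry + e * (Qx * Sy)) * (2 * (Py * Rx + e * (Qy * Sx)))"
    using hxx hyy hxy hyx by metis
  also have "\<dots> = 4 * e * ((Px * Qy - Py * Qx) * (Rx * Sy - Ry * Sx))" by algebra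
  finally show "hxx * hyy - hxy * hxy = 4 * e * ((Px * Qy - Py * Qx) * (Rx * Sy - Ry * Sx))" .
qed


subsection \<open>Lagrangian surfaces with parallel mean curvature in coordinates\<close>

lemma wedge_zeroE:
  assumes "linear p" "linear q" "wedge p q = 0"
  obtains u where "u \<noteq> 0" "p u = 0" "q u = 0"
proof -
  have pe: "p u = u$1 * p ex + u$2 * p ey" "q u = u$1 * q ex + u$2 * q ey" for u
    using linear_expand2[OF assms(1), of u] linear_expand2[OF assms(2), of u] by simp_all
  consider "p ex \<noteq> 0 \<or> p ey \<noteq> 0" | "q ex \<noteq> 0 \<or> q ey \<noteq> 0" | "p ex = 0 \<and> p ey = 0 \<and> q ex = 0 \<and> q ey = 0" by blast
  then show thesis
  proof cases
    case 1
    then have "(- p ey) *\<^sub>R ex + p ex *\<^sub>R ey \<noteq> 0" by (auto simp: vec_eq_iff forall_2)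
    then show thesis
      by (rule that) (use assms(3) in \<open>simp_all add: wedge_def pe[of "- (_ *\<^sub>R _) + _"] pe[of "_ *\<^sub>R _ - _"] pe[of "_ *\<^sub>R _ + _"] algebra_simps\<close>)
  next
    case 2
    then have "(- q ey) *\<^sub>R ex + q ex *\<^sub>R ey \<noteq> 0" by (auto simp: vec_eq_iff forall_2)
    then show thesis
      by (rule that) (use assms(3) in \<open>simp_all add: wedge_def pe[of "- (_ *\<^sub>R _) + _"] pe[of "_ *\<^sub>R _ - _"] pe[of "_ *\<^sub>R _ + _"] algebra_simps\<close>)
  next
    case 3
    then have "p ex = 0" "q ex = 0" by auto
    moreover have "ex \<noteq> 0" by (simp add: vec_eq_iff forall_2)
    ultimately show thesis using that by blast
  qed
qed

lemma solve2:
  fixes e :: real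
  assumes "e * e = 1" "A * r1 + e * (C * s1) = a1" "A * r2 + e * (C * s2) = a2" "r1 * s2 - r2 * s1 \<noteq> 0"
  shows "A = (a1 * s2 - a2 * s1) / (r1 * s2 - r2 * s1)" "C = e * (r1 * a2 - r2 * a1) / (r1 * s2 - r2 * s1)"
proof -
  have "A * (r1 * s2 - r2 * s1) = a1 * s2 - a2 * s1"
    unfolding assms(2,3)[symmetric] by (simp add: algebra_simps)
  then show "A = (a1 * s2 - a2 * s1) / (r1 * s2 - r2 * s1)" using assms(4) by (simp add: eq_divide_eq)
  have "e * (r1 * a2 - r2 * a1) = (e * e) * (C * (r1 * s2 - r2 * s1))"
    unfolding assms(2,3)[symmetric] by (simp add: algebra_simps)
  then have "C * (r1 * s2 - r2 * s1) = e * (r1 * a2 - r2 * a1)" using assms(1) by simp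
  then show "C = e * (r1 * a2 - r2 * a1) / (r1 * s2 - r2 * s1)" using assms(4) by (simp add: eq_divide_eq)
qed

locale lagrangian_chart =
  m1: coframe_map V1 b1 \<alpha>1 \<beta>1 U "\<lambda>x. fst (F x)" +
  m2: coframe_map V2 b2 \<alpha>2 \<beta>2 U "\<lambda>x. snd (F x)"
  for V1 b1 \<alpha>1 \<beta>1 V2 b2 \<alpha>2 \<beta>2 U and F :: "real^2 \<Rightarrow> (real^2) \<times> (real^2)" +
  fixes \<epsilon> :: real
  assumes eps: "\<epsilon> * \<epsilon> = 1" and smoothF: "smooth_on U F"
    and lor1: "y \<in> V1 \<Longrightarrow> lorentzian_form (b1 y)" and lor2: "z \<in> V2 \<Longrightarrow> lorentzian_form (b2 z)"
    and nondeg: "x \<in> U \<Longrightarrow> nondegenerate (pullback F (prod_metric \<epsilon> b1 b2) x)"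
    and lagr: "x \<in> U \<Longrightarrow> pullback F (prod_omega \<epsilon> b1 b2) x u v = 0"
    and par: "x \<in> U \<Longrightarrow> normal_derivative (prod_metric \<epsilon> b1 b2) F (mean_curvature (prod_metric \<epsilon> b1 b2) F) x u = 0"
begin

abbreviation "G \<equiv> prod_metric \<epsilon> b1 b2"
abbreviation "Om \<equiv> prod_omega \<epsilon> b1 b2"
abbreviation "P \<equiv> m1.pa"
abbreviation "R \<equiv> m1.pb"
abbreviation "Q \<equiv> m2.pa"
abbreviation "S \<equiv> m2.pb"
abbreviation "T1 \<equiv> m1.pt"
abbreviation "T2 \<equiv> m2.pt"

text \<open>The components of an ambient vector along F in the coframe (\<alpha>1, \<beta>1,
  \<alpha>2, \<beta>2). J is +1 on \<open>cA\<close>, \<open>cC\<close> and -1 on \<open>cB\<close>,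
  \<open>cD\<close>; G and \<Omega> pair \<open>cA\<close> with \<open>cB\<close> and
  \<open>cC\<close> with \<open>cD\<close>.\<close>

definition "cA x Z = \<alpha>1 (fst (F x)) (fst Z)"
definition "cB x Z = \<beta>1 (fst (F x)) (fst Z)"
definition "cC x Z = \<alpha>2 (snd (F x)) (snd Z)"
definition "cD x Z = \<beta>2 (snd (F x)) (snd Z)"

lemma openU: "open U" by (rule m1.openU)

lemma FdU: "x \<in> U \<Longrightarrow> F differentiable (at x)"
  by (rule smooth_onD(1)[OF smoothF])

lemma dd_fst_snd:
  assumes "W differentiable (at x)"
  shows "dd (\<lambda>x. fst (W x)) x u = fst (dd W x u)" "dd (\<lambda>x. snd (W x)) x u = snd (dd W x u)"
  using dd_bounded_linear[OF bounded_linear_fst assms] dd_bounded_linear[OF bounded_linear_snd assms] by auto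

lemma comp_dd [simp]:
  assumes "x \<in> U"
  shows "cA x (dd F x u) = P x u" "cB x (dd F x u) = R x u" "cC x (dd F x u) = Q x u" "cD x (dd F x u) = S x u"
  unfolding cA_def cB_def cC_def cD_def m1.pa_def m1.pb_def m2.pa_def m2.pb_def dd_fst_snd[OF FdU[OF assms]]
  by (rule refl)+

lemma comp_linear:
  assumes "x \<in> U"
  shows "linear (cA x)" "linear (cB x)" "linear (cC x)" "linear (cD x)"
proof -
  have "cA x = \<alpha>1 (fst (F x)) \<circ> fst" "cB x = \<beta>1 (fst (F x)) \<circ> fst"
    "cC x = \<alpha>2 (snd (F x)) \<circ> snd" "cD x = \<beta>2 (snd (F x)) \<circ> snd"
    by (simp_all add: fun_eq_iff cA_def cB_def cC_def cD_def)
  then show "linear (cA x)" "linear (cB x)" "linear (cC x)" "linear (cD x)"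
    using linear_compose[OF linear_fst m1.lin\<alpha>[OF m1.\<phi>V[OF assms]]]
      linear_compose[OF linear_fst m1.lin\<beta>[OF m1.\<phi>V[OF assms]]]
      linear_compose[OF linear_snd m2.lin\<alpha>[OF m2.\<phi>V[OF assms]]]
      linear_compose[OF linear_snd m2.lin\<beta>[OF m2.\<phi>V[OF assms]]] by metis+
qed

lemma G_eq:
  assumes "x \<in> U"
  shows "G (F x) Z Z' = cA x Z * cB x Z' + cB x Z * cA x Z' + \<epsilon> * (cC x Z * cD x Z' + cD x Z * cC x Z')"
  unfolding prod_metric_def m1.metric[OF m1.\<phi>V[OF assms]] m2.metric[OF m2.\<phi>V[OF assms]] cA_def cB_def cC_def cD_def ..

lemma Om_eq:
  assumes "x \<in> U"
  shows "Om (F x) Z Z' = cA x Z * cB x Z' - cB x Z * cA x Z' + \<epsilon> * (cC x Z * cD x Z' - cD x Z * cC x Z')"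
  unfolding prod_omega_def para_omega_def m1.metric[OF m1.\<phi>V[OF assms]] m2.metric[OF m2.\<phi>V[OF assms]]
    m1.para_j[where y="fst (F x)", OF lor1[OF m1.\<phi>V[OF assms]] m1.\<phi>V[OF assms]]
    m2.para_j[where y="snd (F x)", OF lor2[OF m2.\<phi>V[OF assms]] m2.\<phi>V[OF assms]]
    cA_def cB_def cC_def cD_def by simp

lemma bilinear_G: "x \<in> U \<Longrightarrow> bilinear (G (F x))"
  unfolding bilinear_def
  by (intro conjI allI linearI) (simp_all add: G_eq linear_add[OF comp_linear(1)] linear_add[OF comp_linear(2)]
    linear_add[OF comp_linear(3)] linear_add[OF comp_linear(4)]
    linear_scale[OF comp_linear(1)] linear_scale[OF comp_linear(2)]
    linear_scale[OF comp_linear(3)] linear_scale[OF comp_linear(4)] algebra_simps)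

lemma bilinear_Om: "x \<in> U \<Longrightarrow> bilinear (Om (F x))"
  unfolding bilinear_def
  by (intro conjI allI linearI) (simp_all add: Om_eq linear_add[OF comp_linear(1)] linear_add[OF comp_linear(2)]
    linear_add[OF comp_linear(3)] linear_add[OF comp_linear(4)]
    linear_scale[OF comp_linear(1)] linear_scale[OF comp_linear(2)]
    linear_scale[OF comp_linear(3)] linear_scale[OF comp_linear(4)] algebra_simps)

lemma eps0: "\<epsilon> \<noteq> 0" using eps by auto

text \<open>The Koszul formula of a product metric splits into those of its factors, the second one
  scaled by \<epsilon>, which is nonzero.\<close>

lemma christoffel_G:
  assumes x: "x \<in> U"
  shows "christoffel G (F x) Z Z' =
    (christoffel b1 (fst (F x)) (fst Z) (fst Z'), christoffel b2 (snd (F x)) (snd Z) (snd Z'))"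
proof (rule christoffel_eqI)
  note y1 = m1.\<phi>V[OF x] and y2 = m2.\<phi>V[OF x]
  show "bilinear (G (F x))" by (rule bilinear_G[OF x])
  show "nondegenerate (G (F x))"
    unfolding nondegenerate_def
  proof (intro allI impI)
    fix Z assume Z: "\<forall>Z'. G (F x) Z Z' = 0"
    have "b1 (fst (F x)) (fst Z) v = 0" for v
      using Z[rule_format, of "(v, 0)"] bilinear_rzero[OF m2.bilinear_metric[OF y2]] by (simp add: prod_metric_def)
    moreover have "b2 (snd (F x)) (snd Z) v = 0" for v
      using Z[rule_format, of "(0, v)"] bilinear_rzero[OF m1.bilinear_metric[OF y1]] eps0 by (simp add: prod_metric_def)
    ultimately show "Z = 0"
      using m1.nondegenerate_metric[OF y1] m2.nondegenerate_metric[OF y2]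
      unfolding nondegenerate_def by (metis prod.collapse zero_prod_def)
  qed
  have d: "dd (\<lambda>y. G y v z) (F x) u = dd (\<lambda>y. b1 y (fst v) (fst z)) (fst (F x)) (fst u)
      + \<epsilon> * dd (\<lambda>y. b2 y (snd v) (snd z)) (snd (F x)) (snd u)" for u v z
  proof -
    have "((\<lambda>y. b1 (fst y) (fst v) (fst z)) has_derivative
        (\<lambda>u. dd (\<lambda>y. b1 y (fst v) (fst z)) (fst (F x)) (fst u))) (at (F x))"
      by (rule has_derivative_compose[OF has_derivative_fst[OF has_derivative_ident]
        smooth_on_has_derivative[OF m1.smooth_metric y1]])
    moreover have "((\<lambda>y. b2 (snd y) (snd v) (snd z)) has_derivative
        (\<lambda>u. dd (\<lambda>y. b2 y (snd v) (snd z)) (snd (F x)) (snd u))) (at (F x))"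
      by (rule has_derivative_compose[OF has_derivative_snd[OF has_derivative_ident]
        smooth_on_has_derivative[OF m2.smooth_metric y2]])
    ultimately have "((\<lambda>y. G y v z) has_derivative
      (\<lambda>u. dd (\<lambda>y. b1 y (fst v) (fst z)) (fst (F x)) (fst u)
        + \<epsilon> * dd (\<lambda>y. b2 y (snd v) (snd z)) (snd (F x)) (snd u))) (at (F x))"
      unfolding prod_metric_def by (intro has_derivative_add has_derivative_mult_right)
    then show ?thesis by (simp add: dd_eqI)
  qed
  fix z
  have "koszul G (F x) Z Z' z = koszul b1 (fst (F x)) (fst Z) (fst Z') (fst z)
     + \<epsilon> * koszul b2 (snd (F x)) (snd Z) (snd Z') (snd z)"
    unfolding koszul_def d by (simp add: algebra_simps)
  then show "2 * G (F x) (christoffel b1 (fst (F x)) (fst Z) (fst Z'), christoffel b2 (snd (F x)) (snd Z) (snd Z')) z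
     = koszul G (F x) Z Z' z"
    unfolding prod_metric_def m1.christoffel[OF y1] m2.christoffel[OF y2]
    using m1.koszul_\<Gamma>[OF y1, of "fst Z" "fst Z'" "fst z"] m2.koszul_\<Gamma>[OF y2, of "snd Z" "snd Z'" "snd z"]
    by (simp add: distrib_left)
qed

lemma cov_along_G:
  assumes x: "x \<in> U" and W: "W differentiable (at x)"
  shows "cA x (cov_along G F W x u) = dd (\<lambda>y. cA y (W y)) x u + T1 x u * cA x (W x)"
    "cB x (cov_along G F W x u) = dd (\<lambda>y. cB y (W y)) x u - T1 x u * cB x (W x)"
    "cC x (cov_along G F W x u) = dd (\<lambda>y. cC y (W y)) x u + T2 x u * cC x (W x)"
    "cD x (cov_along G F W x u) = dd (\<lambda>y. cD y (W y)) x u - T2 x u * cD x (W x)"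
proof -
  have c: "cov_along G F W x u = (cov_along b1 (\<lambda>x. fst (F x)) (\<lambda>x. fst (W x)) x u,
      cov_along b2 (\<lambda>x. snd (F x)) (\<lambda>x. snd (W x)) x u)"
    unfolding cov_along_def christoffel_G[OF x] dd_fst_snd[OF FdU[OF x]] dd_fst_snd[OF W]
    by (simp add: plus_prod_def)
  have w: "(\<lambda>x. fst (W x)) differentiable (at x)" "(\<lambda>x. snd (W x)) differentiable (at x)"
    using has_derivative_fst[OF dd_works[OF W]] has_derivative_snd[OF dd_works[OF W]] differentiable_def by blast+
  show "cA x (cov_along G F W x u) = dd (\<lambda>y. cA y (W y)) x u + T1 x u * cA x (W x)"
    "cB x (cov_along G F W x u) = dd (\<lambda>y. cB y (W y)) x u - T1 x u * cB x (W x)"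
    "cC x (cov_along G F W x u) = dd (\<lambda>y. cC y (W y)) x u + T2 x u * cC x (W x)"
    "cD x (cov_along G F W x u) = dd (\<lambda>y. cD y (W y)) x u - T2 x u * cD x (W x)"
    using m1.cov_along_map[OF x w(1), of u] m2.cov_along_map[OF x w(2), of u]
    unfolding c cA_def cB_def cC_def cD_def by simp_all
qed

lemma cov_along_dd:
  assumes x: "x \<in> U"
  shows "cA x (cov_along G F (\<lambda>y. dd F y v) x u) = m1.paa x u v"
    "cB x (cov_along G F (\<lambda>y. dd F y v) x u) = m1.pbb x u v"
    "cC x (cov_along G F (\<lambda>y. dd F y v) x u) = m2.paa x u v"
    "cD x (cov_along G F (\<lambda>y. dd F y v) x u) = m2.pbb x u v"
proof -
  have d: "(\<lambda>y. dd F y v) differentiable (at x)" by (rule smooth_onD(1)[OF smooth_onD(2)[OF smoothF] x])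
  have "dd (\<lambda>y. cA y (dd F y v)) x = dd (\<lambda>y. P y v) x" "dd (\<lambda>y. cB y (dd F y v)) x = dd (\<lambda>y. R y v) x"
    "dd (\<lambda>y. cC y (dd F y v)) x = dd (\<lambda>y. Q y v) x" "dd (\<lambda>y. cD y (dd F y v)) x = dd (\<lambda>y. S y v) x"
    by (rule dd_cong_open[OF openU x], simp)+
  then show "cA x (cov_along G F (\<lambda>y. dd F y v) x u) = m1.paa x u v"
    "cB x (cov_along G F (\<lambda>y. dd F y v) x u) = m1.pbb x u v"
    "cC x (cov_along G F (\<lambda>y. dd F y v) x u) = m2.paa x u v"
    "cD x (cov_along G F (\<lambda>y. dd F y v) x u) = m2.pbb x u v"
    unfolding cov_along_G[OF x d] m1.paa_def m1.pbb_def m2.paa_def m2.pbb_def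
    using comp_dd[OF x] by simp_all
qed

section \<open>Induced metric, mean curvature and the cubic form\<close>

lemma lagrange:
  assumes "x \<in> U"
  shows "P x u * R x v - R x u * P x v + \<epsilon> * (Q x u * S x v - S x u * Q x v) = 0"
  using lagr[OF assms, of u v] unfolding pullback_def Om_eq[OF assms] comp_dd[OF assms] .

text \<open>G and \<Omega> consist of the same products up to sign, so \<Omega> = 0 on tangent
  vectors identifies the two halves of G. In this form the Gram matrix is, up to constants, a
  product of the matrices of (P, Q) and (R, S), and its determinant factors.\<close>

lemma induced_metric:
  assumes "x \<in> U"
  shows "pullback F G x u v = 2 * (P x u * R x v + \<epsilon> * (Q x u * S x v))"
  using lagrange[OF assms, of u v] unfolding pullback_def G_eq[OF assms] comp_dd[OF assms]
  by (simp add: algebra_simps)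

text \<open>\<open>Dp\<close> and \<open>Dm\<close> are the determinants of the projections of the
  tangent plane onto the +1 and -1 eigenbundles of J.\<close>

definition "Dp x = wedge (P x) (Q x)"
definition "Dm x = wedge (R x) (S x)"

text \<open>A tangent vector killed by P and Q, or by R and S, would be orthogonal to the whole
  tangent plane.\<close>

lemma D_nonzero:
  assumes x: "x \<in> U"
  shows "Dp x \<noteq> 0" "Dm x \<noteq> 0"
proof -
  have nd: "u = 0" if "\<And>v. pullback F G x u v = 0" for u
    using nondeg[OF x] that unfolding nondegenerate_def by blast
  show "Dp x \<noteq> 0"
  proof
    assume "Dp x = 0"
    then obtain u where u: "u \<noteq> 0" "P x u = 0" "Q x u = 0"
      using wedge_zeroE[OF m1.linear_pullback(1)[OF x] m2.linear_pullback(1)[OF x]] unfolding Dp_def by metis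
    then have "pullback F G x u v = 0" for v unfolding induced_metric[OF x] by simp
    then show False using nd u(1) by blast
  qed
  show "Dm x \<noteq> 0"
  proof
    assume "Dm x = 0"
    then obtain u where u: "u \<noteq> 0" "R x u = 0" "S x u = 0"
      using wedge_zeroE[OF m1.linear_pullback(2)[OF x] m2.linear_pullback(2)[OF x]] unfolding Dm_def by metis
    then have "pullback F G x u v = 0" for v
      using lagrange[OF x, of u v] unfolding induced_metric[OF x] by simp
    then show False using nd u(1) by blast
  qed
qed

text \<open>Tangential parts are invisible to \<Omega> because the surface is Lagrangian. Hence the
  values of \<Omega> on the second fundamental form, and later on \<nabla>H, are computed without
  forming the normal projection.\<close>

lemma normal_part_F:
  assumes x: "x \<in> U"
  shows "G (F x) (normal_part (G (F x)) (dd F x) Z) (dd F x v) = 0"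
    "Om (F x) (normal_part (G (F x)) (dd F x) Z) (dd F x v) = Om (F x) Z (dd F x v)"
    "normal_part (G (F x)) (dd F x) Z = 0 \<Longrightarrow> Om (F x) Z (dd F x v) = 0"
proof -
  have lin: "linear (dd F x)" by (rule dd_linear[OF FdU[OF x]])
  have nd: "nondegenerate (\<lambda>u v. G (F x) (dd F x u) (dd F x v))"
    using nondeg[OF x] unfolding pullback_def .
  note np = normal_part[OF bilinear_G[OF x] lin nd]
  show "G (F x) (normal_part (G (F x)) (dd F x) Z) (dd F x v) = 0" by (rule np(1))
  obtain u where "Z = normal_part (G (F x)) (dd F x) Z + dd F x u" using np(2) by blast
  then have "Om (F x) Z (dd F x v) = Om (F x) (normal_part (G (F x)) (dd F x) Z) (dd F x v) + Om (F x) (dd F x u) (dd F x v)"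
    using bilinear_ladd[OF bilinear_Om[OF x]] by metis
  also have "Om (F x) (dd F x u) (dd F x v) = 0" using lagr[OF x] unfolding pullback_def .
  finally show "Om (F x) (normal_part (G (F x)) (dd F x) Z) (dd F x v) = Om (F x) Z (dd F x v)" by simp
  then show "normal_part (G (F x)) (dd F x) Z = 0 \<Longrightarrow> Om (F x) Z (dd F x v) = 0"
    using bilinear_lzero[OF bilinear_Om[OF x]] by metis
qed

definition "H = mean_curvature G F"
definition "Om_H x w = Om (F x) (H x) (dd F x w)"

text \<open>Multiplied by twice the determinant of the induced metric, H becomes polynomial in the
  metric and in the second fundamental form: the determinant clears the inverse matrix, the 2
  cancels the 1/2 in the definition of H.\<close>

lemma mean_curvature_eq:
  assumes x: "x \<in> U"
  defines "h \<equiv> \<lambda>u v. pullback F G x u v" and "II \<equiv> \<lambda>u v. second_fundamental_form G F x u v"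
  shows "h ex ex * h ey ey - h ex ey * h ex ey = 4 * \<epsilon> * (Dp x * Dm x)"
    "(2 * (4 * \<epsilon> * (Dp x * Dm x))) *\<^sub>R H x =
      h ey ey *\<^sub>R II ex ex - h ex ey *\<^sub>R (II ex ey + II ey ex) + h ex ex *\<^sub>R II ey ey"
proof -
  define d where "d = 4 * \<epsilon> * (Dp x * Dm x)"
  have d0: "d \<noteq> 0" using D_nonzero[OF x] eps0 by (simp add: d_def)
  have sym: "h ey ex = h ex ey" unfolding h_def induced_metric[OF x]
    using lagrange[OF x, of ex ey] by (simp add: algebra_simps)
  show hd: "h ex ex * h ey ey - h ex ey * h ex ey = 4 * \<epsilon> * (Dp x * Dm x)"
    unfolding Dp_def Dm_def wedge_def
    by (rule trace_identity(2)[OF lagrange[OF x, of ex ey]]) (simp_all add: h_def induced_metric[OF x])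
  define M :: "real^2^2" where "M = (\<chi> i j. pullback F G x (axis i 1) (axis j 1))"
  have M: "M $ 1 $ 1 = h ex ex" "M $ 1 $ 2 = h ex ey" "M $ 2 $ 1 = h ex ey" "M $ 2 $ 2 = h ey ey"
    using sym by (simp_all add: M_def h_def)
  have Md: "M$1$1 * M$2$2 - M$1$2 * M$2$1 = d" unfolding M using hd by (simp add: d_def)
  have inv: "matrix_inv M $ 1 $ 1 = h ey ey / d" "matrix_inv M $ 1 $ 2 = - h ex ey / d"
    "matrix_inv M $ 2 $ 1 = - h ex ey / d" "matrix_inv M $ 2 $ 2 = h ex ex / d"
    using matrix_inv_2[of M] d0 unfolding Md unfolding M by simp_all
  have "H x = (1/2) *\<^sub>R ((h ey ey / d) *\<^sub>R II ex ex + (- h ex ey / d) *\<^sub>R II ex ey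
      + ((- h ex ey / d) *\<^sub>R II ey ex + (h ex ex / d) *\<^sub>R II ey ey))"
    unfolding H_def mean_curvature_def Let_def M_def[symmetric] sum_2 inv II_def ..
  then have "(2 * d) *\<^sub>R H x = ((2 * d) * (1/2)) *\<^sub>R ((h ey ey / d) *\<^sub>R II ex ex + (- h ex ey / d) *\<^sub>R II ex ey
      + ((- h ex ey / d) *\<^sub>R II ey ex + (h ex ex / d) *\<^sub>R II ey ey))" by simp
  also have "\<dots> = h ey ey *\<^sub>R II ex ex - h ex ey *\<^sub>R (II ex ey + II ey ex) + h ex ex *\<^sub>R II ey ey"
    using d0 by (simp add: scaleR_add_right scaleR_diff_right)
  finally show "(2 * (4 * \<epsilon> * (Dp x * Dm x))) *\<^sub>R H x =
      h ey ey *\<^sub>R II ex ex - h ex ey *\<^sub>R (II ex ey + II ey ex) + h ex ex *\<^sub>R II ey ey"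
    unfolding d_def .
qed

lemma H_normal:
  assumes x: "x \<in> U"
  shows "G (F x) (H x) (dd F x v) = 0"
proof -
  note bl = bilinear_G[OF x]
  have "G (F x) (second_fundamental_form G F x u w) (dd F x v) = 0" for u w
    unfolding second_fundamental_form_def by (rule normal_part_F(1)[OF x])
  then have "G (F x) ((2 * (4 * \<epsilon> * (Dp x * Dm x))) *\<^sub>R H x) (dd F x v) = 0"
    unfolding mean_curvature_eq(2)[OF x]
    by (simp add: bilinear_ladd[OF bl] bilinear_lsub[OF bl] bilinear_lmul[OF bl])
  then show ?thesis using D_nonzero[OF x] eps0 by (simp add: bilinear_lmul[OF bl])
qed

text \<open>The fundamental cubic form \<Omega>(II(u, v), X_w) of a Lagrangian immersion, in coframe
  components; II is the second fundamental form.\<close>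

definition "cubic x u v w = m1.paa x u v * R x w - m1.pbb x u v * P x w
    + \<epsilon> * (m2.paa x u v * S x w - m2.pbb x u v * Q x w)"

lemma cubic_second_fundamental_form:
  assumes x: "x \<in> U"
  shows "Om (F x) (second_fundamental_form G F x u v) (dd F x w) = cubic x u v w"
  unfolding second_fundamental_form_def normal_part_F(2)[OF x]
  unfolding Om_eq[OF x] comp_dd[OF x] cov_along_dd[OF x] cubic_def ..

lemma cubic_sym12: "x \<in> U \<Longrightarrow> cubic x u v w = cubic x v u w"
  unfolding cubic_def using m1.second_sym[of x u v] m2.second_sym[of x u v] by simp

lemma pullback_has_derivative:
  assumes x: "x \<in> U"
  shows "((\<lambda>y. P y v) has_derivative dd (\<lambda>y. P y v) x) (at x)"
    "((\<lambda>y. R y v) has_derivative dd (\<lambda>y. R y v) x) (at x)"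
    "((\<lambda>y. Q y v) has_derivative dd (\<lambda>y. Q y v) x) (at x)"
    "((\<lambda>y. S y v) has_derivative dd (\<lambda>y. S y v) x) (at x)"
  by (rule smooth_on_has_derivative[OF _ x], rule m1.smooth_pullback m2.smooth_pullback)+

text \<open>This is the derivative of the Lagrangian condition.\<close>

lemma cubic_sym23:
  assumes x: "x \<in> U"
  shows "cubic x u v w = cubic x u w v"
proof -
  let ?L = "\<lambda>y. P y v * R y w - R y v * P y w + \<epsilon> * (Q y v * S y w - S y v * Q y w)"
  have "dd ?L x = dd (\<lambda>y. 0) x"
    by (rule dd_cong_open[OF openU x]) (rule lagrange)
  also have "\<dots> = (\<lambda>u. 0)" by (rule dd_eqI[OF has_derivative_const])
  finally have "dd ?L x u = 0" by (rule fun_cong)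
  moreover have "dd ?L x = (\<lambda>u. (P x v * dd (\<lambda>y. R y w) x u + dd (\<lambda>y. P y v) x u * R x w)
      - (R x v * dd (\<lambda>y. P y w) x u + dd (\<lambda>y. R y v) x u * P x w)
      + \<epsilon> * ((Q x v * dd (\<lambda>y. S y w) x u + dd (\<lambda>y. Q y v) x u * S x w)
      - (S x v * dd (\<lambda>y. Q y w) x u + dd (\<lambda>y. S y v) x u * Q x w)))"
    by (intro dd_eqI has_derivative_add has_derivative_diff has_derivative_mult has_derivative_mult_right pullback_has_derivative x)
  ultimately show ?thesis
    unfolding cubic_def m1.paa_def m1.pbb_def m2.paa_def m2.pbb_def by (simp add: algebra_simps)
qed

lemma smooth_D: "smooth_on U Dp" "smooth_on U Dm"
  unfolding Dp_def Dm_def wedge_def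
  by (intro smooth_on_diff smooth_on_mult m1.smooth_pullback m2.smooth_pullback openU)+

text \<open>Replacing ordinary by covariant derivatives in the product rule for a determinant adds
  the trace of the connection, which is \<theta>1 + \<theta>2 on the +1 eigenbundle and its negative
  on the other.\<close>

lemma dd_D:
  assumes x: "x \<in> U"
  shows "m1.paa x w ex * Q x ey - m1.paa x w ey * Q x ex + P x ex * m2.paa x w ey - P x ey * m2.paa x w ex
      = dd Dp x w + (T1 x w + T2 x w) * Dp x"
    "m1.pbb x w ex * S x ey - m1.pbb x w ey * S x ex + R x ex * m2.pbb x w ey - R x ey * m2.pbb x w ex
      = dd Dm x w - (T1 x w + T2 x w) * Dm x"
proof -
  have "dd Dp x = (\<lambda>u. (P x ex * dd (\<lambda>y. Q y ey) x u + dd (\<lambda>y. P y ex) x u * Q x ey)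
      - (P x ey * dd (\<lambda>y. Q y ex) x u + dd (\<lambda>y. P y ey) x u * Q x ex))"
    unfolding Dp_def wedge_def by (intro dd_eqI has_derivative_diff has_derivative_mult pullback_has_derivative x)
  then show "m1.paa x w ex * Q x ey - m1.paa x w ey * Q x ex + P x ex * m2.paa x w ey - P x ey * m2.paa x w ex
      = dd Dp x w + (T1 x w + T2 x w) * Dp x"
    unfolding m1.paa_def m2.paa_def Dp_def wedge_def by (simp add: algebra_simps)
  have "dd Dm x = (\<lambda>u. (R x ex * dd (\<lambda>y. S y ey) x u + dd (\<lambda>y. R y ex) x u * S x ey)
      - (R x ey * dd (\<lambda>y. S y ex) x u + dd (\<lambda>y. R y ey) x u * S x ex))"
    unfolding Dm_def wedge_def by (intro dd_eqI has_derivative_diff has_derivative_mult pullback_has_derivative x)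
  then show "m1.pbb x w ex * S x ey - m1.pbb x w ey * S x ex + R x ex * m2.pbb x w ey - R x ey * m2.pbb x w ex
      = dd Dm x w - (T1 x w + T2 x w) * Dm x"
    unfolding m1.pbb_def m2.pbb_def Dm_def wedge_def by (simp add: algebra_simps)
qed

text \<open>Up to an exact form, \<open>\<Omega>(H, \<cdot>)\<close> is the connection form of the determinant of the null
  subbundle \<open>j = 1\<close>; its differential is therefore the Ricci form.\<close>

lemma Om_H_eq:
  assumes x: "x \<in> U"
  shows "Om_H x w = 1/4 * (dd Dp x w / Dp x - dd Dm x w / Dm x) + 1/2 * (T1 x w + T2 x w)"
proof -
  note bl = bilinear_Om[OF x]
  let ?h = "pullback F G x"
  have hs: "?h ex ex = 2 * (P x ex * R x ex + \<epsilon> * (Q x ex * S x ex))"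
    "?h ex ey = 2 * (P x ex * R x ey + \<epsilon> * (Q x ex * S x ey))"
    "?h ey ey = 2 * (P x ey * R x ey + \<epsilon> * (Q x ey * S x ey))"
    by (rule induced_metric[OF x])+
  \<comment> \<open>Total symmetry moves w into the first slot. The trace over the other two slots
    is then a derivative in the direction w, to which \<open>trace_identity\<close> and
    \<open>dd_D\<close> apply.\<close>
  have c: "cubic x u v w = cubic x w u v" for u v
    using cubic_sym23[OF x, of u v w] cubic_sym12[OF x, of u w v] by simp
  have "2 * (4 * \<epsilon> * (Dp x * Dm x)) * Om_H x w = Om (F x) ((2 * (4 * \<epsilon> * (Dp x * Dm x))) *\<^sub>R H x) (dd F x w)"
    by (simp add: bilinear_lmul[OF bl] Om_H_def)
  also have "\<dots> = ?h ey ey * cubic x w ex ex - ?h ex ey * (cubic x w ex ey + cubic x w ey ex) + ?h ex ex * cubic x w ey ey"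
    unfolding mean_curvature_eq(2)[OF x]
    by (simp add: bilinear_ladd[OF bl] bilinear_lsub[OF bl] bilinear_lmul[OF bl] cubic_second_fundamental_form[OF x] c)
  also have "\<dots> = 2 * \<epsilon> * ((m1.paa x w ex * Q x ey - m1.paa x w ey * Q x ex + P x ex * m2.paa x w ey - P x ey * m2.paa x w ex)
        * (R x ex * S x ey - R x ey * S x ex)
      - (m1.pbb x w ex * S x ey - m1.pbb x w ey * S x ex + R x ex * m2.pbb x w ey - R x ey * m2.pbb x w ex)
        * (P x ex * Q x ey - P x ey * Q x ex))"
    unfolding cubic_def by (rule trace_identity(1)[OF lagrange[OF x, of ex ey] hs])
  also have "\<dots> = 2 * \<epsilon> * ((dd Dp x w + (T1 x w + T2 x w) * Dp x) * Dm x - (dd Dm x w - (T1 x w + T2 x w) * Dm x) * Dp x)"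
    unfolding dd_D[OF x] by (simp add: Dp_def Dm_def wedge_def)
  finally have "4 * (Dp x * Dm x) * Om_H x w =
      (dd Dp x w + (T1 x w + T2 x w) * Dp x) * Dm x - (dd Dm x w - (T1 x w + T2 x w) * Dm x) * Dp x"
    using eps0 by simp
  then show ?thesis using D_nonzero[OF x] by (simp add: field_simps)
qed

section \<open>Smoothness of H and closedness of \<Omega>(H, \<cdot>)\<close>

lemma smooth_Om_H: "smooth_on U (\<lambda>x. Om_H x w)"
proof (rule smooth_on_cong[OF openU])
  show "smooth_on U (\<lambda>x. 1/4 * (dd Dp x w / Dp x - dd Dm x w / Dm x) + 1/2 * (T1 x w + T2 x w))"
    by (intro smooth_on_add smooth_on_diff smooth_on_mult smooth_on_divide smooth_on_const smooth_onD(2)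
        smooth_D m1.smooth_pullback m2.smooth_pullback openU D_nonzero)
qed (simp add: Om_H_eq)

text \<open>Adding and subtracting \<Omega>(H, X_w) and G(H, X_w) = 0 separates the +1 from the -1
  components of H. Each pair solves a 2 x 2 linear system with determinant \<open>Dm\<close> or
  \<open>Dp\<close> up to \<epsilon>, so H is recovered from \<open>Om_H\<close>.\<close>

lemma H_components:
  assumes x: "x \<in> U"
  shows "cA x (H x) * R x w + \<epsilon> * (cC x (H x) * S x w) = Om_H x w / 2"
    "cB x (H x) * P x w + \<epsilon> * (cD x (H x) * Q x w) = - Om_H x w / 2"
proof -
  have "Om_H x w = cA x (H x) * R x w - cB x (H x) * P x w + \<epsilon> * (cC x (H x) * S x w - cD x (H x) * Q x w)"
    unfolding Om_H_def Om_eq[OF x] comp_dd[OF x] ..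
  moreover have "cA x (H x) * R x w + cB x (H x) * P x w + \<epsilon> * (cC x (H x) * S x w + cD x (H x) * Q x w) = 0"
    using H_normal[OF x, of w] unfolding G_eq[OF x] comp_dd[OF x] .
  ultimately show "cA x (H x) * R x w + \<epsilon> * (cC x (H x) * S x w) = Om_H x w / 2"
    "cB x (H x) * P x w + \<epsilon> * (cD x (H x) * Q x w) = - Om_H x w / 2"
    by (simp_all add: algebra_simps)
qed

lemma smooth_H_components:
  "smooth_on U (\<lambda>x. cA x (H x))" "smooth_on U (\<lambda>x. cB x (H x))"
  "smooth_on U (\<lambda>x. cC x (H x))" "smooth_on U (\<lambda>x. cD x (H x))"
proof -
  have dm: "R x ex * S x ey - R x ey * S x ex \<noteq> 0" if "x \<in> U" for x
    using D_nonzero(2)[OF that] by (simp add: Dm_def wedge_def)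
  have dp: "P x ex * Q x ey - P x ey * Q x ex \<noteq> 0" if "x \<in> U" for x
    using D_nonzero(1)[OF that] by (simp add: Dp_def wedge_def)
  note sm = m1.smooth_pullback m2.smooth_pullback openU smooth_Om_H smooth_on_mult smooth_on_diff
    smooth_on_divide smooth_on_const smooth_on_minus
  have "smooth_on U (\<lambda>x. (Om_H x ex / 2 * S x ey - Om_H x ey / 2 * S x ex) / (R x ex * S x ey - R x ey * S x ex))"
    by (intro sm dm) simp_all
  then show "smooth_on U (\<lambda>x. cA x (H x))"
    by (rule smooth_on_cong[OF openU]) (simp add: solve2(1)[OF eps H_components(1) H_components(1) dm])
  have "smooth_on U (\<lambda>x. \<epsilon> * (R x ex * (Om_H x ey / 2) - R x ey * (Om_H x ex / 2)) / (R x ex * S x ey - R x ey * S x ex))"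
    by (intro sm dm) simp_all
  then show "smooth_on U (\<lambda>x. cC x (H x))"
    by (rule smooth_on_cong[OF openU]) (simp add: solve2(2)[OF eps H_components(1) H_components(1) dm])
  have "smooth_on U (\<lambda>x. (- Om_H x ex / 2 * Q x ey - - Om_H x ey / 2 * Q x ex) / (P x ex * Q x ey - P x ey * Q x ex))"
    by (intro sm dp) simp_all
  then show "smooth_on U (\<lambda>x. cB x (H x))"
    by (rule smooth_on_cong[OF openU]) (simp add: solve2(1)[OF eps H_components(2) H_components(2) dp])
  have "smooth_on U (\<lambda>x. \<epsilon> * (P x ex * (- Om_H x ey / 2) - P x ey * (- Om_H x ex / 2)) / (P x ex * Q x ey - P x ey * Q x ex))"
    by (intro sm dp) simp_all
  then show "smooth_on U (\<lambda>x. cD x (H x))"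
    by (rule smooth_on_cong[OF openU]) (simp add: solve2(2)[OF eps H_components(2) H_components(2) dp])
qed

text \<open>The definition of H through \<open>THE\<close> and \<open>matrix_inv\<close> says
  nothing about regularity; it is inherited from \<open>Om_H\<close>, which has the explicit formula
  \<open>Om_H_eq\<close>. It is what allows \<nabla>H to be expanded by the product rule.\<close>

lemma smooth_H: "smooth_on U H"
proof (rule smooth_on_cong[OF openU])
  show "smooth_on U (\<lambda>x. (m1.of_coframe (fst (F x)) (cA x (H x)) (cB x (H x)),
      m2.of_coframe (snd (F x)) (cC x (H x)) (cD x (H x))))"
    by (intro smooth_on_Pair openU m1.smooth_of_coframe_map m2.smooth_of_coframe_map smooth_H_components)
  fix x assume x: "x \<in> U"
  have "m1.of_coframe (fst (F x)) (cA x (H x)) (cB x (H x)) = fst (H x)"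
    by (rule m1.eqI[OF m1.\<phi>V[OF x]]) (simp_all add: m1.\<phi>V[OF x] cA_def cB_def)
  moreover have "m2.of_coframe (snd (F x)) (cC x (H x)) (cD x (H x)) = snd (H x)"
    by (rule m2.eqI[OF m2.\<phi>V[OF x]]) (simp_all add: m2.\<phi>V[OF x] cC_def cD_def)
  ultimately show "(m1.of_coframe (fst (F x)) (cA x (H x)) (cB x (H x)),
      m2.of_coframe (snd (F x)) (cC x (H x)) (cD x (H x))) = H x" by simp
qed

text \<open>By the product rule this derivative is \<Omega>(\<nabla>_u H, X_w) + \<Omega>(H,
  \<nabla>_u X_w), the connection terms cancelling. The first summand vanishes because \<nabla>_u H
  has no normal part and tangential vectors pair to zero; the second is the right-hand side.\<close>

lemma dd_Om_H:
  assumes x: "x \<in> U"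
  shows "dd (\<lambda>y. Om_H y w) x u = cA x (H x) * m1.pbb x u w - cB x (H x) * m1.paa x u w
    + \<epsilon> * (cC x (H x) * m2.pbb x u w - cD x (H x) * m2.paa x u w)"
proof -
  have "dd (\<lambda>y. Om_H y w) x = dd (\<lambda>y. cA y (H y) * R y w - cB y (H y) * P y w
      + \<epsilon> * (cC y (H y) * S y w - cD y (H y) * Q y w)) x"
    by (rule dd_cong_open[OF openU x]) (simp add: Om_H_def Om_eq)
  also have "\<dots> = (\<lambda>u. (cA x (H x) * dd (\<lambda>y. R y w) x u + dd (\<lambda>y. cA y (H y)) x u * R x w)
      - (cB x (H x) * dd (\<lambda>y. P y w) x u + dd (\<lambda>y. cB y (H y)) x u * P x w)
      + \<epsilon> * ((cC x (H x) * dd (\<lambda>y. S y w) x u + dd (\<lambda>y. cC y (H y)) x u * S x w)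
      - (cD x (H x) * dd (\<lambda>y. Q y w) x u + dd (\<lambda>y. cD y (H y)) x u * Q x w)))"
    by (intro dd_eqI has_derivative_add has_derivative_diff has_derivative_mult has_derivative_mult_right pullback_has_derivative x
      smooth_on_has_derivative[OF _ x] smooth_H_components)
  finally have 1: "dd (\<lambda>y. Om_H y w) x u = (cA x (H x) * dd (\<lambda>y. R y w) x u + dd (\<lambda>y. cA y (H y)) x u * R x w)
      - (cB x (H x) * dd (\<lambda>y. P y w) x u + dd (\<lambda>y. cB y (H y)) x u * P x w)
      + \<epsilon> * ((cC x (H x) * dd (\<lambda>y. S y w) x u + dd (\<lambda>y. cC y (H y)) x u * S x w)
      - (cD x (H x) * dd (\<lambda>y. Q y w) x u + dd (\<lambda>y. cD y (H y)) x u * Q x w))" by (rule fun_cong)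
  have Hd: "H differentiable (at x)" by (rule smooth_onD(1)[OF smooth_H x])
  have "Om (F x) (cov_along G F H x u) (dd F x w) = 0"
    using par[OF x, of u] normal_part_F(3)[OF x] unfolding normal_derivative_def H_def by blast
  then have 2: "(dd (\<lambda>y. cA y (H y)) x u + T1 x u * cA x (H x)) * R x w - (dd (\<lambda>y. cB y (H y)) x u - T1 x u * cB x (H x)) * P x w
    + \<epsilon> * ((dd (\<lambda>y. cC y (H y)) x u + T2 x u * cC x (H x)) * S x w - (dd (\<lambda>y. cD y (H y)) x u - T2 x u * cD x (H x)) * Q x w) = 0"
    unfolding Om_eq[OF x] comp_dd[OF x] cov_along_G[OF x Hd] .
  show ?thesis
    unfolding 1 m1.paa_def m1.pbb_def m2.paa_def m2.pbb_def using 2 by (simp add: algebra_simps)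
qed

text \<open>This is closedness of d log D; writing it as a quotient avoids fixing the sign of
  D.\<close>

lemma dd_log_closed:
  fixes D :: "real^2 \<Rightarrow> real"
  assumes x: "x \<in> U" and D: "smooth_on U D" and D0: "D x \<noteq> 0"
  shows "dd (\<lambda>y. dd D y v / D y) x u = dd (\<lambda>y. dd D y u / D y) x v"
proof -
  have "dd (\<lambda>y. dd D y v / D y) x u = (dd (\<lambda>y. dd D y v) x u * D x - dd D x v * dd D x u) / (D x * D x)" for u v
    using dd_eqI[OF has_derivative_divide'[OF smooth_on_has_derivative[OF smooth_onD(2)[OF D] x]
      smooth_on_has_derivative[OF D x] D0]] by simp
  then show ?thesis using dd_commute[OF openU x D, of u v] by (simp add: mult.commute)
qed

text \<open>\<open>Om_H\<close> is closed by \<open>dd_Om_H\<close> and the symmetry of second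
  derivatives. Its logarithmic terms are closed by themselves, so the pulled back d\<theta>1 +
  d\<theta>2 must vanish.\<close>

lemma ricci_form_zero:
  assumes x: "x \<in> U"
  shows "gauss_curvature b1 (fst (F x)) * wedge (P x) (R x) + gauss_curvature b2 (snd (F x)) * wedge (Q x) (S x) = 0"
proof -
  have closed: "dd (\<lambda>y. Om_H y ey) x ex = dd (\<lambda>y. Om_H y ex) x ey"
    unfolding dd_Om_H[OF x] using m1.second_sym[OF x, of ex ey] m2.second_sym[OF x, of ex ey] by simp
  have d: "dd (\<lambda>y. Om_H y w) x u = 1/4 * (dd (\<lambda>y. dd Dp y w / Dp y) x u - dd (\<lambda>y. dd Dm y w / Dm y) x u)
      + 1/2 * (dd (\<lambda>y. T1 y w) x u + dd (\<lambda>y. T2 y w) x u)" for u w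
  proof -
    have s: "smooth_on U (\<lambda>y. dd Dp y w / Dp y)" "smooth_on U (\<lambda>y. dd Dm y w / Dm y)"
      by (rule smooth_on_divide[OF openU smooth_onD(2)[OF smooth_D(1)] smooth_D(1) D_nonzero(1)]
        smooth_on_divide[OF openU smooth_onD(2)[OF smooth_D(2)] smooth_D(2) D_nonzero(2)]; assumption)+
    have "dd (\<lambda>y. Om_H y w) x = dd (\<lambda>y. 1/4 * (dd Dp y w / Dp y - dd Dm y w / Dm y) + 1/2 * (T1 y w + T2 y w)) x"
      by (rule dd_cong_open[OF openU x]) (rule Om_H_eq)
    also have "\<dots> = (\<lambda>u. 1/4 * (dd (\<lambda>y. dd Dp y w / Dp y) x u - dd (\<lambda>y. dd Dm y w / Dm y) x u)
      + 1/2 * (dd (\<lambda>y. T1 y w) x u + dd (\<lambda>y. T2 y w) x u))"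
      by (intro dd_eqI has_derivative_add has_derivative_diff has_derivative_mult_right
         smooth_on_has_derivative[OF _ x] s m1.smooth_pullback m2.smooth_pullback)
    finally show ?thesis by (rule fun_cong)
  qed
  have "(dd (\<lambda>y. T1 y ey) x ex - dd (\<lambda>y. T1 y ex) x ey) + (dd (\<lambda>y. T2 y ey) x ex - dd (\<lambda>y. T2 y ex) x ey) = 0"
    using closed dd_log_closed[OF x smooth_D(1) D_nonzero(1)[OF x], of ey ex]
      dd_log_closed[OF x smooth_D(2) D_nonzero(2)[OF x], of ey ex] unfolding d by simp
  then show ?thesis
    unfolding m1.pullback_curvature[OF x] m2.pullback_curvature[OF x] wedge_def by (simp add: mult.commute)
qed

end


subsection \<open>Products of curves\<close>

lemma dd_real:
  fixes h :: "real \<Rightarrow> 'n::real_normed_vector"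
  assumes "h differentiable (at s)"
  shows "dd h s r = r *\<^sub>R dd h s 1"
  using linear_scale[OF dd_linear[OF assms], of r 1] by simp

locale curve_factor = coframe_map V b \<alpha> \<beta> U \<phi> for V b \<alpha> \<beta> U \<phi> +
  fixes U0 :: "(real^2) set" and I :: "real set" and f :: "real^2 \<Rightarrow> real" and \<gamma> :: "real \<Rightarrow> real^2"
  assumes openU0: "open U0" and U0U: "U0 \<subseteq> U" and openI: "open I" and smoothf: "smooth_on U0 f"
    and fI: "f ` U0 = I" and smooth\<gamma>: "smooth_on I \<gamma>" and factor: "x \<in> U0 \<Longrightarrow> \<phi> x = \<gamma> (f x)"
begin

definition "vel s = dd \<gamma> s 1"
definition "ca s = \<alpha> (\<gamma> s) (vel s)"
definition "cb s = \<beta> (\<gamma> s) (vel s)"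
definition "ct s = \<theta> (\<gamma> s) (vel s)"

lemma \<gamma>V:
  assumes "s \<in> I"
  shows "\<gamma> s \<in> V"
proof -
  obtain x where "x \<in> U0" "s = f x" using assms fI by blast
  then show ?thesis using factor[of x] \<phi>V[of x] U0U by auto
qed

lemma f_mem: "x \<in> U0 \<Longrightarrow> f x \<in> I"
  using fI by blast

lemma smooth_vel: "smooth_on I vel"
  unfolding vel_def by (rule smooth_onD(2)[OF smooth\<gamma>])

lemma smooth_curve_components: "smooth_on I ca" "smooth_on I cb" "smooth_on I ct"
  unfolding ca_def cb_def ct_def
  by (rule smooth_on_linear_family[OF openI openV image_subsetI lin\<alpha> smooth\<alpha> smooth\<gamma> smooth_vel]
      smooth_on_linear_family[OF openI openV image_subsetI lin\<beta> smooth\<beta> smooth\<gamma> smooth_vel]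
      smooth_on_linear_family[OF openI openV image_subsetI linear\<theta> smooth\<theta> smooth\<gamma> smooth_vel];
    simp add: \<gamma>V)+

lemma dd_comp_f:
  fixes h :: "real \<Rightarrow> 'n::real_normed_vector"
  assumes x: "x \<in> U0" and h: "smooth_on I h"
  shows "((\<lambda>y. h (f y)) has_derivative (\<lambda>u. dd f x u *\<^sub>R dd h (f x) 1)) (at x)"
proof -
  have "dd h (f x) (dd f x u) = dd f x u *\<^sub>R dd h (f x) 1" for u
    by (rule dd_real[OF smooth_onD(1)[OF h f_mem[OF x]]])
  then show ?thesis
    using has_derivative_compose[OF smooth_on_has_derivative[OF smoothf x]
      smooth_on_has_derivative[OF h f_mem[OF x]]] by simp
qed

lemma dd_factor:
  assumes x: "x \<in> U0"
  shows "dd \<phi> x v = dd f x v *\<^sub>R vel (f x)"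
proof -
  have "dd \<phi> x = dd (\<lambda>y. \<gamma> (f y)) x"
    by (rule dd_cong_open[OF openU0 x factor])
  also have "\<dots> = (\<lambda>u. dd f x u *\<^sub>R dd \<gamma> (f x) 1)"
    by (rule dd_eqI[OF dd_comp_f[OF x smooth\<gamma>]])
  finally show ?thesis unfolding vel_def by (rule fun_cong)
qed

lemma pullback_factor:
  assumes x: "x \<in> U0"
  shows "pa x v = dd f x v * ca (f x)" "pb x v = dd f x v * cb (f x)" "pt x v = dd f x v * ct (f x)"
proof -
  note g = \<gamma>V[OF f_mem[OF x]]
  show "pa x v = dd f x v * ca (f x)" "pb x v = dd f x v * cb (f x)" "pt x v = dd f x v * ct (f x)"
    unfolding pa_def pb_def pt_def ca_def cb_def ct_def dd_factor[OF x] factor[OF x]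
    using linear_scale[OF lin\<alpha>[OF g]] linear_scale[OF lin\<beta>[OF g]] linear_scale[OF linear\<theta>[OF g]] by simp_all
qed

lemma metric_vel: "s \<in> I \<Longrightarrow> b (\<gamma> s) (vel s) (vel s) = 2 * (ca s * cb s)"
  by (simp add: metric[OF \<gamma>V] ca_def cb_def)

text \<open>The curvature k of a unit-speed curve: as \<alpha> is fixed by j, the \<alpha>-component
  of D \<gamma>' = k j \<gamma>' reads \<open>ca\<close>' + \<open>ct\<close> \<open>ca\<close> = k
  \<open>ca\<close>.\<close>

definition "geod s = dd ca s 1 / ca s + ct s"

context
  fixes \<eta> :: real
  assumes unit: "\<And>s. s \<in> I \<Longrightarrow> b (\<gamma> s) (vel s) (vel s) = \<eta>" and \<eta>: "\<eta> \<noteq> 0"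
begin

lemma components_nonzero: "s \<in> I \<Longrightarrow> ca s \<noteq> 0" "s \<in> I \<Longrightarrow> cb s \<noteq> 0"
  using unit metric_vel \<eta> by fastforce+

lemma smooth_geod: "smooth_on I geod"
  unfolding geod_def
  by (intro smooth_on_add smooth_on_divide smooth_onD(2) smooth_curve_components openI components_nonzero)

text \<open>Constant speed makes \<open>ca s * cb s\<close> equal to \<eta>/2, so the two
  logarithmic derivatives are opposite. Hence the \<beta>-component, on which j acts by -1, gives
  the same curvature as the \<alpha>-component.\<close>

lemma dd_ca:
  assumes s: "s \<in> I"
  shows "dd ca s 1 = (geod s - ct s) * ca s" "dd cb s 1 = - (geod s - ct s) * cb s"
proof -
  show 1: "dd ca s 1 = (geod s - ct s) * ca s" using components_nonzero[OF s] by (simp add: geod_def)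
  have "dd (\<lambda>s. ca s * cb s) s = dd (\<lambda>s. \<eta> / 2) s"
    by (rule dd_cong_open[OF openI s]) (use unit metric_vel in fastforce)
  also have "\<dots> = (\<lambda>u. 0)" by (rule dd_eqI[OF has_derivative_const])
  also have "dd (\<lambda>s. ca s * cb s) s = (\<lambda>u. ca s * dd cb s u + dd ca s u * cb s)"
    by (intro dd_eqI has_derivative_mult smooth_on_has_derivative[OF _ s] smooth_curve_components)
  finally have "ca s * dd cb s 1 + dd ca s 1 * cb s = 0" by (rule fun_cong)
  then have "ca s * (dd cb s 1 + (geod s - ct s) * cb s) = 0" unfolding 1 by (simp add: algebra_simps)
  then have "dd cb s 1 + (geod s - ct s) * cb s = 0" using components_nonzero[OF s] by simp
  then show "dd cb s 1 = - (geod s - ct s) * cb s" by (simp add: algebra_simps)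
qed

lemma curvature_geod:
  assumes s: "s \<in> I" and lor: "lorentzian_form (b (\<gamma> s))"
  shows "cov_along b \<gamma> vel s 1 = geod s *\<^sub>R para_j (b (\<gamma> s)) (vel s)"
proof (rule eqI[OF \<gamma>V[OF s]])
  note g = \<gamma>V[OF s] and d = smooth_onD(1)[OF smooth\<gamma> s] smooth_onD(1)[OF smooth_vel s]
  note j = para_j[OF lor g]
  show "\<alpha> (\<gamma> s) (cov_along b \<gamma> vel s 1) = \<alpha> (\<gamma> s) (geod s *\<^sub>R para_j (b (\<gamma> s)) (vel s))"
    unfolding cov_along_coframe[OF g d] linear_scale[OF lin\<alpha>[OF g]] j
    using dd_ca(1)[OF s] unfolding ca_def ct_def vel_def by (simp add: algebra_simps)
  show "\<beta> (\<gamma> s) (cov_along b \<gamma> vel s 1) = \<beta> (\<gamma> s) (geod s *\<^sub>R para_j (b (\<gamma> s)) (vel s))"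
    unfolding cov_along_coframe[OF g d] linear_scale[OF lin\<beta>[OF g]] j
    using dd_ca(2)[OF s] unfolding cb_def ct_def vel_def by (simp add: algebra_simps)
qed

lemma second_factor:
  assumes x: "x \<in> U0"
  shows "paa x u v = ca (f x) * (dd (\<lambda>y. dd f y v) x u + geod (f x) * (dd f x u * dd f x v))"
    "pbb x u v = cb (f x) * (dd (\<lambda>y. dd f y v) x u - geod (f x) * (dd f x u * dd f x v))"
proof -
  note s = f_mem[OF x]
  note f2 = smooth_on_has_derivative[OF smooth_onD(2)[OF smoothf] x]
  have "dd (\<lambda>y. pa y v) x = dd (\<lambda>y. dd f y v * ca (f y)) x"
    by (rule dd_cong_open[OF openU0 x]) (rule pullback_factor)
  also have "\<dots> = (\<lambda>u. dd f x v * (dd f x u *\<^sub>R dd ca (f x) 1) + dd (\<lambda>y. dd f y v) x u * ca (f x))"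
    by (intro dd_eqI has_derivative_mult f2 dd_comp_f[OF x] smooth_curve_components)
  finally show "paa x u v = ca (f x) * (dd (\<lambda>y. dd f y v) x u + geod (f x) * (dd f x u * dd f x v))"
    unfolding paa_def pullback_factor[OF x] dd_ca[OF s] by (simp add: algebra_simps)
  have "dd (\<lambda>y. pb y v) x = dd (\<lambda>y. dd f y v * cb (f y)) x"
    by (rule dd_cong_open[OF openU0 x]) (rule pullback_factor)
  also have "\<dots> = (\<lambda>u. dd f x v * (dd f x u *\<^sub>R dd cb (f x) 1) + dd (\<lambda>y. dd f y v) x u * cb (f x))"
    by (intro dd_eqI has_derivative_mult f2 dd_comp_f[OF x] smooth_curve_components)
  finally show "pbb x u v = cb (f x) * (dd (\<lambda>y. dd f y v) x u - geod (f x) * (dd f x u * dd f x v))"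
    unfolding pbb_def pullback_factor[OF x] dd_ca[OF s] by (simp add: algebra_simps)
qed

end

end

lemma wedge_independent:
  fixes p q :: "real^2 \<Rightarrow> real"
  assumes "wedge p q \<noteq> 0" "X * p ex + Y * q ex = X' * p ex + Y' * q ex" "X * p ey + Y * q ey = X' * p ey + Y' * q ey"
  shows "X = X'" "Y = Y'"
proof -
  have "(X - X') * wedge p q = 0" "(Y - Y') * wedge p q = 0"
    using arg_cong[OF assms(2), of "\<lambda>t. q ey * t"] arg_cong[OF assms(3), of "\<lambda>t. q ex * t"]
      arg_cong[OF assms(2), of "\<lambda>t. p ey * t"] arg_cong[OF assms(3), of "\<lambda>t. p ex * t"]
    unfolding wedge_def by (simp_all add: algebra_simps)
  then show "X = X'" "Y = Y'" using assms(1) by auto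
qed

locale product_chart = lagrangian_chart V1 b1 \<alpha>1 \<beta>1 V2 b2 \<alpha>2 \<beta>2 U F \<epsilon> +
  c1: curve_factor V1 b1 \<alpha>1 \<beta>1 U "\<lambda>x. fst (F x)" U0 I1 f \<gamma>1 +
  c2: curve_factor V2 b2 \<alpha>2 \<beta>2 U "\<lambda>x. snd (F x)" U0 I2 g \<gamma>2
  for V1 b1 \<alpha>1 \<beta>1 V2 b2 \<alpha>2 \<beta>2 U F \<epsilon> U0 I1 f \<gamma>1 I2 g \<gamma>2 +
  assumes surj: "s \<in> I1 \<Longrightarrow> t \<in> I2 \<Longrightarrow> \<exists>x\<in>U0. f x = s \<and> g x = t"
    and indep: "x \<in> U0 \<Longrightarrow> wedge (dd f x) (dd g x) \<noteq> 0" and I_ne: "I1 \<noteq> {}" "I2 \<noteq> {}"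
begin

lemma D_factor:
  assumes "x \<in> U0"
  shows "Dp x = c1.ca (f x) * (c2.ca (g x) * wedge (dd f x) (dd g x))"
    "Dm x = c1.cb (f x) * (c2.cb (g x) * wedge (dd f x) (dd g x))"
  unfolding Dp_def Dm_def wedge_def c1.pullback_factor[OF assms] c2.pullback_factor[OF assms]
  by (simp_all add: algebra_simps)

text \<open>The squared speed is twice the product of \<open>ca\<close> and \<open>cb\<close>, and
  the nonvanishing determinants \<open>Dp\<close> and \<open>Dm\<close> contain these as factors:
  nondegeneracy of the surface excludes null curves. Every parameter is met by a point of U0, by
  \<open>surj\<close> and \<open>I_ne\<close>.\<close>

lemma velocity_nonnull:
  "s \<in> I1 \<Longrightarrow> b1 (\<gamma>1 s) (c1.vel s) (c1.vel s) \<noteq> 0" "t \<in> I2 \<Longrightarrow> b2 (\<gamma>2 t) (c2.vel t) (c2.vel t) \<noteq> 0"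
proof -
  have *: "c1.ca s * c1.cb s \<noteq> 0 \<and> c2.ca t * c2.cb t \<noteq> 0" if st: "s \<in> I1" "t \<in> I2" for s t
  proof -
    obtain x where x: "x \<in> U0" "f x = s" "g x = t" using surj[OF st] by blast
    then have "x \<in> U" using c1.U0U by blast
    from D_nonzero[OF this] show ?thesis unfolding D_factor[OF x(1)] x(2,3) by auto
  qed
  show "s \<in> I1 \<Longrightarrow> b1 (\<gamma>1 s) (c1.vel s) (c1.vel s) \<noteq> 0"
    using * I_ne(2) c1.metric_vel by auto
  show "t \<in> I2 \<Longrightarrow> b2 (\<gamma>2 t) (c2.vel t) (c2.vel t) \<noteq> 0"
    using * I_ne(1) c2.metric_vel by auto
qed

context
  fixes \<eta>1 \<eta>2 :: real
  assumes unit1: "\<And>s. s \<in> I1 \<Longrightarrow> b1 (\<gamma>1 s) (c1.vel s) (c1.vel s) = \<eta>1"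
    and unit2: "\<And>t. t \<in> I2 \<Longrightarrow> b2 (\<gamma>2 t) (c2.vel t) (c2.vel t) = \<eta>2"
begin

lemma eta_nonzero: "\<eta>1 \<noteq> 0" "\<eta>2 \<noteq> 0"
  using velocity_nonnull unit1 unit2 I_ne by fastforce+

lemma smooth_curvatures: "smooth_on I1 c1.geod" "smooth_on I2 c2.geod"
  by (rule c1.smooth_geod[OF unit1 eta_nonzero(1)] c2.smooth_geod[OF unit2 eta_nonzero(2)]; assumption)+

lemma second_factors:
  assumes "x \<in> U0"
  shows "m1.paa x u v = c1.ca (f x) * (dd (\<lambda>y. dd f y v) x u + c1.geod (f x) * (dd f x u * dd f x v))"
    "m1.pbb x u v = c1.cb (f x) * (dd (\<lambda>y. dd f y v) x u - c1.geod (f x) * (dd f x u * dd f x v))"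
    "m2.paa x u v = c2.ca (g x) * (dd (\<lambda>y. dd g y v) x u + c2.geod (g x) * (dd g x u * dd g x v))"
    "m2.pbb x u v = c2.cb (g x) * (dd (\<lambda>y. dd g y v) x u - c2.geod (g x) * (dd g x u * dd g x v))"
  by (rule c1.second_factor[OF unit1 eta_nonzero(1)] c2.second_factor[OF unit2 eta_nonzero(2)]; (assumption | rule assms))+

lemma dd_components:
  "s \<in> I1 \<Longrightarrow> dd c1.ca s 1 = (c1.geod s - c1.ct s) * c1.ca s"
  "s \<in> I1 \<Longrightarrow> dd c1.cb s 1 = - (c1.geod s - c1.ct s) * c1.cb s"
  "t \<in> I2 \<Longrightarrow> dd c2.ca t 1 = (c2.geod t - c2.ct t) * c2.ca t"
  "t \<in> I2 \<Longrightarrow> dd c2.cb t 1 = - (c2.geod t - c2.ct t) * c2.cb t"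
  by (rule c1.dd_ca[OF unit1 eta_nonzero(1)] c2.dd_ca[OF unit2 eta_nonzero(2)]; assumption)+

text \<open>The factor df \<and> dg is common to \<open>Dp\<close> and \<open>Dm\<close> and drops
  out of the difference of logarithmic derivatives. What remains is 2 (k - \<open>ct\<close>) for
  each curve, and the connection terms of \<open>Om_H_eq\<close> remove \<open>ct\<close>.\<close>

lemma Om_H_factor:
  assumes x: "x \<in> U0"
  shows "Om_H x w = 1/2 * (c1.geod (f x) * dd f x w + c2.geod (g x) * dd g x w)"
proof -
  let ?W = "\<lambda>y. wedge (dd f y) (dd g y)"
  have Ws: "smooth_on U0 ?W"
    unfolding wedge_def
    by (intro smooth_on_diff smooth_on_mult smooth_onD(2) c1.smoothf c2.smoothf c1.openU0)
  note Wd = smooth_on_has_derivative[OF Ws x]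
  have xU: "x \<in> U" using x c1.U0U by blast
  note s = c1.f_mem[OF x] and t = c2.f_mem[OF x]
  have "dd Dp x = dd (\<lambda>y. c1.ca (f y) * (c2.ca (g y) * ?W y)) x"
    by (rule dd_cong_open[OF c1.openU0 x]) (rule D_factor)
  also have "\<dots> = (\<lambda>u. c1.ca (f x) * (c2.ca (g x) * dd ?W x u + (dd g x u *\<^sub>R dd c2.ca (g x) 1) * ?W x)
       + (dd f x u *\<^sub>R dd c1.ca (f x) 1) * (c2.ca (g x) * ?W x))"
    by (intro dd_eqI has_derivative_mult Wd c1.dd_comp_f[OF x] c2.dd_comp_f[OF x]
        c1.smooth_curve_components c2.smooth_curve_components)
  finally have "dd Dp x w = Dp x * (dd ?W x w / ?W x + (c2.geod (g x) - c2.ct (g x)) * dd g x w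
      + (c1.geod (f x) - c1.ct (f x)) * dd f x w)"
    unfolding D_factor[OF x] dd_components(1)[OF s] dd_components(3)[OF t] using indep[OF x] by (simp add: field_simps)
  then have p: "dd Dp x w / Dp x = dd ?W x w / ?W x + (c2.geod (g x) - c2.ct (g x)) * dd g x w
      + (c1.geod (f x) - c1.ct (f x)) * dd f x w"
    using D_nonzero[OF xU] by simp
  have "dd Dm x = dd (\<lambda>y. c1.cb (f y) * (c2.cb (g y) * ?W y)) x"
    by (rule dd_cong_open[OF c1.openU0 x]) (rule D_factor)
  also have "\<dots> = (\<lambda>u. c1.cb (f x) * (c2.cb (g x) * dd ?W x u + (dd g x u *\<^sub>R dd c2.cb (g x) 1) * ?W x)
       + (dd f x u *\<^sub>R dd c1.cb (f x) 1) * (c2.cb (g x) * ?W x))"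
    by (intro dd_eqI has_derivative_mult Wd c1.dd_comp_f[OF x] c2.dd_comp_f[OF x]
        c1.smooth_curve_components c2.smooth_curve_components)
  finally have "dd Dm x w = Dm x * (dd ?W x w / ?W x - (c2.geod (g x) - c2.ct (g x)) * dd g x w
      - (c1.geod (f x) - c1.ct (f x)) * dd f x w)"
    unfolding D_factor[OF x] dd_components(2)[OF s] dd_components(4)[OF t] using indep[OF x] by (simp add: field_simps)
  then have m: "dd Dm x w / Dm x = dd ?W x w / ?W x - (c2.geod (g x) - c2.ct (g x)) * dd g x w
      - (c1.geod (f x) - c1.ct (f x)) * dd f x w"
    using D_nonzero[OF xU] by simp
  show ?thesis
    unfolding Om_H_eq[OF xU] p m c1.pullback_factor[OF x] c2.pullback_factor[OF x] by (simp add: algebra_simps)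
qed

text \<open>The derivative of \<open>Om_H\<close> is computed twice, from \<open>Om_H_factor\<close>
  and from \<open>dd_Om_H\<close>. Once the components of H are inserted, the Hessians of f and g
  and the terms quadratic in the curvatures cancel, leaving k1' df \<otimes> df + k2' dg \<otimes>
  dg = 0 with df and dg independent.\<close>

lemma geod_derivative_zero:
  assumes x: "x \<in> U0"
  shows "dd c1.geod (f x) 1 = 0" "dd c2.geod (g x) 1 = 0"
proof -
  have xU: "x \<in> U" using x c1.U0U by blast
  note s = c1.f_mem[OF x] and t = c2.f_mem[OF x]
  let ?k1 = "c1.geod (f x)" and ?k2 = "c2.geod (g x)"
  let ?A = "cA x (H x)" and ?B = "cB x (H x)" and ?C = "cC x (H x)" and ?D = "cD x (H x)"
  \<comment> \<open>Comparing the coefficients of df and dg in \<open>H_components\<close> gives A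
    \<open>cb\<close> = k1/4 and B \<open>ca\<close> = - k1/4 for the first curve, and the analogues
    with \<epsilon> for the second.\<close>
  have e1: "(?A * c1.cb (f x)) * dd f x w + (\<epsilon> * (?C * c2.cb (g x))) * dd g x w
      = (?k1 / 4) * dd f x w + (?k2 / 4) * dd g x w" for w
    using H_components(1)[OF xU, of w]
    unfolding Om_H_factor[OF x] c1.pullback_factor[OF x] c2.pullback_factor[OF x] by (simp add: algebra_simps)
  have e2: "(?B * c1.ca (f x)) * dd f x w + (\<epsilon> * (?D * c2.ca (g x))) * dd g x w
      = (- ?k1 / 4) * dd f x w + (- ?k2 / 4) * dd g x w" for w
    using H_components(2)[OF xU, of w]
    unfolding Om_H_factor[OF x] c1.pullback_factor[OF x] c2.pullback_factor[OF x] by (simp add: algebra_simps)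
  note AC = wedge_independent[OF indep[OF x] e1 e1] and BD = wedge_independent[OF indep[OF x] e2 e2]
  have main: "dd c1.geod (f x) 1 * (dd f x u * dd f x w) + dd c2.geod (g x) 1 * (dd g x u * dd g x w) = 0" for u w
  proof -
    have "dd (\<lambda>y. Om_H y w) x = dd (\<lambda>y. 1/2 * (c1.geod (f y) * dd f y w + c2.geod (g y) * dd g y w)) x"
      by (rule dd_cong_open[OF c1.openU0 x]) (rule Om_H_factor)
    also have "\<dots> = (\<lambda>u. 1/2 * ((?k1 * dd (\<lambda>y. dd f y w) x u + (dd f x u *\<^sub>R dd c1.geod (f x) 1) * dd f x w)
        + (?k2 * dd (\<lambda>y. dd g y w) x u + (dd g x u *\<^sub>R dd c2.geod (g x) 1) * dd g x w)))"
      by (intro dd_eqI has_derivative_mult_right has_derivative_add has_derivative_mult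
         c1.dd_comp_f[OF x] c2.dd_comp_f[OF x] smooth_curvatures
         smooth_on_has_derivative[OF smooth_onD(2)[OF c1.smoothf] x] smooth_on_has_derivative[OF smooth_onD(2)[OF c2.smoothf] x])
    finally have "dd (\<lambda>y. Om_H y w) x u = 1/2 * ((?k1 * dd (\<lambda>y. dd f y w) x u + (dd f x u *\<^sub>R dd c1.geod (f x) 1) * dd f x w)
        + (?k2 * dd (\<lambda>y. dd g y w) x u + (dd g x u *\<^sub>R dd c2.geod (g x) 1) * dd g x w))" by (rule fun_cong)
    moreover have "dd (\<lambda>y. Om_H y w) x u =
       (?A * c1.cb (f x)) * (dd (\<lambda>y. dd f y w) x u - ?k1 * (dd f x u * dd f x w))
       - (?B * c1.ca (f x)) * (dd (\<lambda>y. dd f y w) x u + ?k1 * (dd f x u * dd f x w))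
       + ((\<epsilon> * (?C * c2.cb (g x))) * (dd (\<lambda>y. dd g y w) x u - ?k2 * (dd g x u * dd g x w))
       - (\<epsilon> * (?D * c2.ca (g x))) * (dd (\<lambda>y. dd g y w) x u + ?k2 * (dd g x u * dd g x w)))"
      unfolding dd_Om_H[OF xU] second_factors[OF x] by (simp add: algebra_simps)
    ultimately show ?thesis unfolding AC BD by (simp add: algebra_simps)
  qed
  have c: "(dd c1.geod (f x) 1 * dd f x u) * dd f x w + (dd c2.geod (g x) 1 * dd g x u) * dd g x w
      = 0 * dd f x w + 0 * dd g x w" for u w
    using main[of u w] by (simp add: mult.assoc)
  have "dd c1.geod (f x) 1 * dd f x u = 0" "dd c2.geod (g x) 1 * dd g x u = 0" for u
    by (rule wedge_independent[OF indep[OF x] c c])+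
  moreover have "dd f x ex \<noteq> 0 \<or> dd f x ey \<noteq> 0" "dd g x ex \<noteq> 0 \<or> dd g x ey \<noteq> 0"
    using indep[OF x] by (auto simp: wedge_def)
  ultimately show "dd c1.geod (f x) 1 = 0" "dd c2.geod (g x) 1 = 0" by (metis mult_eq_0_iff)+
qed

lemma geod_constant:
  assumes "convex I1" "convex I2"
  shows "\<exists>k. \<forall>s\<in>I1. c1.geod s = k" "\<exists>k. \<forall>t\<in>I2. c2.geod t = k"
proof -
  have z1: "dd c1.geod s 1 = 0" if "s \<in> I1" for s
    using geod_derivative_zero(1) c1.fI that by (metis imageE)
  have z2: "dd c2.geod t 1 = 0" if "t \<in> I2" for t
    using geod_derivative_zero(2) c2.fI that by (metis imageE)
  have d1: "(c1.geod has_derivative (\<lambda>h. 0)) (at s within I1)" if "s \<in> I1" for s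
  proof -
    have "dd c1.geod s r = 0" for r using dd_real[OF smooth_onD(1)[OF smooth_curvatures(1) that], of r] z1[OF that] by simp
    then show ?thesis using has_derivative_at_withinI[OF smooth_on_has_derivative[OF smooth_curvatures(1) that]] by presburger
  qed
  have d2: "(c2.geod has_derivative (\<lambda>h. 0)) (at t within I2)" if "t \<in> I2" for t
  proof -
    have "dd c2.geod t r = 0" for r using dd_real[OF smooth_onD(1)[OF smooth_curvatures(2) that], of r] z2[OF that] by simp
    then show ?thesis using has_derivative_at_withinI[OF smooth_on_has_derivative[OF smooth_curvatures(2) that]] by presburger
  qed
  show "\<exists>k. \<forall>s\<in>I1. c1.geod s = k" using has_derivative_zero_constant[OF assms(1) d1] by blast
  show "\<exists>k. \<forall>t\<in>I2. c2.geod t = k" using has_derivative_zero_constant[OF assms(2) d2] by blast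
qed

end

end


subsection \<open>The local product structure\<close>

lemma constant_sign:
  fixes q :: "real \<Rightarrow> real"
  assumes "continuous_on {a<..<b} q" "\<And>s. s \<in> {a<..<b} \<Longrightarrow> q s \<noteq> 0"
  obtains \<eta> where "\<eta> \<in> {-1, 1}" "\<And>s. s \<in> {a<..<b} \<Longrightarrow> 0 < \<eta> * q s"
proof -
  have "connected (q ` {a<..<b})"
    by (rule connected_continuous_image[OF assms(1)]) simp
  then have seg: "{x..y} \<subseteq> q ` {a<..<b}" if "x \<in> q ` {a<..<b}" "y \<in> q ` {a<..<b}" for x y
    using that connected_contains_Icc by blast
  then have no: False if "s \<in> {a<..<b}" "t \<in> {a<..<b}" "q s < 0" "0 < q t" for s t
  proof -
    have "0 \<in> {q s..q t}" using that(3,4) by simp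
    then have "0 \<in> q ` {a<..<b}" using seg[of "q s" "q t"] that(1,2) by blast
    then show False using assms(2) by fastforce
  qed
  show thesis
  proof (cases "\<exists>t\<in>{a<..<b}. 0 < q t")
    case True
    then have "0 < q s" if "s \<in> {a<..<b}" for s using no assms(2)[OF that] that by (meson linorder_neqE)
    then show thesis using that[of 1] by simp
  next
    case False
    then have "q s < 0" if "s \<in> {a<..<b}" for s using assms(2)[OF that] that by (meson linorder_neqE)
    then show thesis using that[of "-1"] by simp
  qed
qed

text \<open>One coordinate of \<phi> serves as f: where it has a nonzero derivative in some
  direction e, the vectors d\<phi>(v) are multiples of d\<phi>(e), so d\<phi>(v) vanishes as soon as
  this one coordinate of it does.\<close>

lemma rank_one_submersion:
  fixes \<phi> :: "real^2 \<Rightarrow> real^2"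
  assumes U: "open U" "x0 \<in> U" and \<phi>: "smooth_on U \<phi>"
    and rank: "\<And>x. x \<in> U \<Longrightarrow> vol2 (dd \<phi> x ex) (dd \<phi> x ey) = 0" and ne: "dd \<phi> x0 u \<noteq> 0"
  obtains U1 and f :: "real^2 \<Rightarrow> real" where "open U1" "U1 \<subseteq> U" "x0 \<in> U1" "smooth_on U1 f"
    "\<And>x v. x \<in> U1 \<Longrightarrow> dd f x v = 0 \<Longrightarrow> dd \<phi> x v = 0"
proof -
  have lin: "linear (dd \<phi> x)" if "x \<in> U" for x by (rule dd_linear[OF smooth_onD(1)[OF \<phi> that]])
  obtain e i where e: "e = ex \<or> e = ey" "dd \<phi> x0 e $ i \<noteq> 0"
  proof -
    have "dd \<phi> x0 ex \<noteq> 0 \<or> dd \<phi> x0 ey \<noteq> 0"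
      using ne linear_expand2[OF lin[OF U(2)], of u] by auto
    then show thesis using that by (auto simp: vec_eq_iff)
  qed
  define U1 where "U1 = {x \<in> U. dd \<phi> x e $ i \<noteq> 0}"
  have "continuous_on U (\<lambda>x. dd \<phi> x e $ i)"
    by (intro smooth_onD(3) smooth_on_vec_nth smooth_onD(2) \<phi> U(1))
  from continuous_open_preimage[OF this U(1), of "- {0}"] have oU1: "open U1"
    by (auto simp: U1_def vimage_def Int_def)
  have "dd \<phi> x v = 0" if x: "x \<in> U1" and v: "dd (\<lambda>y. \<phi> y $ i) x v = 0" for x v
  proof -
    have xU: "x \<in> U" using x by (simp add: U1_def)
    have "dd (\<lambda>y. \<phi> y $ i) x v = dd \<phi> x v $ i"
      by (rule dd_bounded_linear[OF bounded_linear_vec_nth smooth_onD(1)[OF \<phi> xU]])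
    then have 0: "dd \<phi> x v $ i = 0" using v by simp
    have e0: "dd \<phi> x e $ i \<noteq> 0" using x by (simp add: U1_def)
    have exp: "dd \<phi> x v = v$1 *\<^sub>R dd \<phi> x ex + v$2 *\<^sub>R dd \<phi> x ey" by (rule linear_expand2[OF lin[OF xU]])
    have "vol2 (dd \<phi> x v) (dd \<phi> x e) = 0"
      using e(1) rank[OF xU] unfolding exp vol2_def by (auto simp: algebra_simps)
    then have z: "dd \<phi> x v $ 1 * dd \<phi> x e $ 2 = dd \<phi> x v $ 2 * dd \<phi> x e $ 1" by (simp add: vol2_def)
    show "dd \<phi> x v = 0"
    proof (cases "i = 1")
      case True
      then show ?thesis using z 0 e0 by (simp add: vec_eq_iff forall_2)
    next
      case False
      then have "i = 2" using exhaust_2 by blast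
      then show ?thesis using z 0 e0 by (simp add: vec_eq_iff forall_2)
    qed
  qed
  moreover have "smooth_on U1 (\<lambda>y. \<phi> y $ i)"
    by (rule smooth_on_vec_nth[OF oU1 smooth_on_subset[OF \<phi>]]) (simp add: U1_def)
  moreover have "U1 \<subseteq> U" "x0 \<in> U1" using U(2) e(2) by (auto simp: U1_def)
  ultimately show thesis by (intro that[of U1 "\<lambda>y. \<phi> y $ i", OF oU1])
qed

context coframe_map
begin

lemma wedge_pullback:
  assumes "x \<in> U"
  shows "wedge (pa x) (pb x) = vol2 (dd \<phi> x ex) (dd \<phi> x ey) * wedge (\<alpha> (\<phi> x)) (\<beta> (\<phi> x))"
  using wedge_vol[OF \<phi>V[OF assms], of "dd \<phi> x ex" "dd \<phi> x ey"] by (simp add: wedge_def pa_def pb_def mult.commute)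

text \<open>At x the derivative of \<phi> is invertible, so \<phi> x is an interior point of the
  image of N, which therefore contains a nonempty open set.\<close>

lemma open_image_not_negligible:
  assumes N: "open N" "N \<subseteq> U" "x \<in> N" and w: "wedge (pa x) (pb x) \<noteq> 0"
  shows "\<not> negligible (\<phi> ` N)"
proof
  assume neg: "negligible (\<phi> ` N)"
  have x: "x \<in> U" using N by blast
  note lin = linear_dd\<phi>[OF x]
  have v: "vol2 (dd \<phi> x ex) (dd \<phi> x ey) \<noteq> 0" using w wedge_pullback[OF x] by auto
  have "u = 0" if "dd \<phi> x u = 0" for u
  proof -
    have z: "u$1 *\<^sub>R dd \<phi> x ex + u$2 *\<^sub>R dd \<phi> x ey = 0" using that linear_expand2[OF lin, of u] by simp
    have z1: "u$1 * dd \<phi> x ex $ i + u$2 * dd \<phi> x ey $ i = 0" for i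
    proof -
      have "(u$1 *\<^sub>R dd \<phi> x ex + u$2 *\<^sub>R dd \<phi> x ey) $ i = 0" unfolding z by simp
      then show ?thesis by simp
    qed
    have "u$1 * vol2 (dd \<phi> x ex) (dd \<phi> x ey) = (u$1 * dd \<phi> x ex $ 1 + u$2 * dd \<phi> x ey $ 1) * dd \<phi> x ey $ 2
       - (u$1 * dd \<phi> x ex $ 2 + u$2 * dd \<phi> x ey $ 2) * dd \<phi> x ey $ 1"
      "u$2 * vol2 (dd \<phi> x ex) (dd \<phi> x ey) = (u$1 * dd \<phi> x ex $ 2 + u$2 * dd \<phi> x ey $ 2) * dd \<phi> x ex $ 1
       - (u$1 * dd \<phi> x ex $ 1 + u$2 * dd \<phi> x ey $ 1) * dd \<phi> x ex $ 2"
      by (simp_all add: vol2_def algebra_simps)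
    then have "u$1 * vol2 (dd \<phi> x ex) (dd \<phi> x ey) = 0" "u$2 * vol2 (dd \<phi> x ex) (dd \<phi> x ey) = 0"
      unfolding z1 by simp_all
    then show "u = 0" using v by (simp add: vec_eq_iff forall_2)
  qed
  then have "inj (dd \<phi> x)" using linear_injective_0[OF lin] by blast
  then obtain g where g: "linear g" "g \<circ> dd \<phi> x = id" using linear_injective_left_inverse[OF lin] by blast
  have "dd \<phi> x \<circ> g = id" using linear_inverse_left[OF lin g(1)] g(2) by blast
  then have "\<phi> x \<in> interior (\<phi> ` N)"
    using sussmann_open_mapping[OF openU smooth_onD(3)[OF smooth\<phi>] x smooth_on_has_derivative[OF smooth\<phi> x], of g N]
      N g(1) by (simp add: interior_open linear_conv_bounded_linear)
  moreover have "negligible (interior (\<phi> ` N))"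
    by (rule negligible_subset[OF neg interior_subset])
  ultimately show False using open_not_negligible[OF open_interior] by blast
qed

end

section \<open>Arclength and local product charts\<close>

lemma (in curve_factor) unit_speed:
  assumes I: "I = {l<..<r}" and nn: "\<And>s. s \<in> I \<Longrightarrow> b (\<gamma> s) (vel s) (vel s) \<noteq> 0"
  obtains \<eta> \<sigma> \<rho> where "\<eta> \<in> {-1, 1}" "smooth_on I \<sigma>" "\<And>s. s \<in> I \<Longrightarrow> dd \<sigma> s 1 = \<rho> s"
    "\<And>s. s \<in> I \<Longrightarrow> 0 < \<rho> s" "\<And>s. s \<in> I \<Longrightarrow> b (\<gamma> s) (vel s) (vel s) = \<eta> * (\<rho> s * \<rho> s)"
proof -
  define q where "q s = 2 * (ca s * cb s)" for s
  have qs: "smooth_on I q"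
    unfolding q_def by (intro smooth_on_mult smooth_on_const smooth_curve_components openI)
  obtain \<eta> where \<eta>: "\<eta> \<in> {-1, 1}" "\<And>s. s \<in> I \<Longrightarrow> 0 < \<eta> * q s"
  proof (rule constant_sign[of l r q])
    show "continuous_on {l<..<r} q" using smooth_onD(3)[OF qs] by (simp add: I)
    show "q s \<noteq> 0" if "s \<in> {l<..<r}" for s using that nn[of s] metric_vel[of s] by (simp add: I q_def)
  qed (use I in blast)
  \<comment> \<open>\<rho> is the speed of the curve and its antiderivative \<sigma> the arclength;
    \<eta> is the causal character, constant because a non-null speed cannot change sign.\<close>
  define \<rho> where "\<rho> s = sqrt (\<eta> * q s)" for s
  have "smooth_on I \<rho>"
    unfolding \<rho>_def by (intro smooth_on_sqrt smooth_on_mult smooth_on_const qs openI \<eta>(2))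
  then have "smooth_on {l<..<r} \<rho>" unfolding I .
  then obtain \<sigma> where "smooth_on {l<..<r} \<sigma>" "\<And>s. s \<in> {l<..<r} \<Longrightarrow> (\<sigma> has_real_derivative \<rho> s) (at s)"
    by (rule smooth_antiderivative) (rule that, assumption+)
  note \<sigma> = this[folded I]
  show thesis
  proof (rule that[OF \<eta>(1) \<sigma>(1)])
    fix s assume s: "s \<in> I"
    show "dd \<sigma> s 1 = \<rho> s" using dd_eqI[OF \<sigma>(2)[OF s, unfolded has_field_derivative_def]] by simp
    show "0 < \<rho> s" using \<eta>(2)[OF s] by (simp add: \<rho>_def)
    have "\<rho> s * \<rho> s = \<eta> * q s" using \<eta>(2)[OF s] by (simp add: \<rho>_def)
    then show "b (\<gamma> s) (vel s) (vel s) = \<eta> * (\<rho> s * \<rho> s)"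
      using \<eta>(1) metric_vel[OF s] by (auto simp: q_def)
  qed
qed

context lagrangian_chart
begin

lemma wedge_lagrange: "x \<in> U \<Longrightarrow> wedge (P x) (R x) + \<epsilon> * wedge (Q x) (S x) = 0"
  using lagrange[of x ex ey] by (simp add: wedge_def algebra_simps)

text \<open>Used twice: for the first pair of coordinate functions, and again after the passage to
  arclength.\<close>

lemma product_chart_from:
  assumes U': "open U'" "U' \<subseteq> U" "x0 \<in> U'" and f: "smooth_on U' f" and g: "smooth_on U' g"
    and J: "wedge (dd f x0) (dd g x0) \<noteq> 0"
    and kf: "\<And>x v. x \<in> U' \<Longrightarrow> dd f x v = 0 \<Longrightarrow> dd (\<lambda>x. fst (F x)) x v = 0"
    and kg: "\<And>x v. x \<in> U' \<Longrightarrow> dd g x v = 0 \<Longrightarrow> dd (\<lambda>x. snd (F x)) x v = 0"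
  obtains U0 a b c d \<zeta> \<gamma>1 \<gamma>2 where
    "product_chart V1 b1 \<alpha>1 \<beta>1 V2 b2 \<alpha>2 \<beta>2 U F \<epsilon> U0 {a<..<b} f \<gamma>1 {c<..<d} g \<gamma>2"
    "x0 \<in> U0" "U0 \<subseteq> U'" "smooth_on ({a<..<b} \<times> {c<..<d}) \<zeta>"
    "\<And>x. x \<in> U0 \<Longrightarrow> \<zeta> (f x, g x) = x"
    "\<And>s t. s \<in> {a<..<b} \<Longrightarrow> t \<in> {c<..<d} \<Longrightarrow> \<zeta> (s, t) \<in> U0 \<and> f (\<zeta> (s, t)) = s \<and> g (\<zeta> (s, t)) = t"
proof (rule product_coordinates[OF U'(1,3) f g J smooth_on_subset[OF m1.smooth\<phi> U'(2)]
      smooth_on_subset[OF m2.smooth\<phi> U'(2)] kf kg])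
  fix U0 a b c d \<zeta> \<gamma>1 \<gamma>2
  assume U0: "open U0" "U0 \<subseteq> U'" "x0 \<in> U0"
    and fg: "\<And>x. x \<in> U0 \<Longrightarrow> f x \<in> {a<..<b} \<and> g x \<in> {c<..<d} \<and> \<zeta> (f x, g x) = x"
    and z: "\<And>s t. s \<in> {a<..<b} \<Longrightarrow> t \<in> {c<..<d} \<Longrightarrow> \<zeta> (s, t) \<in> U0 \<and> f (\<zeta> (s, t)) = s \<and> g (\<zeta> (s, t)) = t"
    and sz: "smooth_on ({a<..<b} \<times> {c<..<d}) \<zeta>"
    and J: "\<And>x. x \<in> U0 \<Longrightarrow> wedge (dd f x) (dd g x) \<noteq> 0"
    and sg: "smooth_on {a<..<b} \<gamma>1" "smooth_on {c<..<d} \<gamma>2"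
    and F: "\<And>x. x \<in> U0 \<Longrightarrow> fst (F x) = \<gamma>1 (f x) \<and> snd (F x) = \<gamma>2 (g x)"
  have ne: "f x0 \<in> {a<..<b}" "g x0 \<in> {c<..<d}" using fg[OF U0(3)] by auto
  have im1: "f ` U0 = {a<..<b}" using fg z ne(2) by (auto simp: image_iff) (metis greaterThanLessThan_iff)
  have im2: "g ` U0 = {c<..<d}" using fg z ne(1) by (auto simp: image_iff) (metis greaterThanLessThan_iff)
  have "curve_factor V1 b1 \<alpha>1 \<beta>1 U (\<lambda>x. fst (F x)) U0 {a<..<b} f \<gamma>1"
    using U0 U'(2) smooth_on_subset[OF f U0(2)] im1 sg(1) F
    by (intro curve_factor.intro m1.coframe_map_axioms curve_factor_axioms.intro) auto
  moreover have "curve_factor V2 b2 \<alpha>2 \<beta>2 U (\<lambda>x. snd (F x)) U0 {c<..<d} g \<gamma>2"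
    using U0 U'(2) smooth_on_subset[OF g U0(2)] im2 sg(2) F
    by (intro curve_factor.intro m2.coframe_map_axioms curve_factor_axioms.intro) auto
  moreover have "product_chart_axioms U0 {a<..<b} f {c<..<d} g"
  proof (rule product_chart_axioms.intro)
    show "\<exists>x\<in>U0. f x = s \<and> g x = t" if "s \<in> {a<..<b}" "t \<in> {c<..<d}" for s t using z[OF that] by blast
  qed (use J ne in auto)
  ultimately have "product_chart V1 b1 \<alpha>1 \<beta>1 V2 b2 \<alpha>2 \<beta>2 U F \<epsilon> U0 {a<..<b} f \<gamma>1 {c<..<d} g \<gamma>2"
    by (intro product_chart.intro lagrangian_chart_axioms)
  then show thesis
  proof (rule that)
    show "\<zeta> (f x, g x) = x" if "x \<in> U0" for x using fg[OF that] by blast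
    show "\<zeta> (s, t) \<in> U0 \<and> f (\<zeta> (s, t)) = s \<and> g (\<zeta> (s, t)) = t"
      if "s \<in> {a<..<b}" "t \<in> {c<..<d}" for s t by (rule z[OF that])
  qed (rule U0 sz)+
qed

lemma product_chart_exists:
  assumes PR: "\<And>x. x \<in> U \<Longrightarrow> wedge (P x) (R x) = 0" and x0: "x0 \<in> U"
  obtains U0 a b c d \<zeta> f g \<gamma>1 \<gamma>2 where
    "product_chart V1 b1 \<alpha>1 \<beta>1 V2 b2 \<alpha>2 \<beta>2 U F \<epsilon> U0 {a<..<b} f \<gamma>1 {c<..<d} g \<gamma>2" "x0 \<in> U0"
proof -
  have QS: "wedge (Q x) (S x) = 0" if "x \<in> U" for x
    using wedge_lagrange[OF that] PR[OF that] eps0 by simp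
  have r1: "vol2 (dd (\<lambda>x. fst (F x)) x ex) (dd (\<lambda>x. fst (F x)) x ey) = 0" if "x \<in> U" for x
    using PR[OF that] m1.wedge_pullback[OF that] m1.wedge_neg[OF m1.\<phi>V[OF that]] by simp
  have r2: "vol2 (dd (\<lambda>x. snd (F x)) x ex) (dd (\<lambda>x. snd (F x)) x ey) = 0" if "x \<in> U" for x
    using QS[OF that] m2.wedge_pullback[OF that] m2.wedge_neg[OF m2.\<phi>V[OF that]] by simp
  \<comment> \<open>As \<open>Dp\<close> is nonzero at x0, neither P nor Q vanishes there, so both
    projections have rank exactly one.\<close>
  have "P x0 ex \<noteq> 0 \<or> P x0 ey \<noteq> 0" "Q x0 ex \<noteq> 0 \<or> Q x0 ey \<noteq> 0"
    using D_nonzero(1)[OF x0] by (auto simp: Dp_def wedge_def)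
  then obtain u1 u2 where "P x0 u1 \<noteq> 0" "Q x0 u2 \<noteq> 0" by blast
  then have u1: "dd (\<lambda>x. fst (F x)) x0 u1 \<noteq> 0" and u2: "dd (\<lambda>x. snd (F x)) x0 u2 \<noteq> 0"
    unfolding m1.pa_def m2.pa_def
    using linear_0[OF m1.lin\<alpha>[OF m1.\<phi>V[OF x0]]] linear_0[OF m2.lin\<alpha>[OF m2.\<phi>V[OF x0]]] by auto
  obtain Uf and f :: "real^2 \<Rightarrow> real" where
    f: "open Uf" "Uf \<subseteq> U" "x0 \<in> Uf" "smooth_on Uf f" "\<And>x v. x \<in> Uf \<Longrightarrow> dd f x v = 0 \<Longrightarrow> dd (\<lambda>x. fst (F x)) x v = 0"
    by (rule rank_one_submersion[OF openU x0 m1.smooth\<phi> r1 u1]) (assumption, rule that, assumption+)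
  obtain Ug and g :: "real^2 \<Rightarrow> real" where
    g: "open Ug" "Ug \<subseteq> U" "x0 \<in> Ug" "smooth_on Ug g" "\<And>x v. x \<in> Ug \<Longrightarrow> dd g x v = 0 \<Longrightarrow> dd (\<lambda>x. snd (F x)) x v = 0"
    by (rule rank_one_submersion[OF openU x0 m2.smooth\<phi> r2 u2]) (assumption, rule that, assumption+)
  define U' where "U' = Uf \<inter> Ug"
  have U': "open U'" "U' \<subseteq> U" "x0 \<in> U'" using f g by (auto simp: U'_def)
  have sf: "smooth_on U' f" and sg: "smooth_on U' g"
    unfolding U'_def by (rule smooth_on_subset[OF f(4)] smooth_on_subset[OF g(4)]; simp)+
  \<comment> \<open>A common kernel vector of df and dg would be killed by both P and Q, against
    \<open>Dp\<close> \<noteq> 0.\<close>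
  have J: "wedge (dd f x0) (dd g x0) \<noteq> 0"
  proof
    assume "wedge (dd f x0) (dd g x0) = 0"
    then obtain u where u: "u \<noteq> 0" "dd f x0 u = 0" "dd g x0 u = 0"
      using wedge_zeroE[OF dd_linear[OF smooth_onD(1)[OF f(4,3)]] dd_linear[OF smooth_onD(1)[OF g(4,3)]]] by metis
    have "P x0 u = 0" "Q x0 u = 0"
      using f(5)[OF f(3) u(2)] g(5)[OF g(3) u(3)] unfolding m1.pa_def m2.pa_def
      using linear_0[OF m1.lin\<alpha>[OF m1.\<phi>V[OF x0]]] linear_0[OF m2.lin\<alpha>[OF m2.\<phi>V[OF x0]]] by simp_all
    then have pq: "u$1 * P x0 ex + u$2 * P x0 ey = 0" "u$1 * Q x0 ex + u$2 * Q x0 ey = 0"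
      using linear_expand2[OF m1.linear_pullback(1)[OF x0], of u] linear_expand2[OF m2.linear_pullback(1)[OF x0], of u] by simp_all
    have "u$1 * Dp x0 = (u$1 * P x0 ex + u$2 * P x0 ey) * Q x0 ey - (u$1 * Q x0 ex + u$2 * Q x0 ey) * P x0 ey"
      "u$2 * Dp x0 = (u$1 * Q x0 ex + u$2 * Q x0 ey) * P x0 ex - (u$1 * P x0 ex + u$2 * P x0 ey) * Q x0 ex"
      by (simp_all add: Dp_def wedge_def algebra_simps)
    then have "u = 0" unfolding pq using D_nonzero(1)[OF x0] by (simp add: vec_eq_iff forall_2)
    then show False using u(1) by simp
  qed
  show thesis
  proof (rule product_chart_from[OF U' sf sg J])
    show "dd (\<lambda>x. fst (F x)) x v = 0" if "x \<in> U'" "dd f x v = 0" for x v using that f(5) by (simp add: U'_def)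
    show "dd (\<lambda>x. snd (F x)) x v = 0" if "x \<in> U'" "dd g x v = 0" for x v using that g(5) by (simp add: U'_def)
  qed (rule that)
qed

end

text \<open>Arclength is introduced on the level of functions: f and g are replaced by \<sigma>1
  \<circ> f and \<sigma>2 \<circ> g, and the product chart is built anew. This avoids inverting
  \<sigma>1 and \<sigma>2, at the price of a smaller neighbourhood.\<close>

lemma (in product_chart) unit_speed_reparametrisation:
  assumes I: "I1 = {a<..<b}" "I2 = {c<..<d}" and x0: "x0 \<in> U0"
  obtains U0' a' b' c' d' \<zeta> f' g' \<gamma>1' \<gamma>2' \<eta>1 \<eta>2 where
    "product_chart V1 b1 \<alpha>1 \<beta>1 V2 b2 \<alpha>2 \<beta>2 U F \<epsilon> U0' {a'<..<b'} f' \<gamma>1' {c'<..<d'} g' \<gamma>2'"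
    "x0 \<in> U0'" "smooth_on ({a'<..<b'} \<times> {c'<..<d'}) \<zeta>"
    "\<And>x. x \<in> U0' \<Longrightarrow> \<zeta> (f' x, g' x) = x"
    "\<And>s t. s \<in> {a'<..<b'} \<Longrightarrow> t \<in> {c'<..<d'} \<Longrightarrow> \<zeta> (s, t) \<in> U0' \<and> f' (\<zeta> (s, t)) = s \<and> g' (\<zeta> (s, t)) = t"
    "\<eta>1 \<in> {-1, 1}" "\<eta>2 \<in> {-1, 1}"
    "\<And>s. s \<in> {a'<..<b'} \<Longrightarrow> b1 (\<gamma>1' s) (dd \<gamma>1' s 1) (dd \<gamma>1' s 1) = \<eta>1"
    "\<And>t. t \<in> {c'<..<d'} \<Longrightarrow> b2 (\<gamma>2' t) (dd \<gamma>2' t 1) (dd \<gamma>2' t 1) = \<eta>2"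
proof -
  obtain \<eta>1 \<sigma>1 \<rho>1 where 1: "\<eta>1 \<in> {-1, 1}" "smooth_on I1 \<sigma>1" "\<And>s. s \<in> I1 \<Longrightarrow> dd \<sigma>1 s 1 = \<rho>1 s"
    "\<And>s. s \<in> I1 \<Longrightarrow> 0 < \<rho>1 s" "\<And>s. s \<in> I1 \<Longrightarrow> b1 (\<gamma>1 s) (c1.vel s) (c1.vel s) = \<eta>1 * (\<rho>1 s * \<rho>1 s)"
    using c1.unit_speed[OF I(1) velocity_nonnull(1)] by metis
  obtain \<eta>2 \<sigma>2 \<rho>2 where 2: "\<eta>2 \<in> {-1, 1}" "smooth_on I2 \<sigma>2" "\<And>s. s \<in> I2 \<Longrightarrow> dd \<sigma>2 s 1 = \<rho>2 s"
    "\<And>s. s \<in> I2 \<Longrightarrow> 0 < \<rho>2 s" "\<And>s. s \<in> I2 \<Longrightarrow> b2 (\<gamma>2 s) (c2.vel s) (c2.vel s) = \<eta>2 * (\<rho>2 s * \<rho>2 s)"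
    using c2.unit_speed[OF I(2) velocity_nonnull(2)] by metis
  define f' where "f' x = \<sigma>1 (f x)" for x
  define g' where "g' x = \<sigma>2 (g x)" for x
  have sf: "smooth_on U0 f'" unfolding f'_def
    by (rule smooth_on_compose[OF c1.openU0 c1.openI _ 1(2) c1.smoothf]) (use c1.f_mem in blast)
  have sg: "smooth_on U0 g'" unfolding g'_def
    by (rule smooth_on_compose[OF c2.openU0 c2.openI _ 2(2) c2.smoothf]) (use c2.f_mem in blast)
  have df: "dd f' x v = dd f x v * \<rho>1 (f x)" if "x \<in> U0" for x v
    unfolding f'_def using dd_eqI[OF c1.dd_comp_f[OF that 1(2)]] 1(3)[OF c1.f_mem[OF that]] by simp
  have dg: "dd g' x v = dd g x v * \<rho>2 (g x)" if "x \<in> U0" for x v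
    unfolding g'_def using dd_eqI[OF c2.dd_comp_f[OF that 2(2)]] 2(3)[OF c2.f_mem[OF that]] by simp
  have \<rho>: "\<rho>1 (f x) \<noteq> 0" "\<rho>2 (g x) \<noteq> 0" if "x \<in> U0" for x
    using 1(4)[OF c1.f_mem[OF that]] 2(4)[OF c2.f_mem[OF that]] by auto
  have J: "wedge (dd f' x0) (dd g' x0) \<noteq> 0"
  proof -
    have "wedge (dd f' x0) (dd g' x0) = wedge (dd f x0) (dd g x0) * (\<rho>1 (f x0) * \<rho>2 (g x0))"
      unfolding wedge_def df[OF x0] dg[OF x0] by (simp add: algebra_simps)
    then show ?thesis using indep[OF x0] \<rho>[OF x0] by simp
  qed
  have kf: "dd (\<lambda>x. fst (F x)) x v = 0" if "x \<in> U0" "dd f' x v = 0" for x v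
    using that df \<rho> c1.dd_factor by simp
  have kg: "dd (\<lambda>x. snd (F x)) x v = 0" if "x \<in> U0" "dd g' x v = 0" for x v
    using that dg \<rho> c2.dd_factor by simp
  show thesis
  proof (rule product_chart_from[OF c1.openU0 c1.U0U x0 sf sg J kf kg])
    fix U0' a' b' c' d' \<zeta> \<gamma>1' \<gamma>2'
    assume pc: "product_chart V1 b1 \<alpha>1 \<beta>1 V2 b2 \<alpha>2 \<beta>2 U F \<epsilon> U0' {a'<..<b'} f' \<gamma>1' {c'<..<d'} g' \<gamma>2'"
      and x0': "x0 \<in> U0'" and U0': "U0' \<subseteq> U0" and \<zeta>: "smooth_on ({a'<..<b'} \<times> {c'<..<d'}) \<zeta>"
      "\<And>x. x \<in> U0' \<Longrightarrow> \<zeta> (f' x, g' x) = x"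
      "\<And>s t. s \<in> {a'<..<b'} \<Longrightarrow> t \<in> {c'<..<d'} \<Longrightarrow> \<zeta> (s, t) \<in> U0' \<and> f' (\<zeta> (s, t)) = s \<and> g' (\<zeta> (s, t)) = t"
    interpret n: product_chart V1 b1 \<alpha>1 \<beta>1 V2 b2 \<alpha>2 \<beta>2 U F \<epsilon> U0' "{a'<..<b'}" f' \<gamma>1' "{c'<..<d'}" g' \<gamma>2'
      by (rule pc)
    have u1: "b1 (\<gamma>1' s) (dd \<gamma>1' s 1) (dd \<gamma>1' s 1) = \<eta>1" if s: "s \<in> {a'<..<b'}" for s
    proof -
      obtain x where x: "x \<in> U0'" "f' x = s" using s n.c1.fI by (metis imageE)
      then have xU: "x \<in> U0" using U0' by blast
      obtain v where v: "dd f x v \<noteq> 0" using indep[OF xU] unfolding wedge_def by (metis diff_self mult_zero_left)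
      \<comment> \<open>Both charts factor the same map, so its derivative in a direction v with
        df(v) \<noteq> 0 compares the old velocity with the new one.\<close>
      have "dd f x v *\<^sub>R c1.vel (f x) = dd f x v *\<^sub>R (\<rho>1 (f x) *\<^sub>R dd \<gamma>1' s 1)"
        using c1.dd_factor[OF xU, of v] n.c1.dd_factor[OF x(1), of v] df[OF xU, of v] x(2) by (simp add: n.c1.vel_def)
      then have vel: "c1.vel (f x) = \<rho>1 (f x) *\<^sub>R dd \<gamma>1' s 1" using v scaleR_cancel_left by blast
      have pt: "\<gamma>1 (f x) = \<gamma>1' s" using c1.factor[OF xU] n.c1.factor[OF x(1)] x(2) by simp
      have bil: "bilinear (b1 (\<gamma>1' s))" by (rule m1.bilinear_metric[OF n.c1.\<gamma>V[OF s]])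
      have "(\<rho>1 (f x) * \<rho>1 (f x)) * b1 (\<gamma>1' s) (dd \<gamma>1' s 1) (dd \<gamma>1' s 1) = \<eta>1 * (\<rho>1 (f x) * \<rho>1 (f x))"
        using 1(5)[OF c1.f_mem[OF xU]] unfolding vel pt by (simp add: bilinear_lmul[OF bil] bilinear_rmul[OF bil])
      then show ?thesis using \<rho>(1)[OF xU] by (simp add: mult.commute)
    qed
    have u2: "b2 (\<gamma>2' s) (dd \<gamma>2' s 1) (dd \<gamma>2' s 1) = \<eta>2" if s: "s \<in> {c'<..<d'}" for s
    proof -
      obtain x where x: "x \<in> U0'" "g' x = s" using s n.c2.fI by (metis imageE)
      then have xU: "x \<in> U0" using U0' by blast
      obtain v where v: "dd g x v \<noteq> 0" using indep[OF xU] unfolding wedge_def by (metis diff_self mult_zero_right)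
      have "dd g x v *\<^sub>R c2.vel (g x) = dd g x v *\<^sub>R (\<rho>2 (g x) *\<^sub>R dd \<gamma>2' s 1)"
        using c2.dd_factor[OF xU, of v] n.c2.dd_factor[OF x(1), of v] dg[OF xU, of v] x(2) by (simp add: n.c2.vel_def)
      then have vel: "c2.vel (g x) = \<rho>2 (g x) *\<^sub>R dd \<gamma>2' s 1" using v scaleR_cancel_left by blast
      have pt: "\<gamma>2 (g x) = \<gamma>2' s" using c2.factor[OF xU] n.c2.factor[OF x(1)] x(2) by simp
      have bil: "bilinear (b2 (\<gamma>2' s))" by (rule m2.bilinear_metric[OF n.c2.\<gamma>V[OF s]])
      have "(\<rho>2 (g x) * \<rho>2 (g x)) * b2 (\<gamma>2' s) (dd \<gamma>2' s 1) (dd \<gamma>2' s 1) = \<eta>2 * (\<rho>2 (g x) * \<rho>2 (g x))"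
        using 2(5)[OF c2.f_mem[OF xU]] unfolding vel pt by (simp add: bilinear_lmul[OF bil] bilinear_rmul[OF bil])
      then show ?thesis using \<rho>(2)[OF xU] by (simp add: mult.commute)
    qed
    show thesis by (rule that[OF pc x0' \<zeta> 1(1) 2(1) u1 u2])
  qed
qed

context lagrangian_chart
begin

text \<open>K and N isolate what cases (i) and (ii) of the theorem have in common. Where the
  projections are local diffeomorphisms, \<kappa>1 = \<epsilon> \<kappa>2; K turns this into
  flatness of both factors on open sets, and N forbids that for at least one of them.\<close>

lemma pullback_omega_zero:
  assumes K: "\<And>y z. y \<in> V1 \<Longrightarrow> z \<in> V2 \<Longrightarrow> gauss_curvature b1 y = \<epsilon> * gauss_curvature b2 z \<Longrightarrow>
      gauss_curvature b1 y = 0 \<and> gauss_curvature b2 z = 0"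
    and N: "negligible {y \<in> V1. gauss_curvature b1 y = 0} \<or> negligible {z \<in> V2. gauss_curvature b2 z = 0}"
    and x0: "x0 \<in> U"
  shows "wedge (P x0) (R x0) = 0"
proof (rule ccontr)
  assume ne: "wedge (P x0) (R x0) \<noteq> 0"
  define N where "N = {x \<in> U. wedge (P x) (R x) \<noteq> 0}"
  have "continuous_on U (\<lambda>x. wedge (P x) (R x))" unfolding wedge_def
    by (intro smooth_onD(3) smooth_on_diff smooth_on_mult m1.smooth_pullback openU)
  from continuous_open_preimage[OF this openU, of "- {0}"] have oN: "open N"
    by (auto simp: N_def vimage_def Int_def)
  have x0N: "x0 \<in> N" and NU: "N \<subseteq> U" using ne x0 by (auto simp: N_def)
  have QS: "wedge (Q x0) (S x0) \<noteq> 0" using wedge_lagrange[OF x0] ne by auto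
  have "gauss_curvature b1 (fst (F x)) = 0 \<and> gauss_curvature b2 (snd (F x)) = 0" if "x \<in> N" for x
  proof -
    have xU: "x \<in> U" using that NU by blast
    have w: "wedge (P x) (R x) = - \<epsilon> * wedge (Q x) (S x)" using wedge_lagrange[OF xU] by simp
    then have q0: "wedge (Q x) (S x) \<noteq> 0" using that by (auto simp: N_def)
    have "(gauss_curvature b2 (snd (F x)) - \<epsilon> * gauss_curvature b1 (fst (F x))) * wedge (Q x) (S x) = 0"
      using ricci_form_zero[OF xU] unfolding w by (simp add: algebra_simps)
    then have "gauss_curvature b2 (snd (F x)) = \<epsilon> * gauss_curvature b1 (fst (F x))" using q0 by simp
    then have "\<epsilon> * gauss_curvature b2 (snd (F x)) = \<epsilon> * \<epsilon> * gauss_curvature b1 (fst (F x))" by simp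
    then have "gauss_curvature b1 (fst (F x)) = \<epsilon> * gauss_curvature b2 (snd (F x))" unfolding eps by simp
    then show ?thesis using K[OF m1.\<phi>V[OF xU] m2.\<phi>V[OF xU]] by blast
  qed
  then have "(\<lambda>x. fst (F x)) ` N \<subseteq> {y \<in> V1. gauss_curvature b1 y = 0}"
    "(\<lambda>x. snd (F x)) ` N \<subseteq> {z \<in> V2. gauss_curvature b2 z = 0}"
    using m1.\<phi>V m2.\<phi>V NU by auto
  then show False
    using N negligible_subset m1.open_image_not_negligible[OF oN NU x0N ne]
      m2.open_image_not_negligible[OF oN NU x0N QS] by blast
qed

lemma local_product:
  assumes K: "\<And>y z. y \<in> V1 \<Longrightarrow> z \<in> V2 \<Longrightarrow> gauss_curvature b1 y = \<epsilon> * gauss_curvature b2 z \<Longrightarrow>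
      gauss_curvature b1 y = 0 \<and> gauss_curvature b2 z = 0"
    and N: "negligible {y \<in> V1. gauss_curvature b1 y = 0} \<or> negligible {z \<in> V2. gauss_curvature b2 z = 0}"
    and x0: "x0 \<in> U"
  obtains U0 a b c d and f g :: "real^2 \<Rightarrow> real" and \<zeta> \<gamma>1 \<gamma>2 \<eta>1 \<eta>2 k1 k2 where
    "open U0" "U0 \<subseteq> U" "x0 \<in> U0" "smooth_on U0 f" "smooth_on U0 g"
    "smooth_on ({a<..<b} \<times> {c<..<d}) \<zeta>"
    "\<And>x. x \<in> U0 \<Longrightarrow> f x \<in> {a<..<b} \<and> g x \<in> {c<..<d} \<and> \<zeta> (f x, g x) = x"
    "\<And>s t. s \<in> {a<..<b} \<Longrightarrow> t \<in> {c<..<d} \<Longrightarrow> \<zeta> (s, t) \<in> U0 \<and> f (\<zeta> (s, t)) = s \<and> g (\<zeta> (s, t)) = t"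
    "\<And>x. x \<in> U0 \<Longrightarrow> F x = (\<gamma>1 (f x), \<gamma>2 (g x))"
    "smooth_on {a<..<b} \<gamma>1" "\<gamma>1 ` {a<..<b} \<subseteq> V1" "\<eta>1 \<in> {-1, 1}"
    "\<And>s. s \<in> {a<..<b} \<Longrightarrow> b1 (\<gamma>1 s) (dd \<gamma>1 s 1) (dd \<gamma>1 s 1) = \<eta>1 \<and>
      cov_along b1 \<gamma>1 (\<lambda>s. dd \<gamma>1 s 1) s 1 = k1 *\<^sub>R para_j (b1 (\<gamma>1 s)) (dd \<gamma>1 s 1)"
    "smooth_on {c<..<d} \<gamma>2" "\<gamma>2 ` {c<..<d} \<subseteq> V2" "\<eta>2 \<in> {-1, 1}"
    "\<And>t. t \<in> {c<..<d} \<Longrightarrow> b2 (\<gamma>2 t) (dd \<gamma>2 t 1) (dd \<gamma>2 t 1) = \<eta>2 \<and>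
      cov_along b2 \<gamma>2 (\<lambda>t. dd \<gamma>2 t 1) t 1 = k2 *\<^sub>R para_j (b2 (\<gamma>2 t)) (dd \<gamma>2 t 1)"
proof -
  have PR: "wedge (P x) (R x) = 0" if "x \<in> U" for x by (rule pullback_omega_zero[OF K N that])
  obtain W a0 b0 c0 d0 f0 g0 \<delta>1 \<delta>2 where
    pc0: "product_chart V1 b1 \<alpha>1 \<beta>1 V2 b2 \<alpha>2 \<beta>2 U F \<epsilon> W {a0<..<b0} f0 \<delta>1 {c0<..<d0} g0 \<delta>2" and xW: "x0 \<in> W"
    by (rule product_chart_exists[OF PR x0])
  show thesis
  proof (rule product_chart.unit_speed_reparametrisation[OF pc0 refl refl xW])
    fix U0 a b c d \<zeta> f g \<gamma>1 \<gamma>2 \<eta>1 \<eta>2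
    assume pc: "product_chart V1 b1 \<alpha>1 \<beta>1 V2 b2 \<alpha>2 \<beta>2 U F \<epsilon> U0 {a<..<b} f \<gamma>1 {c<..<d} g \<gamma>2"
      and x0': "x0 \<in> U0" and \<zeta>: "smooth_on ({a<..<b} \<times> {c<..<d}) \<zeta>"
      "\<And>x. x \<in> U0 \<Longrightarrow> \<zeta> (f x, g x) = x"
      "\<And>s t. s \<in> {a<..<b} \<Longrightarrow> t \<in> {c<..<d} \<Longrightarrow> \<zeta> (s, t) \<in> U0 \<and> f (\<zeta> (s, t)) = s \<and> g (\<zeta> (s, t)) = t"
      and \<eta>: "\<eta>1 \<in> {-1, 1}" "\<eta>2 \<in> {-1, 1}"
      and u1: "\<And>s. s \<in> {a<..<b} \<Longrightarrow> b1 (\<gamma>1 s) (dd \<gamma>1 s 1) (dd \<gamma>1 s 1) = \<eta>1"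
      and u2: "\<And>t. t \<in> {c<..<d} \<Longrightarrow> b2 (\<gamma>2 t) (dd \<gamma>2 t 1) (dd \<gamma>2 t 1) = \<eta>2"
    interpret n: product_chart V1 b1 \<alpha>1 \<beta>1 V2 b2 \<alpha>2 \<beta>2 U F \<epsilon> U0 "{a<..<b}" f \<gamma>1 "{c<..<d}" g \<gamma>2
      by (rule pc)
    note v1 = u1[folded n.c1.vel_def] and v2 = u2[folded n.c2.vel_def]
    obtain k1 where k1: "\<And>s. s \<in> {a<..<b} \<Longrightarrow> n.c1.geod s = k1"
      using n.geod_constant(1)[OF v1 v2] by auto
    obtain k2 where k2: "\<And>s. s \<in> {c<..<d} \<Longrightarrow> n.c2.geod s = k2"
      using n.geod_constant(2)[OF v1 v2] by auto
    have e: "\<eta>1 \<noteq> 0" "\<eta>2 \<noteq> 0" using \<eta> by auto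
    have cv1: "cov_along b1 \<gamma>1 (\<lambda>s. dd \<gamma>1 s 1) s 1 = k1 *\<^sub>R para_j (b1 (\<gamma>1 s)) (dd \<gamma>1 s 1)" if s: "s \<in> {a<..<b}" for s
      using n.c1.curvature_geod[OF v1 e(1) s lor1[OF n.c1.\<gamma>V[OF s]]] k1[OF s] unfolding n.c1.vel_def by simp
    have cv2: "cov_along b2 \<gamma>2 (\<lambda>s. dd \<gamma>2 s 1) s 1 = k2 *\<^sub>R para_j (b2 (\<gamma>2 s)) (dd \<gamma>2 s 1)" if s: "s \<in> {c<..<d}" for s
      using n.c2.curvature_geod[OF v2 e(2) s lor2[OF n.c2.\<gamma>V[OF s]]] k2[OF s] unfolding n.c2.vel_def by simp
    show thesis
    proof (rule that[of U0 f g a b c d \<zeta> \<gamma>1 \<gamma>2 \<eta>1 k1 \<eta>2 k2])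
      show "f x \<in> {a<..<b} \<and> g x \<in> {c<..<d} \<and> \<zeta> (f x, g x) = x" if "x \<in> U0" for x
        using n.c1.f_mem[OF that] n.c2.f_mem[OF that] \<zeta>(2)[OF that] by blast
      show "F x = (\<gamma>1 (f x), \<gamma>2 (g x))" if "x \<in> U0" for x
        using n.c1.factor[OF that] n.c2.factor[OF that] by (simp add: prod_eq_iff)
      show "\<gamma>1 ` {a<..<b} \<subseteq> V1" "\<gamma>2 ` {c<..<d} \<subseteq> V2" using n.c1.\<gamma>V n.c2.\<gamma>V by blast+
      show "b1 (\<gamma>1 s) (dd \<gamma>1 s 1) (dd \<gamma>1 s 1) = \<eta>1 \<and>
          cov_along b1 \<gamma>1 (\<lambda>s. dd \<gamma>1 s 1) s 1 = k1 *\<^sub>R para_j (b1 (\<gamma>1 s)) (dd \<gamma>1 s 1)"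
        if "s \<in> {a<..<b}" for s by (intro conjI u1 cv1 that)
      show "b2 (\<gamma>2 t) (dd \<gamma>2 t 1) (dd \<gamma>2 t 1) = \<eta>2 \<and>
          cov_along b2 \<gamma>2 (\<lambda>t. dd \<gamma>2 t 1) t 1 = k2 *\<^sub>R para_j (b2 (\<gamma>2 t)) (dd \<gamma>2 t 1)"
        if "t \<in> {c<..<d}" for t by (intro conjI u2 cv2 that)
      show "\<zeta> (s, t) \<in> U0 \<and> f (\<zeta> (s, t)) = s \<and> g (\<zeta> (s, t)) = t"
        if "s \<in> {a<..<b}" "t \<in> {c<..<d}" for s t by (rule \<zeta>(3)[OF that])
      show "open U0" "U0 \<subseteq> U" "x0 \<in> U0" by (rule n.c1.openU0 n.c1.U0U x0')+
      show "smooth_on U0 f" "smooth_on U0 g" by (rule n.c1.smoothf n.c2.smoothf)+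
      show "smooth_on ({a<..<b} \<times> {c<..<d}) \<zeta>" by (rule \<zeta>(1))
      show "smooth_on {a<..<b} \<gamma>1" "smooth_on {c<..<d} \<gamma>2" by (rule n.c1.smooth\<gamma> n.c2.smooth\<gamma>)+
      show "\<eta>1 \<in> {-1, 1}" "\<eta>2 \<in> {-1, 1}" by (rule \<eta>)+
    qed
  qed
qed

end


subsection \<open>From charts to the surface\<close>

lemma chart_inverse:
  assumes "is_chart c"
  shows "p \<in> fst c \<Longrightarrow> inv_into (fst c) (snd c) (snd c p) = p"
    "x \<in> snd c ` fst c \<Longrightarrow> inv_into (fst c) (snd c) x \<in> fst c"
    "x \<in> snd c ` fst c \<Longrightarrow> snd c (inv_into (fst c) (snd c) x) = x"
    "continuous_on (fst c) (snd c)" "continuous_on (snd c ` fst c) (inv_into (fst c) (snd c))"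
    "open (fst c)" "open (snd c ` fst c)"
  using assms unfolding is_chart_def homeomorphism_def by auto

lemma chart_open_image:
  assumes c: "is_chart c" and O: "open W" "W \<subseteq> fst c"
  shows "open (snd c ` W)"
proof -
  have "snd c ` W = snd c ` fst c \<inter> inv_into (fst c) (snd c) -` W"
    using O(2) chart_inverse(1)[OF c] by (auto simp: image_iff)
  then show ?thesis
    using continuous_open_preimage[OF chart_inverse(5)[OF c] chart_inverse(7)[OF c] O(1)] by simp
qed

lemma cov_along_cong:
  assumes "open S" "x \<in> S" "\<And>y. y \<in> S \<Longrightarrow> X y = Y y"
  shows "cov_along b F X x u = cov_along b F Y x u"
  unfolding cov_along_def using dd_cong_open[OF assms] assms(3)[OF assms(2)] by simp

text \<open>The definitions quantify over all charts of the atlas, whereas the data live in the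
  single chart c. Transition maps are orientation-preserving isometries, so velocity,
  \<open>cov_along\<close> and j transform alike and the same k works in every chart. The parameter
  is already arclength, hence the identity as reparametrisation.\<close>

lemma curve_from_chart:
  fixes A :: "'a::{t2_space,second_countable_topology} chart set" and \<gamma> :: "real \<Rightarrow> real^2"
  assumes A: "lorentzian_surface A g" and c: "c \<in> A"
    and I: "I = {a<..<b}" "a < b" and \<gamma>: "smooth_on I \<gamma>" "\<gamma> ` I \<subseteq> snd c ` fst c" and \<eta>: "\<eta> \<in> {-1, 1}"
    and unit: "\<And>s. s \<in> I \<Longrightarrow> g c (\<gamma> s) (dd \<gamma> s 1) (dd \<gamma> s 1) = \<eta>"
    and curv: "\<And>s. s \<in> I \<Longrightarrow> cov_along (g c) \<gamma> (\<lambda>s. dd \<gamma> s 1) s 1 = k *\<^sub>R para_j (g c (\<gamma> s)) (dd \<gamma> s 1)"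
  defines "\<Gamma> \<equiv> inv_into (fst c) (snd c) \<circ> \<gamma>"
  shows "regular_nonnull_curve A g \<Gamma> I" "constant_curvature A g \<Gamma> I"
proof -
  have ch: "is_chart d" if "d \<in> A" for d
    using A that by (simp add: lorentzian_surface_def oriented_surface_def smooth_surface_def)
  note cc = chart_inverse[OF ch[OF c]]
  have oI: "open I" by (simp add: I)
  have \<Gamma>c: "\<Gamma> s \<in> fst c" "snd c (\<Gamma> s) = \<gamma> s" if "s \<in> I" for s
    using that \<gamma>(2) cc(2,3) by (auto simp: \<Gamma>_def)
  have cont: "continuous_on I \<Gamma>"
    unfolding \<Gamma>_def using \<gamma>(2) continuous_on_subset[OF cc(5)]
    by (intro continuous_on_compose smooth_onD(3)[OF \<gamma>(1)]) blast
  have eq: "snd d \<circ> \<Gamma> = (\<lambda>s. transition c d (\<gamma> s))" for d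
    by (simp add: \<Gamma>_def transition_def fun_eq_iff)
  have loc: "isometry (snd c ` (fst c \<inter> fst d)) (snd d ` fst d) (g c) (g d) (transition c d)" if d: "d \<in> A" for d
  proof (rule isometry.intro)
    show "open (snd c ` (fst c \<inter> fst d))"
      by (rule chart_open_image[OF ch[OF c]]) (auto intro!: chart_inverse(6) ch c d)
    show "transition c d ` snd c ` (fst c \<inter> fst d) \<subseteq> snd d ` fst d"
      using cc(1) by (auto simp: transition_def)
    show "smooth_on (snd c ` (fst c \<inter> fst d)) (\<lambda>y. g c y u v)" for u v
      by (rule smooth_on_subset[of "snd c ` fst c"]) (use A c in \<open>auto simp: lorentzian_surface_def\<close>)
    show "open (snd d ` fst d)" by (rule chart_inverse(7)[OF ch[OF d]])
    show "lorentzian_form (g c y)" if "y \<in> snd c ` (fst c \<inter> fst d)" for y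
      using A c that by (auto simp: lorentzian_surface_def)
    show "lorentzian_form (g d y)" if "y \<in> snd d ` fst d" for y
      using A d that by (auto simp: lorentzian_surface_def)
    show "smooth_on (snd d ` fst d) (\<lambda>y. g d y u v)" for u v
      using A d by (simp add: lorentzian_surface_def)
    show "smooth_on (snd c ` (fst c \<inter> fst d)) (transition c d)"
      using A c d by (simp add: lorentzian_surface_def oriented_surface_def smooth_surface_def)
    show "g c y u v = g d (transition c d y) (dd (transition c d) y u) (dd (transition c d) y v)"
      if "y \<in> snd c ` (fst c \<inter> fst d)" for y u v
      using A c d that unfolding lorentzian_surface_def by blast
  qed
  define I' where "I' d = {s \<in> I. \<Gamma> s \<in> fst d}" for d :: "'a chart"
  have oI': "open (I' d)" if d: "d \<in> A" for d
    using continuous_open_preimage[OF cont oI chart_inverse(6)[OF ch[OF d]]]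
    by (simp add: I'_def vimage_def Int_def)
  have mem: "\<gamma> s \<in> snd c ` (fst c \<inter> fst d)" if "s \<in> I' d" for s d
  proof -
    have "\<Gamma> s \<in> fst c \<inter> fst d" using \<Gamma>c(1) that by (simp add: I'_def)
    then have "snd c (\<Gamma> s) \<in> snd c ` (fst c \<inter> fst d)" by (rule imageI)
    then show ?thesis using \<Gamma>c(2) that by (simp add: I'_def)
  qed
  have \<gamma>I': "smooth_on (I' d) \<gamma>" for d by (rule smooth_on_subset[OF \<gamma>(1)]) (simp add: I'_def)
  have smooth: "smooth_curve A \<Gamma> I"
    unfolding smooth_curve_def
  proof (intro conjI ballI cont)
    show "\<Gamma> ` I \<subseteq> carrier_of A" using \<Gamma>c(1) c by (auto simp: carrier_of_def)
    fix d assume d: "d \<in> A"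
    interpret isometry "snd c ` (fst c \<inter> fst d)" "snd d ` fst d" "g c" "g d" "transition c d" by (rule loc[OF d])
    have "smooth_on (I' d) (\<lambda>s. transition c d (\<gamma> s))"
      by (rule smooth_on_compose[OF oI'[OF d] W(1) _ sm\<tau> \<gamma>I']) (use mem in blast)
    then show "smooth_on {s \<in> I. \<Gamma> s \<in> fst d} (snd d \<circ> \<Gamma>)" unfolding eq I'_def .
  qed
  have vel: "velocity d \<Gamma> s = dd (transition c d) (\<gamma> s) (dd \<gamma> s 1)" if d: "d \<in> A" and s: "s \<in> I' d" for d s
  proof -
    interpret isometry "snd c ` (fst c \<inter> fst d)" "snd d ` fst d" "g c" "g d" "transition c d" by (rule loc[OF d])
    have D: "((\<lambda>s. transition c d (\<gamma> s)) has_derivative (\<lambda>u. dd (transition c d) (\<gamma> s) (dd \<gamma> s u))) (at s)"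
      by (rule has_derivative_compose[OF smooth_on_has_derivative[OF \<gamma>I' s] smooth_on_has_derivative[OF sm\<tau> mem[OF s]]])
    have "dd (transition c d) (\<gamma> s) (dd \<gamma> s u) = u *\<^sub>R dd (transition c d) (\<gamma> s) (dd \<gamma> s 1)" for u
      using linear_scale[OF dd_linear[OF smooth_onD(1)[OF \<gamma>I' s]], of u 1]
        linear_scale[OF dd_linear[OF smooth_onD(1)[OF sm\<tau> mem[OF s]]]] by simp
    then have "((\<lambda>s. transition c d (\<gamma> s)) has_vector_derivative dd (transition c d) (\<gamma> s) (dd \<gamma> s 1)) (at s)"
      unfolding has_vector_derivative_def by (intro has_derivative_eq_rhs[OF D] ext)
    then show ?thesis unfolding velocity_def eq by (rule vector_derivative_at)
  qed
  have unit': "g d (snd d (\<Gamma> s)) (velocity d \<Gamma> s) (velocity d \<Gamma> s) = \<eta>" if d: "d \<in> A" and s: "s \<in> I' d" for d s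
  proof -
    interpret isometry "snd c ` (fst c \<inter> fst d)" "snd d ` fst d" "g c" "g d" "transition c d" by (rule loc[OF d])
    have "snd d (\<Gamma> s) = transition c d (\<gamma> s)" using fun_cong[OF eq[of d], of s] by simp
    then show ?thesis using iso[OF mem[OF s], of "dd \<gamma> s 1" "dd \<gamma> s 1"] unit[of s] s by (simp add: vel[OF d s] I'_def)
  qed
  show "regular_nonnull_curve A g \<Gamma> I"
    unfolding regular_nonnull_curve_def
  proof (intro conjI ballI impI smooth)
    fix d s assume d: "d \<in> A" and "s \<in> I" "\<Gamma> s \<in> fst d"
    then have s: "s \<in> I' d" by (simp add: I'_def)
    show nz: "g d (snd d (\<Gamma> s)) (velocity d \<Gamma> s) (velocity d \<Gamma> s) \<noteq> 0"
      using unit'[OF d s] \<eta> by auto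
    have "lorentzian_form (g d (snd d (\<Gamma> s)))"
      using A d \<open>\<Gamma> s \<in> fst d\<close> by (auto simp: lorentzian_surface_def)
    then show "velocity d \<Gamma> s \<noteq> 0"
      using nz bilinear_lzero unfolding lorentzian_form_def by metis
  qed
  have "has_curvature A g \<Gamma> I (\<lambda>_. k)"
    unfolding has_curvature_def
  proof (intro conjI ballI impI)
    show "arclength_curve A g \<Gamma> I"
      unfolding arclength_curve_def using smooth \<eta> unit' by (auto simp: I'_def)
    fix d s assume d: "d \<in> A" and "s \<in> I" "\<Gamma> s \<in> fst d"
    then have s: "s \<in> I' d" and sI: "s \<in> I" by (simp_all add: I'_def)
    interpret isometry "snd c ` (fst c \<inter> fst d)" "snd d ` fst d" "g c" "g d" "transition c d" by (rule loc[OF d])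
    have "\<gamma> s \<in> snd c ` (fst c \<inter> fst d)" by (rule mem[OF s])
    then have det: "0 < det (matrix (dd (transition c d) (\<gamma> s)))"
      using A c d by (auto simp: lorentzian_surface_def oriented_surface_def)
    have "cov_along (g d) (snd d \<circ> \<Gamma>) (velocity d \<Gamma>) s 1
        = cov_along (g d) (\<lambda>s. transition c d (\<gamma> s)) (\<lambda>s. dd (transition c d) (\<gamma> s) (dd \<gamma> s 1)) s 1"
      unfolding eq by (rule cov_along_cong[OF oI'[OF d] s]) (rule vel[OF d])
    also have "\<dots> = dd (transition c d) (\<gamma> s) (cov_along (g c) \<gamma> (\<lambda>s. dd \<gamma> s 1) s 1)"
      by (rule cov_along_transform[OF mem[OF s] smooth_onD(1)[OF \<gamma>(1) sI] smooth_onD(1)[OF smooth_onD(2)[OF \<gamma>(1)] sI]])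
    also have "\<dots> = k *\<^sub>R para_j (g d (transition c d (\<gamma> s))) (dd (transition c d) (\<gamma> s) (dd \<gamma> s 1))"
      unfolding curv[OF sI] para_j_transform[OF mem[OF s] det]
      using linear_scale[OF dd_linear[OF smooth_onD(1)[OF sm\<tau> mem[OF s]]]] by simp
    finally show "cov_along (g d) (snd d \<circ> \<Gamma>) (velocity d \<Gamma>) s 1 = k *\<^sub>R para_j (g d (snd d (\<Gamma> s))) (velocity d \<Gamma> s)"
      unfolding vel[OF d s] using fun_cong[OF eq[of d], of s] by simp
  qed
  moreover have "open_interval I" using I by (auto simp: open_interval_def is_interval_oo)
  moreover have "smooth_on I id" unfolding id_def by (rule smooth_on_id[OF oI])
  moreover have "vector_derivative id (at r) \<noteq> 0" for r :: real
    using vector_derivative_at[OF has_vector_derivative_id, of r] by (simp add: id_def)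
  ultimately show "constant_curvature A g \<Gamma> I"
    unfolding constant_curvature_def by (intro exI[of _ I] exI[of _ id] exI[of _ k]) auto
qed

text \<open>The inverse of the parametrisation is (f, g) composed with the chart c, so smoothness in
  both directions, seen in any other chart d, follows from the transition maps.\<close>

lemma parametrisation_from_chart:
  fixes B :: "'c::{t2_space,second_countable_topology} chart set" and \<zeta> :: "real \<times> real \<Rightarrow> real^2"
  assumes B: "smooth_surface B" and c: "c \<in> B" and U0: "open U0" "U0 \<subseteq> snd c ` fst c"
    and f: "smooth_on U0 f" and g: "smooth_on U0 g" and oQ: "open Q" and \<zeta>: "smooth_on Q \<zeta>"
    and fg: "\<And>x. x \<in> U0 \<Longrightarrow> (f x, g x) \<in> Q \<and> \<zeta> (f x, g x) = x"
    and z: "\<And>q. q \<in> Q \<Longrightarrow> \<zeta> q \<in> U0 \<and> (f (\<zeta> q), g (\<zeta> q)) = q"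
  shows "local_parametrisation B Q (inv_into (fst c) (snd c) \<circ> \<zeta>)"
proof -
  define \<psi> where "\<psi> = inv_into (fst c) (snd c) \<circ> \<zeta>"
  have ch: "is_chart d" if "d \<in> B" for d using B that by (simp add: smooth_surface_def)
  note cc = chart_inverse[OF ch[OF c]]
  have \<psi>c: "\<psi> q \<in> fst c" "snd c (\<psi> q) = \<zeta> q" if "q \<in> Q" for q
    using z[OF that] U0(2) cc(2,3) by (auto simp: \<psi>_def)
  define \<mu> where "\<mu> y = (f (snd c y), g (snd c y))" for y
  have \<mu>\<psi>: "\<mu> (\<psi> q) = q" if "q \<in> Q" for q using \<psi>c(2)[OF that] z[OF that] by (simp add: \<mu>_def)
  then have inj: "inj_on \<psi> Q" by (rule inj_on_inverseI)
  have inv: "inv_into Q \<psi> y = \<mu> y" if "y \<in> \<psi> ` Q" for y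
    using that \<mu>\<psi> inv_into_f_f[OF inj] by auto
  have im: "\<psi> ` Q = {y \<in> fst c. snd c y \<in> U0}"
  proof
    show "\<psi> ` Q \<subseteq> {y \<in> fst c. snd c y \<in> U0}" using \<psi>c z by auto
    show "{y \<in> fst c. snd c y \<in> U0} \<subseteq> \<psi> ` Q"
    proof clarify
      fix y assume y: "y \<in> fst c" "snd c y \<in> U0"
      have "\<psi> (f (snd c y), g (snd c y)) = y" using fg[OF y(2)] cc(1)[OF y(1)] by (simp add: \<psi>_def)
      then show "y \<in> \<psi> ` Q" using fg[OF y(2)] by (metis imageI)
    qed
  qed
  have oim: "open (\<psi> ` Q)"
    using continuous_open_preimage[OF cc(4,6) U0(1)] unfolding im by (simp add: vimage_def Int_def)
  have cont: "continuous_on Q \<psi>"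
  proof -
    have "\<zeta> ` Q \<subseteq> snd c ` fst c" using z U0(2) by blast
    then show ?thesis
      unfolding \<psi>_def by (rule continuous_on_compose[OF smooth_onD(3)[OF \<zeta>] continuous_on_subset[OF cc(5)]])
  qed
  have cont\<mu>: "continuous_on (\<psi> ` Q) \<mu>"
  proof -
    have "continuous_on (\<psi> ` Q) (snd c)" by (rule continuous_on_subset[OF cc(4)]) (auto simp: im)
    moreover have "snd c ` (\<psi> ` Q) \<subseteq> U0" by (auto simp: im)
    ultimately show ?thesis
      unfolding \<mu>_def
      by (intro continuous_on_Pair continuous_on_compose2[OF smooth_onD(3)[OF f]]
        continuous_on_compose2[OF smooth_onD(3)[OF g]])
  qed
  have hom: "homeomorphism Q (\<psi> ` Q) \<psi> (inv_into Q \<psi>)"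
    unfolding homeomorphism_def
  proof (intro conjI ballI)
    show "continuous_on (\<psi> ` Q) (inv_into Q \<psi>)" by (rule continuous_on_eq[OF cont\<mu>]) (simp add: inv)
  qed (use cont inj in \<open>auto simp: f_inv_into_f image_iff intro: bexI\<close>)
  have tr: "smooth_on (snd d ` (fst d \<inter> fst e)) (transition d e)" "open (snd d ` (fst d \<inter> fst e))"
    if "d \<in> B" "e \<in> B" for d e
    using B that chart_open_image[OF ch[OF that(1)], of "fst d \<inter> fst e"]
      open_Int[OF chart_inverse(6)[OF ch[OF that(1)]] chart_inverse(6)[OF ch[OF that(2)]]]
    by (simp_all add: smooth_surface_def)
  have s1: "smooth_on {q \<in> Q. \<psi> q \<in> fst d} (snd d \<circ> \<psi>)" if d: "d \<in> B" for d
  proof -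
    have o: "open {q \<in> Q. \<psi> q \<in> fst d}"
      using continuous_open_preimage[OF cont oQ chart_inverse(6)[OF ch[OF d]]] by (simp add: vimage_def Int_def)
    have sub: "\<zeta> ` {q \<in> Q. \<psi> q \<in> fst d} \<subseteq> snd c ` (fst c \<inter> fst d)"
    proof clarify
      fix q assume q: "q \<in> Q" "\<psi> q \<in> fst d"
      then show "\<zeta> q \<in> snd c ` (fst c \<inter> fst d)" using \<psi>c[OF q(1)] by (metis IntI imageI)
    qed
    have "smooth_on {q \<in> Q. \<psi> q \<in> fst d} (\<lambda>q. transition c d (\<zeta> q))"
      by (rule smooth_on_compose[OF o tr(2)[OF c d] sub tr(1)[OF c d] smooth_on_subset[OF \<zeta>]]) auto
    moreover have "snd d \<circ> \<psi> = (\<lambda>q. transition c d (\<zeta> q))" by (simp add: fun_eq_iff transition_def \<psi>_def)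
    ultimately show ?thesis by simp
  qed
  have s2: "smooth_on (snd d ` (fst d \<inter> \<psi> ` Q)) (inv_into Q \<psi> \<circ> inv_into (fst d) (snd d))" if d: "d \<in> B" for d
  proof -
    note dc = chart_inverse[OF ch[OF d]]
    have o: "open (snd d ` (fst d \<inter> \<psi> ` Q))"
      by (rule chart_open_image[OF ch[OF d]]) (use dc(6) oim in auto)
    have sub: "snd d ` (fst d \<inter> \<psi> ` Q) \<subseteq> snd d ` (fst d \<inter> fst c)" unfolding im by auto
    have tU: "transition d c ` snd d ` (fst d \<inter> \<psi> ` Q) \<subseteq> U0"
      unfolding im using dc(1) by (auto simp: transition_def)
    note t = smooth_on_subset[OF tr(1)[OF d c] sub]
    have "smooth_on (snd d ` (fst d \<inter> \<psi> ` Q)) (\<lambda>y. (f (transition d c y), g (transition d c y)))"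
      by (intro smooth_on_Pair o smooth_on_compose[OF o U0(1) tU f t] smooth_on_compose[OF o U0(1) tU g t])
    then show ?thesis
    proof (rule smooth_on_cong[OF o])
      fix y assume "y \<in> snd d ` (fst d \<inter> \<psi> ` Q)"
      then obtain w where w: "w \<in> fst d" "w \<in> \<psi> ` Q" "y = snd d w" by blast
      then show "(f (transition d c y), g (transition d c y)) = (inv_into Q \<psi> \<circ> inv_into (fst d) (snd d)) y"
        using inv[OF w(2)] dc(1)[OF w(1)] by (simp add: transition_def \<mu>_def)
    qed
  qed
  have "local_parametrisation B Q \<psi>"
    unfolding local_parametrisation_def
    using oQ oim hom s1 s2 \<psi>c(1) c by (auto simp: carrier_of_def)
  then show ?thesis unfolding \<psi>_def .
qed

theorem theorem2:
  fixes A1 :: "'a::{t2_space,second_countable_topology} chart set"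
    and A2 :: "'b::{t2_space,second_countable_topology} chart set"
    and B :: "'c::{t2_space,second_countable_topology} chart set"
    and g1 :: "'a chart \<Rightarrow> (real^2) tensor2"
    and g2 :: "'b chart \<Rightarrow> (real^2) tensor2"
    and \<epsilon> :: real
    and \<Phi> :: "'c \<Rightarrow> 'a \<times> 'b"
  assumes "lorentzian_surface A1 g1" and "lorentzian_surface A2 g2"
    and "\<epsilon> \<in> {-1, 1}"
    and "(nonflat_ae A1 g1 \<and> nonflat_ae A2 g2 \<and>
          (\<forall>c1\<in>A1. \<forall>c2\<in>A2. \<forall>x \<in> snd c1 ` fst c1. \<forall>y \<in> snd c2 ` fst c2.
             gauss_curvature (g1 c1) x \<noteq> 0 \<longrightarrow> gauss_curvature (g2 c2) y \<noteq> 0 \<longrightarrow>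
             \<epsilon> * gauss_curvature (g1 c1) x * gauss_curvature (g2 c2) y < 0)) \<or>
         (flat_metric A1 g1 \<and> \<not> flat_metric A2 g2 \<and> nonflat_ae A2 g2) \<or>
         (flat_metric A2 g2 \<and> \<not> flat_metric A1 g1 \<and> nonflat_ae A1 g1)"
    and "smooth_surface B" and "immersion B A1 A2 \<Phi>"
    and "nondegenerate_surface \<epsilon> B A1 g1 A2 g2 \<Phi>"
    and "lagrangian \<epsilon> B A1 g1 A2 g2 \<Phi>"
    and "parallel_mean_curvature \<epsilon> B A1 g1 A2 g2 \<Phi>"
  shows "locally_product_of_constant_curvature_curves B A1 g1 A2 g2 \<Phi>"
  unfolding locally_product_of_constant_curvature_curves_def
proof
  note A1 = assms(1) and A2 = assms(2) and hyp = assms(4) and B = assms(5) and imm = assms(6)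
  have eps: "\<epsilon> * \<epsilon> = 1" and eps0: "\<epsilon> \<noteq> 0" using assms(3) by auto
  fix p assume "p \<in> carrier_of B"
  then obtain c where c: "c \<in> B" "p \<in> fst c" by (auto simp: carrier_of_def)
  have "\<Phi> p \<in> carrier_of A1 \<times> carrier_of A2" using imm \<open>p \<in> carrier_of B\<close> by (auto simp: immersion_def)
  then obtain c1 c2 where c1: "c1 \<in> A1" "fst (\<Phi> p) \<in> fst c1" and c2: "c2 \<in> A2" "snd (\<Phi> p) \<in> fst c2"
    by (auto simp: carrier_of_def mem_Times_iff)
  have chc: "is_chart c" using B c by (simp add: smooth_surface_def)
  have ch1: "is_chart c1" using A1 c1 by (simp add: lorentzian_surface_def oriented_surface_def smooth_surface_def)
  have ch2: "is_chart c2" using A2 c2 by (simp add: lorentzian_surface_def oriented_surface_def smooth_surface_def)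
  define U where "U = local_dom \<Phi> c c1 c2"
  define F where "F = local_rep \<Phi> c c1 c2"
  define x0 where "x0 = snd c p"
  have x0: "x0 \<in> U" using c c1 c2 by (auto simp: U_def x0_def local_dom_def mem_Times_iff)
  have Uc: "U \<subseteq> snd c ` fst c" by (auto simp: U_def local_dom_def)
  have oU: "open U"
  proof -
    have "continuous_on (fst c) \<Phi>"
      using imm c(1) by (auto simp: immersion_def carrier_of_def elim!: continuous_on_subset)
    from continuous_open_preimage[OF this chart_inverse(6)[OF chc] open_Times[OF chart_inverse(6)[OF ch1] chart_inverse(6)[OF ch2]]]
    have "open {p \<in> fst c. \<Phi> p \<in> fst c1 \<times> fst c2}" by (simp add: vimage_def Int_def)
    then show ?thesis unfolding U_def local_dom_def by (rule chart_open_image[OF chc]) auto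
  qed
  have smF: "smooth_on U F" using imm c(1) c1(1) c2(1) by (simp add: immersion_def U_def F_def)
  have Fx: "\<exists>y. y \<in> fst c \<and> x = snd c y \<and> fst (\<Phi> y) \<in> fst c1 \<and> snd (\<Phi> y) \<in> fst c2 \<and>
      F x = (snd c1 (fst (\<Phi> y)), snd c2 (snd (\<Phi> y)))" if "x \<in> U" for x
    using that chart_inverse(1)[OF chc]
    by (auto simp: U_def F_def local_dom_def local_rep_def Let_def mem_Times_iff)
  have FW: "fst (F x) \<in> snd c1 ` fst c1" "snd (F x) \<in> snd c2 ` fst c2" if "x \<in> U" for x
    using Fx[OF that] by auto
  have lor1: "lorentzian_form (g1 c1 y)" if "y \<in> snd c1 ` fst c1" for y using A1 c1(1) that by (auto simp: lorentzian_surface_def)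
  have lor2: "lorentzian_form (g2 c2 y)" if "y \<in> snd c2 ` fst c2" for y using A2 c2(1) that by (auto simp: lorentzian_surface_def)
  have sm1: "smooth_on (snd c1 ` fst c1) (\<lambda>y. g1 c1 y u v)" for u v using A1 c1(1) by (simp add: lorentzian_surface_def)
  have sm2: "smooth_on (snd c2 ` fst c2) (\<lambda>y. g2 c2 y u v)" for u v using A2 c2(1) by (simp add: lorentzian_surface_def)
  obtain V1 \<alpha>1 \<beta>1 where n1: "null_coframe V1 (g1 c1) \<alpha>1 \<beta>1" "fst (F x0) \<in> V1" "V1 \<subseteq> snd c1 ` fst c1"
    by (rule null_coframe_exists[OF chart_inverse(7)[OF ch1] FW(1)[OF x0] lor1 sm1]) (assumption, rule that, assumption+)
  obtain V2 \<alpha>2 \<beta>2 where n2: "null_coframe V2 (g2 c2) \<alpha>2 \<beta>2" "snd (F x0) \<in> V2" "V2 \<subseteq> snd c2 ` fst c2"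
    by (rule null_coframe_exists[OF chart_inverse(7)[OF ch2] FW(2)[OF x0] lor2 sm2]) (assumption, rule that, assumption+)
  \<comment> \<open>The null coframes were constructed only near the image of x0, so the domain is
    shrunk to the points that F sends into both of their domains.\<close>
  define U' where "U' = {x \<in> U. F x \<in> V1 \<times> V2}"
  have oU': "open U'"
    using continuous_open_preimage[OF smooth_onD(3)[OF smF] oU open_Times[OF null_coframe.openV[OF n1(1)] null_coframe.openV[OF n2(1)]]]
    by (simp add: U'_def vimage_def Int_def)
  have U'U: "U' \<subseteq> U" and x0': "x0 \<in> U'" using x0 n1(2) n2(2) by (auto simp: U'_def mem_Times_iff)
  note smF' = smooth_on_subset[OF smF U'U]
  have "lagrangian_chart V1 (g1 c1) \<alpha>1 \<beta>1 V2 (g2 c2) \<alpha>2 \<beta>2 U' F \<epsilon>"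
  proof (intro lagrangian_chart.intro coframe_map.intro coframe_map_axioms.intro lagrangian_chart_axioms.intro n1(1) n2(1) oU' eps smF')
    show "smooth_on U' (\<lambda>x. fst (F x))" "smooth_on U' (\<lambda>x. snd (F x))"
      by (rule smooth_on_fst[OF oU' smF'] smooth_on_snd[OF oU' smF'])+
    show "fst (F x) \<in> V1" "snd (F x) \<in> V2" if "x \<in> U'" for x using that by (auto simp: U'_def mem_Times_iff)
    show "lorentzian_form (g1 c1 y)" if "y \<in> V1" for y using that n1(3) lor1 by blast
    show "lorentzian_form (g2 c2 y)" if "y \<in> V2" for y using that n2(3) lor2 by blast
    show "nondegenerate (pullback F (prod_metric \<epsilon> (g1 c1) (g2 c2)) x)" if "x \<in> U'" for x
      using assms(7) c(1) c1(1) c2(1) that U'U by (auto simp: nondegenerate_surface_def U_def F_def)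
    show "pullback F (prod_omega \<epsilon> (g1 c1) (g2 c2)) x u v = 0" if "x \<in> U'" for x u v
      using assms(8) c(1) c1(1) c2(1) that U'U by (auto simp: lagrangian_def U_def F_def)
    show "normal_derivative (prod_metric \<epsilon> (g1 c1) (g2 c2)) F (mean_curvature (prod_metric \<epsilon> (g1 c1) (g2 c2)) F) x u = 0"
      if "x \<in> U'" for x u
      using assms(9) c(1) c1(1) c2(1) that U'U by (auto simp: parallel_mean_curvature_def Let_def U_def F_def)
  qed
  then interpret L: lagrangian_chart V1 "g1 c1" \<alpha>1 \<beta>1 V2 "g2 c2" \<alpha>2 \<beta>2 U' F \<epsilon> .
  \<comment> \<open>In case (ii) just one factor is non-flat almost everywhere; hence a
    disjunction.\<close>
  have N: "negligible {y \<in> V1. gauss_curvature (g1 c1) y = 0} \<or> negligible {z \<in> V2. gauss_curvature (g2 c2) z = 0}"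
  proof -
    have "negligible {y \<in> V1. gauss_curvature (g1 c1) y = 0}" if "nonflat_ae A1 g1"
      by (rule negligible_subset[of "{x \<in> snd c1 ` fst c1. gauss_curvature (g1 c1) x = 0}"])
        (use that c1(1) n1(3) in \<open>auto simp: nonflat_ae_def\<close>)
    moreover have "negligible {z \<in> V2. gauss_curvature (g2 c2) z = 0}" if "nonflat_ae A2 g2"
      by (rule negligible_subset[of "{x \<in> snd c2 ` fst c2. gauss_curvature (g2 c2) x = 0}"])
        (use that c2(1) n2(3) in \<open>auto simp: nonflat_ae_def\<close>)
    ultimately show ?thesis using hyp by blast
  qed
  \<comment> \<open>If neither curvature vanished, neither metric would be flat and case (i) would
    apply; but there \<epsilon> \<kappa>1 \<kappa>2 = \<epsilon>^2 \<kappa>2^2 is a square. So one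
    curvature vanishes, and the assumed relation carries this to the other.\<close>
  have K: "gauss_curvature (g1 c1) y = 0 \<and> gauss_curvature (g2 c2) z = 0"
    if y: "y \<in> V1" and z: "z \<in> V2" and e: "gauss_curvature (g1 c1) y = \<epsilon> * gauss_curvature (g2 c2) z" for y z
  proof -
    have yz: "y \<in> snd c1 ` fst c1" "z \<in> snd c2 ` fst c2" using y z n1(3) n2(3) by auto
    have "gauss_curvature (g1 c1) y = 0 \<or> gauss_curvature (g2 c2) z = 0"
    proof (rule ccontr)
      assume ne: "\<not> (gauss_curvature (g1 c1) y = 0 \<or> gauss_curvature (g2 c2) z = 0)"
      then have "\<not> flat_metric A1 g1" "\<not> flat_metric A2 g2"
        using yz c1(1) c2(1) by (auto simp: flat_metric_def)
      then have "\<epsilon> * gauss_curvature (g1 c1) y * gauss_curvature (g2 c2) z < 0"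
        using hyp ne yz c1(1) c2(1) by blast
      moreover have "\<epsilon> * gauss_curvature (g1 c1) y * gauss_curvature (g2 c2) z
          = (\<epsilon> * \<epsilon>) * (gauss_curvature (g2 c2) z * gauss_curvature (g2 c2) z)"
        unfolding e by (simp add: algebra_simps)
      ultimately show False unfolding eps by (simp add: not_less[symmetric])
    qed
    then show ?thesis using e eps0 by auto
  qed
  show "\<exists>I1 I2 \<psi> \<gamma>1 \<gamma>2. open_interval I1 \<and> open_interval I2 \<and>
        local_parametrisation B (I1 \<times> I2) \<psi> \<and> p \<in> \<psi> ` (I1 \<times> I2) \<and>
        (\<forall>s\<in>I1. \<forall>t\<in>I2. \<Phi> (\<psi> (s, t)) = (\<gamma>1 s, \<gamma>2 t)) \<and>
        regular_nonnull_curve A1 g1 \<gamma>1 I1 \<and> regular_nonnull_curve A2 g2 \<gamma>2 I2 \<and>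
        constant_curvature A1 g1 \<gamma>1 I1 \<and> constant_curvature A2 g2 \<gamma>2 I2"
  proof (rule L.local_product[OF K N x0'])
    fix U0 :: "(real^2) set" and a b c' d :: real and f g :: "real^2 \<Rightarrow> real" and \<zeta> :: "real \<times> real \<Rightarrow> real^2"
      and \<gamma>1 \<gamma>2 :: "real \<Rightarrow> real^2" and \<eta>1 \<eta>2 k1 k2 :: real
    assume U0: "open U0" "U0 \<subseteq> U'" "x0 \<in> U0" and sfg: "smooth_on U0 f" "smooth_on U0 g"
      and s\<zeta>: "smooth_on ({a<..<b} \<times> {c'<..<d}) \<zeta>"
      and fg: "\<And>x. x \<in> U0 \<Longrightarrow> f x \<in> {a<..<b} \<and> g x \<in> {c'<..<d} \<and> \<zeta> (f x, g x) = x"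
      and z: "\<And>s t. s \<in> {a<..<b} \<Longrightarrow> t \<in> {c'<..<d} \<Longrightarrow> \<zeta> (s, t) \<in> U0 \<and> f (\<zeta> (s, t)) = s \<and> g (\<zeta> (s, t)) = t"
      and F: "\<And>x. x \<in> U0 \<Longrightarrow> F x = (\<gamma>1 (f x), \<gamma>2 (g x))"
      and \<gamma>1: "smooth_on {a<..<b} \<gamma>1" "\<gamma>1 ` {a<..<b} \<subseteq> V1" and \<eta>1: "\<eta>1 \<in> {-1, 1}"
      and k1: "\<And>s. s \<in> {a<..<b} \<Longrightarrow> g1 c1 (\<gamma>1 s) (dd \<gamma>1 s 1) (dd \<gamma>1 s 1) = \<eta>1 \<and>
        cov_along (g1 c1) \<gamma>1 (\<lambda>s. dd \<gamma>1 s 1) s 1 = k1 *\<^sub>R para_j (g1 c1 (\<gamma>1 s)) (dd \<gamma>1 s 1)"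
      and \<gamma>2: "smooth_on {c'<..<d} \<gamma>2" "\<gamma>2 ` {c'<..<d} \<subseteq> V2" and \<eta>2: "\<eta>2 \<in> {-1, 1}"
      and k2: "\<And>t. t \<in> {c'<..<d} \<Longrightarrow> g2 c2 (\<gamma>2 t) (dd \<gamma>2 t 1) (dd \<gamma>2 t 1) = \<eta>2 \<and>
        cov_along (g2 c2) \<gamma>2 (\<lambda>t. dd \<gamma>2 t 1) t 1 = k2 *\<^sub>R para_j (g2 c2 (\<gamma>2 t)) (dd \<gamma>2 t 1)"
    define \<psi> where "\<psi> = inv_into (fst c) (snd c) \<circ> \<zeta>"
    define \<Gamma>1 where "\<Gamma>1 = inv_into (fst c1) (snd c1) \<circ> \<gamma>1"
    define \<Gamma>2 where "\<Gamma>2 = inv_into (fst c2) (snd c2) \<circ> \<gamma>2"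
    have ab: "a < b" "c' < d" using fg[OF U0(3)] by auto
    have lp: "local_parametrisation B ({a<..<b} \<times> {c'<..<d}) \<psi>"
      unfolding \<psi>_def
    proof (rule parametrisation_from_chart[OF B c(1) U0(1) _ sfg _ s\<zeta>])
      show "U0 \<subseteq> snd c ` fst c" using U0(2) U'U Uc by blast
      show "open ({a<..<b} \<times> {c'<..<d})" by (simp add: open_Times)
    qed (use fg z in auto)
    have p: "p \<in> \<psi> ` ({a<..<b} \<times> {c'<..<d})"
    proof
      show "p = \<psi> (f x0, g x0)" using fg[OF U0(3)] chart_inverse(1)[OF chc c(2)] by (simp add: \<psi>_def x0_def)
      show "(f x0, g x0) \<in> {a<..<b} \<times> {c'<..<d}" using fg[OF U0(3)] by simp
    qed
    have \<Phi>: "\<Phi> (\<psi> (s, t)) = (\<Gamma>1 s, \<Gamma>2 t)" if st: "s \<in> {a<..<b}" "t \<in> {c'<..<d}" for s t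
    proof -
      note zz = z[OF st]
      obtain y where y: "y \<in> fst c" "\<zeta> (s, t) = snd c y" "fst (\<Phi> y) \<in> fst c1" "snd (\<Phi> y) \<in> fst c2"
        "F (\<zeta> (s, t)) = (snd c1 (fst (\<Phi> y)), snd c2 (snd (\<Phi> y)))"
        using Fx[of "\<zeta> (s, t)"] zz U0(2) U'U by blast
      have "F (\<zeta> (s, t)) = (\<gamma>1 s, \<gamma>2 t)" using F zz by simp
      then have "\<gamma>1 s = snd c1 (fst (\<Phi> y))" "\<gamma>2 t = snd c2 (snd (\<Phi> y))" using y(5) by simp_all
      then show ?thesis
        using y chart_inverse(1)[OF chc] chart_inverse(1)[OF ch1] chart_inverse(1)[OF ch2]
        by (simp add: \<psi>_def \<Gamma>1_def \<Gamma>2_def)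
    qed
    have r1: "regular_nonnull_curve A1 g1 \<Gamma>1 {a<..<b}" "constant_curvature A1 g1 \<Gamma>1 {a<..<b}"
      unfolding \<Gamma>1_def using \<gamma>1(2) n1(3) k1
      by (auto intro!: curve_from_chart[OF A1 c1(1) refl ab(1) \<gamma>1(1) _ \<eta>1])
    have r2: "regular_nonnull_curve A2 g2 \<Gamma>2 {c'<..<d}" "constant_curvature A2 g2 \<Gamma>2 {c'<..<d}"
      unfolding \<Gamma>2_def using \<gamma>2(2) n2(3) k2
      by (auto intro!: curve_from_chart[OF A2 c2(1) refl ab(2) \<gamma>2(1) _ \<eta>2])
    have oi: "open_interval {a<..<b}" "open_interval {c'<..<d}"
      using ab by (simp_all add: open_interval_def is_interval_oo)
    show ?thesis
      by (intro exI[of _ "{a<..<b}"] exI[of _ "{c'<..<d}"] exI[of _ \<psi>] exI[of _ \<Gamma>1] exI[of _ \<Gamma>2] conjI ballI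
        oi lp p \<Phi> r1 r2)
  qed
qed

end
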